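(* Let $E$ be a graph and $w\in\mathrm{reg}(E)$ a vertex that does not emit a loop. Let $E_L$ and $E_R$ be formed by performing a balanced in-split of $E$ at $w$, with respect to partitions $\mathcal L_1,\dots,\mathcal L_n$ and $\mathcal R_1,\dots,\mathcal R_n$ of $t_E^{-1}(w)$, respectively, and let $\phi_*\colon C^*(E_L)\to C^*(E_R)$ be the $*$-homomorphism given by $\phi_*(S_{v^i})=S_{v^i}$ for $v^i\in E_L^0$ and $$\phi_*(S_{e^i})=\begin{cases}S_{e^i}& t_E(e)\neq w\\ S_{e^i}\sum_{f\in s_E^{-1}(w)}S_{f^k}S_{f^j}^*& t_E(e)=w,\ e\in\mathcal L_j\cap\mathcal R_k\end{cases}$$ for $e^i\in E_L^1$. Then there exist a multi-out-split $E_{\widehat L}$ of $E_L$, with multi-out-split homomorphism $g\colon E_{\widehat L}\to E_L$, and a regular extended path homomorphism $\xi\colon S(E_{\widehat L})\to S(E_R)$ such that $\phi_*$ decomposes as $$C^*(E_L)\xrightarrow{\ g^*\ }C^*(E_{\widehat L})\xrightarrow{\ \xi_*\ }C^*(E_R).$$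
   Context: A graph $E=(E^0,E^1,s_E,t_E)$ consists of arbitrary sets of vertices and edges with source and target maps. A vertex $v$ is regular if $s_E^{-1}(v)$ is finite and nonempty; $\mathrm{reg}(E)$ is the set of regular vertices. A loop is an edge with equal source and target. $\mathrm{FP}(E)$ is the set of finite paths (vertices, of length $0$, and sequences $e_1\ldots e_n$ of edges with $t_E(e_i)=s_E(e_{i+1})$); vertices act as units for concatenation. In-split of $E$ at a regular vertex $w$ with respect to a partition of $t_E^{-1}(w)$ into a finite disjoint union of (possibly empty) sets $\epsilon_1,\dots,\epsilon_n$: the graph $E_I$ with $E_I^0=\{v^1\mid v\in E^0,v\ne w\}\sqcup\{w^1,\dots,w^n\}$, $E_I^1=\{e^1\mid e\in E^1,s_E(e)\neq w\}\sqcup\{e^i\mid s_E(e)=w,1\le i\le n\}$, $s_{E_I}(e^i)=s_E(e)^i$, and $t_{E_I}(e^i)=t_E(e)^1$ if $t_E(e)\ne w$, $t_{E_I}(e^i)=w^j$ if $t_E(e)=w$ and $e\in\epsilon_j$. A balanced in-split of $E$ at $w$ is a pair $E_L,E_R$ of in-splits of $E$ at $w$ with respect to partitions $\mathcal L_1,\dots,\mathcal L_n$ and $\mathcal R_1,\dots,\mathcal R_n$ with the same number $n$ of (possibly empty) sets. Vertices and edges of $E_L$ and $E_R$ are denoted by the same symbols $v^i$, $e^i$, although the targets of edges may differ. Multi-out-split of a graph $E$: for every $v\in E^0$ emitting at least one edge, partition $s_E^{-1}(v)$ into finitely many nonempty disjoint sets $\epsilon_v^1,\dots,\epsilon_v^{m(v)}$,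 $m(v)\ge1$, at most one of them infinite; for sinks put $m(v)=1$. The multi-out-split $E_O$ is $E_O^0=\{v^i\mid v\in E^0,1\le i\le m(v)\}$, $E_O^1=\{e^i\mid e\in E^1,1\le i\le m(t_E(e))\}$, $s_{E_O}(e^i)=s_E(e)^j$ for $e\in\epsilon^j_{s_E(e)}$, $t_{E_O}(e^i)=t_E(e)^i$. The multi-out-split homomorphism is $E_O\to E$, $v^i\mapsto v$, $e^i\mapsto e$. A multi-out-split homomorphism $h\colon G\to H$ induces the $*$-homomorphism $h^*\colon C^*(H)\to C^*(G)$, $S_v\mapsto\sum_{u\in h^{-1}(v)}S_u$, $S_e\mapsto\sum_{x\in h^{-1}(e)}S_x$. $C^*(E)$ is the universal C*-algebra generated by mutually orthogonal projections $S_v$ ($v\in E^0$) and elements $S_e$ ($e\in E^1$) with $S_e^*S_{e'}=\delta_{e,e'}S_{t_E(e)}$, $S_{s_E(e)}S_e=S_e$, and $S_v=\sum_{e\in s_E^{-1}(v)}S_eS_e^*$ for $v\in\mathrm{reg}(E)$. For paths, $S_{e_1\ldots e_n}=S_{e_1}\cdots S_{e_n}$; put $S_{(\alpha,\beta)}=S_\alpha S_\beta^*$, $S_0=0$. It is known that $\phi_*$ in the claim is a well-defined $*$-isomorphism. The graph inverse semigroup is $S(E)=\{(\alpha,\beta)\in \mathrm{FP}(E)^2\mid t_E(\alpha)=t_E(\beta)\}\cup\{0\}$ with $(\alpha,\beta)(\gamma,\delta)=(\alpha\gamma',\delta)$ if $\gamma=\beta\gamma'$, $=(\alpha,\delta\beta')$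 if $\beta=\gamma\beta'$, and $=0$ otherwise; $0$ is a zero element; $(\alpha,\beta)^*=(\beta,\alpha)$; $s\le t\iff ss^*t=s$. An extended path homomorphism from $E$ to $F$ is a semigroup homomorphism $\varphi\colon S(E)\to S(F)$ with $\varphi(0)=0$; it is regular if whenever $u\in\mathrm{reg}(E)$, $0\ne t\in S(F)$ and $t\le\varphi(u,u)$, there exists $e\in s_E^{-1}(u)$ with $t\varphi(e,e)\neq0$. A regular $\varphi$ induces the $*$-homomorphism $\varphi_*\colon C^*(E)\to C^*(F)$, $S_v\mapsto S_{\varphi(v,v)}$, $S_e\mapsto S_{\varphi(e,t_E(e))}$. *)

theory Defs
  imports
    "HOL-Library.Poly_Mapping"
    "HOL-Library.Disjoint_Sets"
    "HOL-Library.Sublist"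
    "HOL-Library.FuncSet"
    "HOL-Algebra.FiniteProduct"
    "Graph_Theory.Digraph"
    "Graph_Theory.Arc_Walk"
    Complex_Main
begin

section \<open>Directed graphs, in-splits and multi-out-splits\<close>

text \<open>
  A graph is a \<^locale>\<open>wf_digraph\<close>: arbitrary (possibly infinite) vertex and arc sets, loops and
  parallel arcs allowed. The source map is \<^const>\<open>tail\<close>, the target map is \<^const>\<open>head\<close>.
\<close>

definition reg :: "('v, 'e) pre_digraph \<Rightarrow> 'v set" where
  "reg G = {v \<in> verts G. finite (out_arcs G v) \<and> out_arcs G v \<noteq> {}}"

definition in_partition :: "('v, 'e) pre_digraph \<Rightarrow> 'v \<Rightarrow> nat \<Rightarrow> (nat \<Rightarrow> 'e set) \<Rightarrow> bool" where
  "in_partition G w n P \<longleftrightarrow>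
     (\<Union>i\<in>{1..n}. P i) = in_arcs G w \<and> disjoint_family_on P {1..n}"

text \<open>The pair \<open>(x, i)\<close> stands for the copy \<open>x\<^sup>i\<close> of a vertex or an arc \<open>x\<close>.\<close>

definition in_split ::
  "('v, 'e) pre_digraph \<Rightarrow> 'v \<Rightarrow> nat \<Rightarrow> (nat \<Rightarrow> 'e set) \<Rightarrow> ('v \<times> nat, 'e \<times> nat) pre_digraph" where
  "in_split G w n P =
     \<lparr>verts = {(v, 1) | v. v \<in> verts G \<and> v \<noteq> w} \<union> {(w, i) | i. i \<in> {1..n}},
      arcs = {(e, 1) | e. e \<in> arcs G \<and> tail G e \<noteq> w} \<union>
             {(e, i) | e i. e \<in> arcs G \<and> tail G e = w \<and> i \<in> {1..n}},
      tail = (\<lambda>(e, i). (tail G e, i)),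
      head = (\<lambda>(e, i). if head G e \<noteq> w then (head G e, 1)
                       else (w, THE j. j \<in> {1..n} \<and> e \<in> P j))\<rparr>"

definition multi_out_partition ::
  "('v, 'e) pre_digraph \<Rightarrow> ('v \<Rightarrow> nat) \<Rightarrow> ('v \<Rightarrow> nat \<Rightarrow> 'e set) \<Rightarrow> bool" where
  "multi_out_partition G m P \<longleftrightarrow>
     (\<forall>v\<in>verts G.
        if out_arcs G v = {} then m v = 1
        else 1 \<le> m v
           \<and> (\<Union>i\<in>{1..m v}. P v i) = out_arcs G v
           \<and> disjoint_family_on (P v) {1..m v}
           \<and> (\<forall>i\<in>{1..m v}. P v i \<noteq> {})
           \<and> (\<forall>i\<in>{1..m v}. \<forall>j\<in>{1..m v}. infinite (P v i) \<and> infinite (P v j) \<longrightarrow> i = j))"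

definition multi_out_split ::
  "('v, 'e) pre_digraph \<Rightarrow> ('v \<Rightarrow> nat) \<Rightarrow> ('v \<Rightarrow> nat \<Rightarrow> 'e set) \<Rightarrow>
     ('v \<times> nat, 'e \<times> nat) pre_digraph" where
  "multi_out_split G m P =
     \<lparr>verts = {(v, i). v \<in> verts G \<and> i \<in> {1..m v}},
      arcs = {(e, i). e \<in> arcs G \<and> i \<in> {1..m (head G e)}},
      tail = (\<lambda>(e, i). (tail G e, THE j. j \<in> {1..m (tail G e)} \<and> e \<in> P (tail G e) j)),
      head = (\<lambda>(e, i). (head G e, i))\<rparr>"

text \<open>
  A graph homomorphism is a pair of a vertex map and an arc map.
\<close>

definition multi_out_split_hom :: "('v \<times> nat \<Rightarrow> 'v) \<times> ('e \<times> nat \<Rightarrow> 'e)" where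
  "multi_out_split_hom = (fst, fst)"

section \<open>Algebras with involution and norm\<close>

record 'a cstar_alg = "'a partial_object" +
  czero :: 'a
  cadd :: "'a \<Rightarrow> 'a \<Rightarrow> 'a"
  cmult :: "'a \<Rightarrow> 'a \<Rightarrow> 'a"
  cscale :: "complex \<Rightarrow> 'a \<Rightarrow> 'a"
  cstar :: "'a \<Rightarrow> 'a"
  cnorm :: "'a \<Rightarrow> real"

definition csum :: "'a cstar_alg \<Rightarrow> ('i \<Rightarrow> 'a) \<Rightarrow> 'i set \<Rightarrow> 'a" where
  "csum A f I = finprod \<lparr>carrier = carrier A, monoid.mult = cadd A, one = czero A\<rparr> f I"

definition star_hom :: "'a cstar_alg \<Rightarrow> 'b cstar_alg \<Rightarrow> ('a \<Rightarrow> 'b) \<Rightarrow> bool" where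
  "star_hom A B h \<longleftrightarrow>
     h \<in> carrier A \<rightarrow> carrier B \<and>
     (\<forall>a\<in>carrier A. \<forall>b\<in>carrier A. h (cadd A a b) = cadd B (h a) (h b)) \<and>
     (\<forall>a\<in>carrier A. \<forall>b\<in>carrier A. h (cmult A a b) = cmult B (h a) (h b)) \<and>
     (\<forall>c. \<forall>a\<in>carrier A. h (cscale A c a) = cscale B c (h a)) \<and>
     (\<forall>a\<in>carrier A. h (cstar A a) = cstar B (h a))"

section \<open>The universal C*-algebra of a set of generators and relations\<close>

text \<open>
  Words in the symbols \<open>x\<close> (encoded \<open>(x, False)\<close>) and \<open>x\<^sup>*\<close> (encoded \<open>(x, True)\<close>). They form the
  free monoid, written additively because the product of \<^typ>\<open>('a, 'b) poly_mapping\<close> is convolution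
  with respect to \<open>+\<close>; thus finitely supported functions from words to the complex numbers form the
  free unital algebra.
\<close>

datatype 'x star_word = Word (letters: "('x \<times> bool) list")

instantiation star_word :: (type) monoid_add
begin

definition "0 = Word []"

definition "u + v = Word (letters u @ letters v)"

instance
  by standard (simp_all add: zero_star_word_def plus_star_word_def)

end

type_synonym 'x star_poly = "'x star_word \<Rightarrow>\<^sub>0 complex"

definition word_star :: "'x star_word \<Rightarrow> 'x star_word" where
  "word_star u = Word (rev (map (\<lambda>(x, b). (x, \<not> b)) (letters u)))"

definition poly_star :: "'x star_poly \<Rightarrow> 'x star_poly" where
  "poly_star p =
     (\<Sum>u\<in>Poly_Mapping.keys p.
        Poly_Mapping.single (word_star u) (cnj (Poly_Mapping.lookup p u)))"

definition poly_scale :: "complex \<Rightarrow> 'x star_poly \<Rightarrow> 'x star_poly" where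
  "poly_scale c p = Poly_Mapping.map ((*) c) p"

definition poly_gen :: "'x \<Rightarrow> 'x star_poly" where
  "poly_gen x = Poly_Mapping.single (Word [(x, False)]) 1"

text \<open>
  The free (non-unital) *-algebra on the generators \<open>X\<close>: no constant term.
\<close>

definition free_star_alg :: "'x set \<Rightarrow> 'x star_poly set" where
  "free_star_alg X =
     {p. \<forall>u\<in>Poly_Mapping.keys p. letters u \<noteq> [] \<and> fst ` set (letters u) \<subseteq> X}"

definition cstar_seminorm :: "'x set \<Rightarrow> ('x star_poly \<Rightarrow> real) \<Rightarrow> bool" where
  "cstar_seminorm X N \<longleftrightarrow>
     (\<forall>p\<in>free_star_alg X. 0 \<le> N p) \<and>
     (\<forall>p\<in>free_star_alg X. \<forall>q\<in>free_star_alg X. N (p + q) \<le> N p + N q) \<and>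
     (\<forall>c. \<forall>p\<in>free_star_alg X. N (poly_scale c p) = cmod c * N p) \<and>
     (\<forall>p\<in>free_star_alg X. \<forall>q\<in>free_star_alg X. N (p * q) \<le> N p * N q) \<and>
     (\<forall>p\<in>free_star_alg X. N (poly_star p * p) = (N p)\<^sup>2)"

text \<open>
  A relation is an element of the free *-algebra that is required to vanish. The universal
  C*-algebra is the Hausdorff completion of the free *-algebra with respect to the largest
  C*-seminorm that annihilates the relations (the supremum is finite for the graph relations below,
  which force the generators to be partial isometries).
\<close>

definition universal_seminorm :: "'x set \<Rightarrow> 'x star_poly set \<Rightarrow> 'x star_poly \<Rightarrow> real" where
  "universal_seminorm X R p = (SUP N \<in> {N. cstar_seminorm X N \<and> (\<forall>r\<in>R. N r = 0)}. N p)"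

definition cauchy_seqs :: "'x set \<Rightarrow> 'x star_poly set \<Rightarrow> (nat \<Rightarrow> 'x star_poly) set" where
  "cauchy_seqs X R =
     {s. (\<forall>i. s i \<in> free_star_alg X) \<and>
         (\<forall>\<epsilon>>0. \<exists>K. \<forall>i\<ge>K. \<forall>j\<ge>K. universal_seminorm X R (s i - s j) < \<epsilon>)}"

definition null_rel ::
  "'x set \<Rightarrow> 'x star_poly set \<Rightarrow> ((nat \<Rightarrow> 'x star_poly) \<times> (nat \<Rightarrow> 'x star_poly)) set" where
  "null_rel X R =
     {(s, t). s \<in> cauchy_seqs X R \<and> t \<in> cauchy_seqs X R \<and>
              (\<lambda>i. universal_seminorm X R (s i - t i)) \<longlonglongrightarrow> 0}"

type_synonym 'x univ_elt = "(nat \<Rightarrow> 'x star_poly) set"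

definition universal_class ::
  "'x set \<Rightarrow> 'x star_poly set \<Rightarrow> (nat \<Rightarrow> 'x star_poly) \<Rightarrow> 'x univ_elt" where
  "universal_class X R s = null_rel X R `` {s}"

definition universal_cstar :: "'x set \<Rightarrow> 'x star_poly set \<Rightarrow> 'x univ_elt cstar_alg" where
  "universal_cstar X R =
     \<lparr>carrier = cauchy_seqs X R // null_rel X R,
      czero = universal_class X R (\<lambda>i. 0),
      cadd = (\<lambda>a b. \<Union>s\<in>a. \<Union>t\<in>b. universal_class X R (\<lambda>i. s i + t i)),
      cmult = (\<lambda>a b. \<Union>s\<in>a. \<Union>t\<in>b. universal_class X R (\<lambda>i. s i * t i)),
      cscale = (\<lambda>c a. \<Union>s\<in>a. universal_class X R (\<lambda>i. poly_scale c (s i))),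
      cstar = (\<lambda>a. \<Union>s\<in>a. universal_class X R (\<lambda>i. poly_star (s i))),
      cnorm = (\<lambda>a. the_elem ((\<lambda>s. lim (\<lambda>i. universal_seminorm X R (s i))) ` a))\<rparr>"

definition universal_gen :: "'x set \<Rightarrow> 'x star_poly set \<Rightarrow> 'x \<Rightarrow> 'x univ_elt" where
  "universal_gen X R x = universal_class X R (\<lambda>i. poly_gen x)"

section \<open>Graph C*-algebras\<close>

datatype ('v, 'e) graph_gen = GVert 'v | GArc 'e

abbreviation pv :: "'v \<Rightarrow> ('v, 'e) graph_gen star_poly" where
  "pv v \<equiv> poly_gen (GVert v)"

abbreviation pe :: "'e \<Rightarrow> ('v, 'e) graph_gen star_poly" where
  "pe e \<equiv> poly_gen (GArc e)"

definition graph_gens :: "('v, 'e) pre_digraph \<Rightarrow> ('v, 'e) graph_gen set" where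
  "graph_gens G = GVert ` verts G \<union> GArc ` arcs G"

definition graph_rels :: "('v, 'e) pre_digraph \<Rightarrow> ('v, 'e) graph_gen star_poly set" where
  "graph_rels G =
     {poly_star (pv v) - pv v | v. v \<in> verts G} \<union>
     {pv u * pv v - (if u = v then pv u else 0) | u v. u \<in> verts G \<and> v \<in> verts G} \<union>
     {poly_star (pe e) * pe f - (if e = f then pv (head G e) else 0) | e f.
        e \<in> arcs G \<and> f \<in> arcs G} \<union>
     {pv (tail G e) * pe e - pe e | e. e \<in> arcs G} \<union>
     {pv v - (\<Sum>e\<in>out_arcs G v. pe e * poly_star (pe e)) | v. v \<in> reg G}"

definition graph_cstar ::
  "('v, 'e) pre_digraph \<Rightarrow> ('v, 'e) graph_gen univ_elt cstar_alg" where
  "graph_cstar G = universal_cstar (graph_gens G) (graph_rels G)"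

definition SV :: "('v, 'e) pre_digraph \<Rightarrow> 'v \<Rightarrow> ('v, 'e) graph_gen univ_elt" where
  "SV G v = universal_gen (graph_gens G) (graph_rels G) (GVert v)"

definition SE :: "('v, 'e) pre_digraph \<Rightarrow> 'e \<Rightarrow> ('v, 'e) graph_gen univ_elt" where
  "SE G e = universal_gen (graph_gens G) (graph_rels G) (GArc e)"

text \<open>\<open>h\<^sup>*\<close> for a multi-out-split homomorphism \<open>h\<close> from \<open>G\<close> to \<open>H\<close>.\<close>

definition is_pullback ::
  "('u, 'x) pre_digraph \<Rightarrow> ('v, 'e) pre_digraph \<Rightarrow> ('u \<Rightarrow> 'v) \<times> ('x \<Rightarrow> 'e) \<Rightarrow>
     (('v, 'e) graph_gen univ_elt \<Rightarrow> ('u, 'x) graph_gen univ_elt) \<Rightarrow> bool" where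
  "is_pullback G H h \<Psi> \<longleftrightarrow>
     star_hom (graph_cstar H) (graph_cstar G) \<Psi> \<and>
     (\<forall>v\<in>verts H. \<Psi> (SV H v) = csum (graph_cstar G) (SV G) {u \<in> verts G. fst h u = v}) \<and>
     (\<forall>e\<in>arcs H. \<Psi> (SE H e) = csum (graph_cstar G) (SE G) {x \<in> arcs G. snd h x = e})"

section \<open>Graph inverse semigroups and extended path homomorphisms\<close>

text \<open>
  A finite path is a pair of its initial vertex and its list of arcs; \<open>(v, [])\<close> is the vertex \<open>v\<close>
  as a path of length 0.
\<close>

type_synonym ('v, 'e) path = "'v \<times> 'e list"

definition FP :: "('v, 'e) pre_digraph \<Rightarrow> ('v, 'e) path set" where
  "FP G = {(u, p). \<exists>v. pre_digraph.awalk G u p v}"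

definition path_target :: "('v, 'e) pre_digraph \<Rightarrow> ('v, 'e) path \<Rightarrow> 'v" where
  "path_target G \<alpha> = last (pre_digraph.awalk_verts G (fst \<alpha>) (snd \<alpha>))"

definition vpath :: "'v \<Rightarrow> ('v, 'e) path" where
  "vpath v = (v, [])"

definition epath :: "('v, 'e) pre_digraph \<Rightarrow> 'e \<Rightarrow> ('v, 'e) path" where
  "epath G e = (tail G e, [e])"

text \<open>\<^const>\<open>None\<close> is the zero element.\<close>

type_synonym ('v, 'e) gis = "(('v, 'e) path \<times> ('v, 'e) path) option"

definition gis_carrier :: "('v, 'e) pre_digraph \<Rightarrow> ('v, 'e) gis set" where
  "gis_carrier G =
     insert None
       {Some (\<alpha>, \<beta>) | \<alpha> \<beta>. \<alpha> \<in> FP G \<and> \<beta> \<in> FP G \<and> path_target G \<alpha> = path_target G \<beta>}"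

text \<open>
  \<open>path_ext \<beta> \<gamma>\<close> says that \<open>\<gamma> = \<beta>\<gamma>'\<close> for a path \<open>\<gamma>'\<close>, and then \<open>path_app \<alpha> \<beta> \<gamma>\<close> is \<open>\<alpha>\<gamma>'\<close>. The
  initial vertices have to be compared because \<open>\<beta>\<close> may be a vertex.
\<close>

definition path_ext :: "('v, 'e) path \<Rightarrow> ('v, 'e) path \<Rightarrow> bool" where
  "path_ext \<beta> \<gamma> \<longleftrightarrow> fst \<beta> = fst \<gamma> \<and> prefix (snd \<beta>) (snd \<gamma>)"

definition path_app :: "('v, 'e) path \<Rightarrow> ('v, 'e) path \<Rightarrow> ('v, 'e) path \<Rightarrow> ('v, 'e) path" where
  "path_app \<alpha> \<beta> \<gamma> = (fst \<alpha>, snd \<alpha> @ drop (length (snd \<beta>)) (snd \<gamma>))"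

fun gis_mult :: "('v, 'e) gis \<Rightarrow> ('v, 'e) gis \<Rightarrow> ('v, 'e) gis" where
  "gis_mult (Some (\<alpha>, \<beta>)) (Some (\<gamma>, \<delta>)) =
     (if path_ext \<beta> \<gamma> then Some (path_app \<alpha> \<beta> \<gamma>, \<delta>)
      else if path_ext \<gamma> \<beta> then Some (\<alpha>, path_app \<delta> \<gamma> \<beta>)
      else None)"
| "gis_mult _ _ = None"

fun gis_inv :: "('v, 'e) gis \<Rightarrow> ('v, 'e) gis" where
  "gis_inv (Some (\<alpha>, \<beta>)) = Some (\<beta>, \<alpha>)"
| "gis_inv None = None"

definition gis_le :: "('v, 'e) gis \<Rightarrow> ('v, 'e) gis \<Rightarrow> bool" where
  "gis_le s t \<longleftrightarrow> gis_mult (gis_mult s (gis_inv s)) t = s"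

definition ext_path_hom ::
  "('u, 'x) pre_digraph \<Rightarrow> ('v, 'e) pre_digraph \<Rightarrow> (('u, 'x) gis \<Rightarrow> ('v, 'e) gis) \<Rightarrow> bool" where
  "ext_path_hom G H \<phi> \<longleftrightarrow>
     \<phi> \<in> gis_carrier G \<rightarrow> gis_carrier H \<and>
     (\<forall>s\<in>gis_carrier G. \<forall>t\<in>gis_carrier G. \<phi> (gis_mult s t) = gis_mult (\<phi> s) (\<phi> t)) \<and>
     \<phi> None = None"

definition regular_ext_path_hom ::
  "('u, 'x) pre_digraph \<Rightarrow> ('v, 'e) pre_digraph \<Rightarrow> (('u, 'x) gis \<Rightarrow> ('v, 'e) gis) \<Rightarrow> bool" where
  "regular_ext_path_hom G H \<phi> \<longleftrightarrow>
     ext_path_hom G H \<phi> \<and>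
     (\<forall>u\<in>reg G. \<forall>t\<in>gis_carrier H.
        t \<noteq> None \<and> gis_le t (\<phi> (Some (vpath u, vpath u))) \<longrightarrow>
        (\<exists>e\<in>out_arcs G u. gis_mult t (\<phi> (Some (epath G e, epath G e))) \<noteq> None))"

fun S_path :: "('v, 'e) pre_digraph \<Rightarrow> ('v, 'e) path \<Rightarrow> ('v, 'e) graph_gen univ_elt" where
  "S_path G (v, []) = SV G v"
| "S_path G (v, [e]) = SE G e"
| "S_path G (v, e # f # p) = cmult (graph_cstar G) (SE G e) (S_path G (head G e, f # p))"

fun S_gis :: "('v, 'e) pre_digraph \<Rightarrow> ('v, 'e) gis \<Rightarrow> ('v, 'e) graph_gen univ_elt" where
  "S_gis G (Some (\<alpha>, \<beta>)) =
     cmult (graph_cstar G) (S_path G \<alpha>) (cstar (graph_cstar G) (S_path G \<beta>))"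
| "S_gis G None = czero (graph_cstar G)"

text \<open>\<open>\<phi>\<^sub>*\<close> for a regular extended path homomorphism \<open>\<phi>\<close> from \<open>G\<close> to \<open>H\<close>.\<close>

definition is_pushforward ::
  "('u, 'x) pre_digraph \<Rightarrow> ('v, 'e) pre_digraph \<Rightarrow> (('u, 'x) gis \<Rightarrow> ('v, 'e) gis) \<Rightarrow>
     (('u, 'x) graph_gen univ_elt \<Rightarrow> ('v, 'e) graph_gen univ_elt) \<Rightarrow> bool" where
  "is_pushforward G H \<phi> \<Psi> \<longleftrightarrow>
     star_hom (graph_cstar G) (graph_cstar H) \<Psi> \<and>
     (\<forall>v\<in>verts G. \<Psi> (SV G v) = S_gis H (\<phi> (Some (vpath v, vpath v)))) \<and>
     (\<forall>e\<in>arcs G. \<Psi> (SE G e) = S_gis H (\<phi> (Some (epath G e, vpath (head G e)))))"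

section \<open>The homomorphism of a balanced in-split\<close>

definition is_balanced_in_split_hom ::
  "('v, 'e) pre_digraph \<Rightarrow> 'v \<Rightarrow> nat \<Rightarrow> (nat \<Rightarrow> 'e set) \<Rightarrow> (nat \<Rightarrow> 'e set) \<Rightarrow>
     (('v \<times> nat, 'e \<times> nat) graph_gen univ_elt \<Rightarrow> ('v \<times> nat, 'e \<times> nat) graph_gen univ_elt) \<Rightarrow>
     bool" where
  "is_balanced_in_split_hom E w n L R \<Phi> \<longleftrightarrow>
     (let EL = in_split E w n L; ER = in_split E w n R; A = graph_cstar ER in
       star_hom (graph_cstar EL) A \<Phi> \<and>
       (\<forall>x\<in>verts EL. \<Phi> (SV EL x) = SV ER x) \<and>
       (\<forall>e i. (e, i) \<in> arcs EL \<and> head E e \<noteq> w \<longrightarrow> \<Phi> (SE EL (e, i)) = SE ER (e, i)) \<and>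
       (\<forall>e i j k. (e, i) \<in> arcs EL \<and> head E e = w \<and>
            j \<in> {1..n} \<and> k \<in> {1..n} \<and> e \<in> L j \<inter> R k \<longrightarrow>
          \<Phi> (SE EL (e, i)) =
            cmult A (SE ER (e, i))
              (csum A (\<lambda>f. cmult A (SE ER (f, k)) (cstar A (SE ER (f, j))))
                 (out_arcs E w))))"

end

theory Submission
  imports Defs "HOL-Library.Function_Algebras"
begin

text \<open>
  Split every copy \<open>w\<^sup>j\<close> of \<open>w\<close> in \<open>E\<^sub>L\<close> along its single arcs \<open>f\<^sup>j\<close>. The sum
  \<open>S\<^bsub>e\<^esub> \<Sum> S\<^bsub>f^k\<^esub> S\<^bsub>f^j\<^esub>\<^sup>*\<close> is then distributed over the copies of \<open>e\<close> in the
  multi-out-split, and each copy is sent to one element of the graph inverse semigroup. Thus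
  \<open>\<xi>\<close> is \<open>(\<alpha>, \<beta>) \<mapsto> (A \<alpha>, A \<beta>)\<close> for a map \<open>A\<close> of paths that preserves and reflects
  comparability in the prefix order, so it is multiplicative.

  The two *-homomorphisms agree on generators, hence everywhere, because a C*-seminorm on a
  C*-algebra is dominated by the norm: if \<open>a\<close> is self-adjoint of norm less than 1, then
  \<open>a + \<i>\<surd>(1 - a\<^sup>2)\<close> is unitary, so the seminorm of \<open>a\<close> is at most 1.
\<close>

section \<open>C*-seminorms\<close>

text \<open>Since \<open>star_hom\<close> asserts nothing about continuity, agreement on generators
  passes by itself only to a dense *-subalgebra. The missing bound compares a C*-seminorm with the
  norm, and it is obtained without spectral theory: the square root comes from an iteration carried
  out on Cauchy sequences.

  On the graph side the obstacle is that an element of S(E_R) stands for one product S_\<alpha>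
  S_\<beta>^*, whereas \<phi>_* sends S_e with t(e) = w to a sum over all arcs leaving w. A vertex
  of the split graph over w^j emits a single arc f^j, and its projection goes to S_{f^j} S_{f^j}^*.
  A copy of e ending there also knows which f comes next, so for e in L_j and R_k it goes to S_{e
  f^k} S_{f^j}^*. For this to be an element of S(E_R), f^k and f^j must have the same target. That
  is where the absence of loops at w enters: both arcs end in t(f)^1. The two partitions are thus
  felt only in the copy numbers j and k of the arc f.\<close>

locale star_algebra =
  fixes A :: "'a::ring_1 set" and sc :: "complex \<Rightarrow> 'a \<Rightarrow> 'a" and st :: "'a \<Rightarrow> 'a"
  assumes zero_closed [simp]: "0 \<in> A"
    and add_closed [simp]: "a \<in> A \<Longrightarrow> b \<in> A \<Longrightarrow> a + b \<in> A"
    and mult_closed [simp]: "a \<in> A \<Longrightarrow> b \<in> A \<Longrightarrow> a * b \<in> A"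
    and sc_closed [simp]: "a \<in> A \<Longrightarrow> sc c a \<in> A"
    and st_closed [simp]: "a \<in> A \<Longrightarrow> st a \<in> A"
    and sc_add_right: "sc c (a + b) = sc c a + sc c b"
    and sc_add_left: "sc (c + d) a = sc c a + sc d a"
    and sc_sc: "sc c (sc d a) = sc (c * d) a"
    and sc_one: "sc 1 a = a"
    and sc_mult_left: "sc c a * b = sc c (a * b)"
    and sc_mult_right: "a * sc c b = sc c (a * b)"
    and st_add: "st (a + b) = st a + st b"
    and st_mult: "st (a * b) = st b * st a"
    and st_st: "st (st a) = a"
    and st_sc: "st (sc c a) = sc (cnj c) (st a)"
begin

lemma sc_zero_left [simp]: "sc 0 a = 0"
  using sc_add_left[of 0 0 a] by simp

lemma sc_zero_right [simp]: "sc c 0 = 0"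
  using sc_add_right[of c 0 0] by simp

lemma sc_minus_one: "sc (-1) a = - a"
  using sc_add_left[of "-1" 1 a] by (simp add: sc_one eq_neg_iff_add_eq_0)

lemma minus_closed [simp]: "a \<in> A \<Longrightarrow> - a \<in> A"
  using sc_closed[of a "-1"] by (simp add: sc_minus_one)

lemma diff_closed [simp]: "a \<in> A \<Longrightarrow> b \<in> A \<Longrightarrow> a - b \<in> A"
  using add_closed[of a "- b"] by simp

lemma st_zero [simp]: "st 0 = 0"
  using st_add[of 0 0] by simp

lemma st_minus: "st (- a) = - st a"
  using st_add[of a "- a"] by (simp add: eq_neg_iff_add_eq_0 add.commute)

lemma st_diff: "st (a - b) = st a - st b"
  using st_add[of a "- b"] by (simp add: st_minus)

lemma sc_minus_right: "sc c (- a) = - sc c a"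
  using sc_add_right[of c a "- a"] by (simp add: eq_neg_iff_add_eq_0 add.commute)

lemma sc_diff_right: "sc c (a - b) = sc c a - sc c b"
  using sc_add_right[of c a "- b"] by (simp add: sc_minus_right)

lemma sum_closed [simp]: "(\<And>i. i \<in> I \<Longrightarrow> f i \<in> A) \<Longrightarrow> sum f I \<in> A"
  by (induction I rule: infinite_finite_induct) auto

lemma st_sum: "st (sum f I) = (\<Sum>i\<in>I. st (f i))"
  by (induction I rule: infinite_finite_induct) (auto simp: st_add)

end

text \<open>The norm axioms hold on \<open>A\<close> only, while the laws of
  \<open>star_algebra\<close> hold in the whole ambient ring, so rewriting needs no membership
  premises. The unit of the ring may lie outside \<open>A\<close>: polynomials without constant term
  sit inside all polynomials, and Cauchy sequences of them inside all sequences.\<close>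

locale cstar_seminormed = star_algebra A sc st
  for A :: "'a::ring_1 set" and sc :: "complex \<Rightarrow> 'a \<Rightarrow> 'a" and st :: "'a \<Rightarrow> 'a" +
  fixes N :: "'a \<Rightarrow> real"
  assumes N_nonneg: "a \<in> A \<Longrightarrow> 0 \<le> N a"
    and N_add: "a \<in> A \<Longrightarrow> b \<in> A \<Longrightarrow> N (a + b) \<le> N a + N b"
    and N_sc: "a \<in> A \<Longrightarrow> N (sc c a) = cmod c * N a"
    and N_mult: "a \<in> A \<Longrightarrow> b \<in> A \<Longrightarrow> N (a * b) \<le> N a * N b"
    and N_st_mult: "a \<in> A \<Longrightarrow> N (st a * a) = (N a)\<^sup>2"
begin

lemma N_zero [simp]: "N 0 = 0"
  using N_sc[of 0 0] by simp

lemma N_minus: "a \<in> A \<Longrightarrow> N (- a) = N a"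
  using N_sc[of a "-1"] by (simp add: sc_minus_one)

lemma N_diff_commute: "a \<in> A \<Longrightarrow> b \<in> A \<Longrightarrow> N (a - b) = N (b - a)"
  using N_minus[of "a - b"] by simp

lemma N_diff_triangle:
  "a \<in> A \<Longrightarrow> b \<in> A \<Longrightarrow> c \<in> A \<Longrightarrow> N (a - c) \<le> N (a - b) + N (b - c)"
  using N_add[of "a - b" "b - c"] by simp

lemma N_diff_ineq: "a \<in> A \<Longrightarrow> b \<in> A \<Longrightarrow> \<bar>N a - N b\<bar> \<le> N (a - b)"
  using N_add[of "a - b" b] N_add[of "b - a" a] N_diff_commute[of a b] by auto

text \<open>The C*-identity and submultiplicativity give
  \<open>(N x)\<^sup>2 \<le> N (st x) * N x\<close>; cancel \<open>N x\<close> and use the result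
  for \<open>a\<close> and for \<open>st a\<close>.\<close>

lemma N_st: assumes "a \<in> A" shows "N (st a) = N a"
proof -
  have le: "N x \<le> N (st x)" if "x \<in> A" for x
  proof (cases "N x = 0")
    case False
    have "N x * N x \<le> N (st x) * N x"
      using N_st_mult[OF that] N_mult[of "st x" x] that by (simp add: power2_eq_square)
    then show ?thesis
      using False N_nonneg[OF that] by simp
  qed (use N_nonneg[of "st x"] that in simp)
  show ?thesis
    using le[of a] le[of "st a"] assms by (simp add: st_st)
qed

lemma N_mult_st: "a \<in> A \<Longrightarrow> N (a * st a) = (N a)\<^sup>2"
  using N_st_mult[of "st a"] by (simp add: st_st N_st)

lemma N_mult_le: "a \<in> A \<Longrightarrow> b \<in> A \<Longrightarrow> N a \<le> x \<Longrightarrow> N b \<le> y \<Longrightarrow> N (a * b) \<le> x * y"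
  using N_mult[of a b] mult_mono[of "N a" x "N b" y] N_nonneg[of a] N_nonneg[of b] by linarith

text \<open>Equality in the quotient by the null elements of the seminorm. Membership in
  \<open>A\<close> is built in, so a chain of such steps carries closure along.\<close>

definition null_eq (infix \<open>\<approx>\<close> 50) where
  "a \<approx> b \<longleftrightarrow> a \<in> A \<and> b \<in> A \<and> N (a - b) = 0"

lemma null_eq_refl [simp]: "a \<in> A \<Longrightarrow> a \<approx> a"
  by (simp add: null_eq_def)

lemma null_eq_sym: "a \<approx> b \<Longrightarrow> b \<approx> a"
  by (simp add: null_eq_def N_diff_commute)

lemma null_eq_trans [trans]: "a \<approx> b \<Longrightarrow> b \<approx> c \<Longrightarrow> a \<approx> c"
  using N_diff_triangle[of a b c] N_nonneg[of "a - c"] by (simp add: null_eq_def)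

lemma null_eq_N: "a \<approx> b \<Longrightarrow> N a = N b"
  using N_diff_ineq[of a b] by (simp add: null_eq_def)

lemma null_eq_add: "a \<approx> b \<Longrightarrow> c \<approx> d \<Longrightarrow> a + c \<approx> b + d"
  using N_add[of "a - b" "c - d"] N_nonneg[of "(a + c) - (b + d)"]
  by (simp add: null_eq_def algebra_simps)

lemma null_eq_sc: "a \<approx> b \<Longrightarrow> sc c a \<approx> sc c b"
  using N_sc[of "a - b" c] by (simp add: null_eq_def sc_diff_right)

lemma null_eq_minus: "a \<approx> b \<Longrightarrow> - a \<approx> - b"
  using null_eq_sc[of a b "-1"] by (simp add: sc_minus_one)

lemma null_eq_diff: "a \<approx> b \<Longrightarrow> c \<approx> d \<Longrightarrow> a - c \<approx> b - d"
  using null_eq_add[of a b "- c" "- d"] by (simp add: null_eq_minus)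

lemma null_eq_st: "a \<approx> b \<Longrightarrow> st a \<approx> st b"
  using N_st[of "a - b"] by (simp add: null_eq_def st_diff)

lemma null_eq_mult: assumes "a \<approx> b" "c \<approx> d" shows "a * c \<approx> b * d"
proof -
  have cl: "a \<in> A" "b \<in> A" "c \<in> A" "d \<in> A" and 0: "N (a - b) = 0" "N (c - d) = 0"
    using assms by (auto simp: null_eq_def)
  have "N (a * c - b * d) = N ((a - b) * c + b * (c - d))"
    by (simp add: algebra_simps)
  also have "\<dots> \<le> N (a - b) * N c + N b * N (c - d)"
    using N_add[of "(a - b) * c" "b * (c - d)"] N_mult[of "a - b" c] N_mult[of b "c - d"] cl by simp
  finally show ?thesis
    using N_nonneg[of "a * c - b * d"] cl 0 by (simp add: null_eq_def)
qed

lemma null_eq_sum: "(\<And>i. i \<in> I \<Longrightarrow> f i \<approx> g i) \<Longrightarrow> sum f I \<approx> sum g I"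
  by (induction I rule: infinite_finite_induct) (auto intro: null_eq_add)

lemma null_eq_0_iff: "a \<approx> 0 \<longleftrightarrow> a \<in> A \<and> N a = 0"
  by (auto simp: null_eq_def)

lemma null_eq_diff_0_iff: "a \<in> A \<Longrightarrow> b \<in> A \<Longrightarrow> N (a - b) = 0 \<longleftrightarrow> a \<approx> b"
  by (auto simp: null_eq_def)

text \<open>
  The hypotheses say that \<open>u = a + \<i>(1 - b)\<close> is unitary modulo null elements; as the unit need not
  lie in the algebra, the argument multiplies \<open>u\<close> by \<open>a\<close>.
\<close>

lemma N_le_1_if_part_of_unitary:
  assumes A: "a \<in> A" "b \<in> A" and sa: "st a = a" "st b = b" and comm: "a * b = b * a"
    and null: "a * a + b * b \<approx> b + b"
  shows "N a \<le> 1"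
proof -
  define h where "h = a - a * b"
  define p where "p = a * a + sc \<i> h"
  define d where "d = b + b - (a * a + b * b)"
  have cl: "h \<in> A" "p \<in> A" "d \<in> A"
    using A by (simp_all add: h_def p_def d_def)
  have st_h: "st h = h"
    by (simp add: h_def st_diff st_mult sa comm)
  have st_p: "st p = a * a - sc \<i> h"
  proof -
    have "st p = a * a + sc (- \<i>) h"
      by (simp add: p_def st_add st_mult sa st_sc st_h)
    also have "sc (- \<i>) h = - sc \<i> h"
      using sc_sc[of "-1" \<i> h] by (simp add: sc_minus_one)
    finally show ?thesis by simp
  qed
  have ah: "a * h = h * a"
    by (simp add: h_def algebra_simps comm) (metis comm mult.assoc)
  \<comment> \<open>Here \<open>h\<close> is \<open>a * (1 - b)\<close> and \<open>p\<close> is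
    \<open>a * u\<close>. Since everything commutes, \<open>p * st p\<close> is \<open>a * a\<close>
    times \<open>a * a + (1 - b) * (1 - b)\<close>, and the latter factor is
    \<open>1 - d\<close>.\<close>
  have "p * st p = a * a * (a * a) - sc \<i> (a * a * h) + sc \<i> (h * (a * a)) - sc (\<i> * \<i>) (h * h)"
    by (simp add: st_p) (simp add: p_def ring_distribs sc_mult_left sc_mult_right sc_diff_right
        sc_add_right sc_sc mult.assoc)
  also have "a * a * h = h * (a * a)"
    by (metis ah mult.assoc)
  finally have "p * st p = a * a * (a * a) + h * h"
    by (simp add: sc_minus_one)
  also have "h * h = a * a - a * b * a - a * a * b + a * b * (a * b)"
    by (simp add: h_def algebra_simps)
  also have "a * a * b = a * b * a"
    by (metis comm mult.assoc)
  also have "a * b * (a * b) = a * (b * b) * a"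
    by (metis comm mult.assoc)
  finally have pp: "p * st p = a * a - a * d * a"
    by (simp add: d_def algebra_simps)
  have "d \<approx> 0"
    using null_eq_diff[OF null_eq_refl null, of "b + b"] null_eq_sym[OF null] A
    by (simp add: d_def null_eq_def)
  then have "a * d * a \<approx> 0"
    using null_eq_mult[OF null_eq_mult[OF null_eq_refl[OF A(1)] \<open>d \<approx> 0\<close>] null_eq_refl[OF A(1)]]
    by simp
  then have "p * st p \<approx> a * a"
    unfolding pp using null_eq_diff[of "a * a" "a * a" "a * d * a" 0] A by simp
  then have "(N p)\<^sup>2 = (N a)\<^sup>2"
    using N_mult_st[of p] N_mult_st[of a] null_eq_N[of "p * st p" "a * a"] A cl by (simp add: sa)
  then have Np: "N p = N a"
    using N_nonneg[of p] N_nonneg[of a] A cl by (simp add: power2_eq_iff_nonneg)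
  \<comment> \<open>The self-adjoint part of \<open>p\<close> is \<open>a * a\<close>, so
    \<open>2 * (N a)\<^sup>2 \<le> N p + N (st p) = 2 * N a\<close>, and a nonzero
    \<open>N a\<close> cancels.\<close>
  have "p + st p = sc 2 (a * a)"
    using sc_add_left[of 1 1 "a * a"] by (simp add: st_p) (simp add: p_def sc_one)
  then have "2 * N (a * a) \<le> N p + N (st p)"
    using N_add[of p "st p"] N_sc[of "a * a" 2] A cl by simp
  then have "(N a)\<^sup>2 \<le> N a"
    using N_mult_st[of a] N_st[of p] A cl Np by (simp add: sa)
  then have "N a * N a \<le> 1 * N a"
    by (simp add: power2_eq_square)
  then show ?thesis
    by (cases "0 < N a") (auto dest: mult_right_le_imp_le)
qed

section \<open>Cauchy sequences\<close>

definition cauchy :: "(nat \<Rightarrow> 'a) set" where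
  "cauchy = {s. (\<forall>i. s i \<in> A) \<and> (\<forall>\<epsilon>>0. \<exists>K. \<forall>i\<ge>K. \<forall>j\<ge>K. N (s i - s j) < \<epsilon>)}"

definition lim_norm :: "(nat \<Rightarrow> 'a) \<Rightarrow> real" where
  "lim_norm s = lim (\<lambda>i. N (s i))"

lemma cauchyD: "s \<in> cauchy \<Longrightarrow> s i \<in> A"
  by (simp add: cauchy_def)

lemma cauchyE:
  assumes "s \<in> cauchy" "0 < \<epsilon>"
  obtains K where "\<And>i j. K \<le> i \<Longrightarrow> K \<le> j \<Longrightarrow> N (s i - s j) < \<epsilon>"
  using assms unfolding cauchy_def by blast

lemma cauchy_lim_norm: assumes "s \<in> cauchy" shows "(\<lambda>i. N (s i)) \<longlonglongrightarrow> lim_norm s"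
proof -
  have "Cauchy (\<lambda>i. N (s i))"
  proof (rule metric_CauchyI)
    fix e :: real assume "0 < e"
    then obtain K where K: "\<And>i j. K \<le> i \<Longrightarrow> K \<le> j \<Longrightarrow> N (s i - s j) < e"
      using cauchyE[OF assms] by blast
    have "dist (N (s i)) (N (s j)) < e" if "K \<le> i" "K \<le> j" for i j
      using N_diff_ineq[of "s i" "s j"] K[OF that] cauchyD[OF assms] by (simp add: dist_real_def)
    then show "\<exists>M. \<forall>m\<ge>M. \<forall>n\<ge>M. dist (N (s m)) (N (s n)) < e"
      by blast
  qed
  then show ?thesis
    unfolding lim_norm_def by (simp add: Cauchy_convergent convergent_LIMSEQ_iff[symmetric])
qed

lemma lim_normI: "s \<in> cauchy \<Longrightarrow> (\<lambda>i. N (s i)) \<longlonglongrightarrow> L \<Longrightarrow> lim_norm s = L"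
  using cauchy_lim_norm LIMSEQ_unique by blast

lemma cauchy_bounded: assumes "s \<in> cauchy" obtains B where "0 < B" "\<And>i. N (s i) \<le> B"
proof -
  have "Bseq (\<lambda>i. N (s i))"
    using cauchy_lim_norm[OF assms] by (intro convergent_imp_Bseq convergentI)
  then obtain B where "0 < B" "\<And>i. norm (N (s i)) \<le> B"
    by (auto elim: BseqE)
  then show thesis
    by (intro that[of B]) (auto dest: abs_le_D1)
qed

text \<open>Common criterion for sums, multiples, adjoints and products: each of them varies by at
  most a fixed multiple of the variation of its arguments.\<close>

lemma cauchy_dominated:
  assumes "\<And>i. t i \<in> A" "0 < B" "f \<in> cauchy" "g \<in> cauchy"
    and le: "\<And>i j. N (t i - t j) \<le> B * (N (f i - f j) + N (g i - g j))"
  shows "t \<in> cauchy"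
  unfolding cauchy_def
proof (intro CollectI conjI allI impI assms)
  fix e :: real assume "0 < e"
  then have "0 < e / (2 * B)" using assms by simp
  then obtain K K' where
    K: "\<And>i j. K \<le> i \<Longrightarrow> K \<le> j \<Longrightarrow> N (f i - f j) < e / (2 * B)" and
    K': "\<And>i j. K' \<le> i \<Longrightarrow> K' \<le> j \<Longrightarrow> N (g i - g j) < e / (2 * B)"
    using cauchyE[OF assms(3)] cauchyE[OF assms(4)] by metis
  have "N (t i - t j) < e" if "max K K' \<le> i" "max K K' \<le> j" for i j
  proof -
    have "N (f i - f j) + N (g i - g j) < e / (2 * B) + e / (2 * B)"
      using K[of i j] K'[of i j] that by simp
    also have "\<dots> = e / B" by simp
    finally show ?thesis
      using le[of i j] assms(2) by (simp add: field_simps)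
  qed
  then show "\<exists>K. \<forall>i\<ge>K. \<forall>j\<ge>K. N (t i - t j) < e"
    by blast
qed

lemma cauchy_const: "a \<in> A \<Longrightarrow> (\<lambda>i. a) \<in> cauchy"
  by (simp add: cauchy_def)

lemma lim_norm_const [simp]: "lim_norm (\<lambda>i. a) = N a"
  by (simp add: lim_norm_def)

lemma cauchy_add: assumes "s \<in> cauchy" "t \<in> cauchy" shows "s + t \<in> cauchy"
proof (rule cauchy_dominated[where B = 1 and f = s and g = t])
  fix i j
  show "N ((s + t) i - (s + t) j) \<le> 1 * (N (s i - s j) + N (t i - t j))"
    using N_add[of "s i - s j" "t i - t j"] cauchyD[OF assms(1)] cauchyD[OF assms(2)]
    by (simp add: algebra_simps)
qed (use assms cauchyD in auto)

lemma cauchy_sc: assumes "s \<in> cauchy" shows "(\<lambda>i. sc c (s i)) \<in> cauchy"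
\<comment> \<open>The summand 1 keeps the constant positive when \<open>c = 0\<close>; for a unary
  operation both comparison sequences are \<open>s\<close>.\<close>
proof (rule cauchy_dominated[where B = "cmod c + 1" and f = s and g = s])
  fix i j
  have "N (s i - s j) \<ge> 0"
    using cauchyD[OF assms] by (simp add: N_nonneg)
  then show "N (sc c (s i) - sc c (s j)) \<le> (cmod c + 1) * (N (s i - s j) + N (s i - s j))"
    using N_sc[of "s i - s j" c] cauchyD[OF assms]
    by (simp add: sc_diff_right algebra_simps)
qed (use assms cauchyD in \<open>auto simp: add_nonneg_pos\<close>)

lemma cauchy_st: assumes "s \<in> cauchy" shows "(\<lambda>i. st (s i)) \<in> cauchy"
proof (rule cauchy_dominated[where B = 1 and f = s and g = s])
  fix i j
  show "N (st (s i) - st (s j)) \<le> 1 * (N (s i - s j) + N (s i - s j))"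
    using N_st[of "s i - s j"] N_nonneg[of "s i - s j"] cauchyD[OF assms] by (simp add: st_diff)
qed (use assms cauchyD in auto)

lemma cauchy_mult: assumes "s \<in> cauchy" "t \<in> cauchy" shows "s * t \<in> cauchy"
proof -
  obtain B where B: "0 < B" "\<And>i. N (s i) \<le> B" using cauchy_bounded[OF assms(1)] by blast
  obtain B' where B': "0 < B'" "\<And>i. N (t i) \<le> B'" using cauchy_bounded[OF assms(2)] by blast
  have cl: "\<And>i. s i \<in> A" "\<And>i. t i \<in> A" using assms cauchyD by auto
  show ?thesis
  proof (rule cauchy_dominated[where B = "B + B'" and f = s and g = t])
    fix i j
    have nn: "0 \<le> N (s i - s j)" "0 \<le> N (t i - t j)"
      using cl by (simp_all add: N_nonneg)
    have "(s * t) i - (s * t) j = (s i - s j) * t i + s j * (t i - t j)"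
      by (simp add: algebra_simps)
    also have "N \<dots> \<le> N (s i - s j) * B' + B * N (t i - t j)"
      using N_add[of "(s i - s j) * t i" "s j * (t i - t j)"]
        N_mult_le[of "s i - s j" "t i" "N (s i - s j)" B'] N_mult_le[of "s j" "t i - t j" B]
        B B' cl by fastforce
    also have "\<dots> \<le> (B + B') * (N (s i - s j) + N (t i - t j))"
      using B B' nn by (simp add: algebra_simps)
    finally show "N ((s * t) i - (s * t) j) \<le> (B + B') * (N (s i - s j) + N (t i - t j))" .
  qed (use assms cl B B' in auto)
qed

text \<open>Every law passes to the limit. Hence the locale can be used a second time, one level up,
  where null elements are null sequences and the quotient is the completion.\<close>

lemma cstar_seminormed_cauchy:
  "cstar_seminormed cauchy (\<lambda>c s i. sc c (s i)) (\<lambda>s i. st (s i)) lim_norm"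
proof
  fix s t c
  show "s \<in> cauchy \<Longrightarrow> 0 \<le> lim_norm s"
    by (rule LIMSEQ_le_const[OF cauchy_lim_norm]) (auto intro: N_nonneg cauchyD)
  show "s \<in> cauchy \<Longrightarrow> t \<in> cauchy \<Longrightarrow> lim_norm (s + t) \<le> lim_norm s + lim_norm t"
    by (rule LIMSEQ_le[OF cauchy_lim_norm tendsto_add[OF cauchy_lim_norm cauchy_lim_norm]])
      (auto intro: N_add cauchyD cauchy_add)
  show "s \<in> cauchy \<Longrightarrow> t \<in> cauchy \<Longrightarrow> lim_norm (s * t) \<le> lim_norm s * lim_norm t"
    by (rule LIMSEQ_le[OF cauchy_lim_norm tendsto_mult[OF cauchy_lim_norm cauchy_lim_norm]])
      (auto intro: N_mult cauchyD cauchy_mult)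
  show "lim_norm (\<lambda>i. sc c (s i)) = cmod c * lim_norm s" if "s \<in> cauchy"
    using tendsto_mult_left[OF cauchy_lim_norm[OF that], of "cmod c"] cauchyD[OF that]
    by (intro lim_normI cauchy_sc that) (simp add: N_sc)
  show "lim_norm ((\<lambda>i. st (s i)) * s) = (lim_norm s)\<^sup>2" if "s \<in> cauchy"
    using tendsto_power[OF cauchy_lim_norm[OF that], of 2] cauchyD[OF that]
    by (intro lim_normI cauchy_mult cauchy_st that) (simp add: N_st_mult)
qed (auto intro!: cauchy_add cauchy_mult cauchy_sc cauchy_st ext
      simp: zero_fun_def cauchy_const sc_add_right sc_add_left sc_sc sc_one sc_mult_left
        sc_mult_right st_add st_mult st_st st_sc)

lemma lim_norm_eq_0_iff: "s \<in> cauchy \<Longrightarrow> lim_norm s = 0 \<longleftrightarrow> (\<lambda>i. N (s i)) \<longlonglongrightarrow> 0"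
  using cauchy_lim_norm lim_normI by metis

section \<open>Automatic continuity\<close>

text \<open>
  Iteration for the solution \<open>b = 1 - \<surd>(1 - a\<^sup>2)\<close> of \<open>2 b = a\<^sup>2 + b\<^sup>2\<close>.
\<close>

fun sqrt_iter :: "nat \<Rightarrow> 'a \<Rightarrow> 'a" where
  "sqrt_iter 0 a = 0"
| "sqrt_iter (Suc k) a = sc (1/2) (a * a + sqrt_iter k a * sqrt_iter k a)"

lemma sqrt_iter_closed [simp]: "a \<in> A \<Longrightarrow> sqrt_iter k a \<in> A"
  by (induction k) auto

lemma sqrt_iter_st: "st a = a \<Longrightarrow> st (sqrt_iter k a) = sqrt_iter k a"
  by (induction k) (auto simp: st_sc st_add st_mult)

lemma sqrt_iter_commute: "a * sqrt_iter k a = sqrt_iter k a * a"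
proof (induction k)
  case (Suc k)
  have "a * (sqrt_iter k a * sqrt_iter k a) = sqrt_iter k a * sqrt_iter k a * a"
    using Suc by (metis mult.assoc)
  then show ?case
    by (simp add: sc_mult_left sc_mult_right distrib_left distrib_right mult.assoc)
qed simp

lemma N_square_diff_le:
  assumes "x \<in> A" "y \<in> A" "N x \<le> r" "N y \<le> r"
  shows "N (x * x - y * y) \<le> 2 * r * N (x - y)"
proof -
  have "x * x - y * y = x * (x - y) + (x - y) * y"
    by (simp add: algebra_simps)
  also have "N \<dots> \<le> r * N (x - y) + N (x - y) * r"
    using N_add[of "x * (x - y)" "(x - y) * y"] N_mult_le[of x "x - y" r "N (x - y)"]
      N_mult_le[of "x - y" y "N (x - y)" r] assms
    by (simp add: mult.commute[of r])
  finally show ?thesis by (simp add: mult.assoc)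
qed

lemma N_half: "a \<in> A \<Longrightarrow> N (sc (1/2) a) = N a / 2"
  by (simp add: N_sc)

text \<open>For \<open>r \<le> 1\<close> the ball of radius \<open>r\<close> is invariant under the
  iteration, as the mean of \<open>r * r\<close> and \<open>r * r\<close> is at most
  \<open>r\<close>.\<close>

lemma sqrt_iter_bound:
  assumes "a \<in> A" "N a \<le> r" "r \<le> 1" shows "N (sqrt_iter k a) \<le> r"
proof (induction k)
  case 0
  then show ?case using N_nonneg[of a] assms by simp
next
  case (Suc k)
  have "0 \<le> r" using N_nonneg[of a] assms by simp
  then have "r * r + r * r \<le> 2 * r"
    using assms mult_left_le[of r r] by simp
  then show ?case
    using N_add[of "a * a" "sqrt_iter k a * sqrt_iter k a"] N_mult_le[of a a r r]
      N_mult_le[of "sqrt_iter k a" "sqrt_iter k a" r r] Suc assms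
    by (simp add: N_half)
qed

text \<open>On the ball of radius \<open>r\<close> the map taking \<open>b\<close> to half of
  \<open>a * a + b * b\<close> has Lipschitz constant \<open>r\<close>, so each iteration gains a
  factor \<open>r\<close>. The base case is the bound of the ball itself, because the iteration
  starts at 0.\<close>

lemma sqrt_iter_cauchy:
  assumes a: "a \<in> A" "N a \<le> r" "r \<le> 1"
  shows "N (sqrt_iter (k + d) a - sqrt_iter k a) \<le> r ^ k"
proof (induction k)
  case 0
  then show ?case using sqrt_iter_bound[OF a, of d] assms by simp
next
  case (Suc k)
  let ?x = "sqrt_iter (k + d) a" and ?y = "sqrt_iter k a"
  have "0 \<le> r" using N_nonneg[of a] assms by simp
  have "sqrt_iter (Suc k + d) a - sqrt_iter (Suc k) a = sc (1/2) (?x * ?x - ?y * ?y)"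
    by (simp add: sc_add_right sc_diff_right)
  also have "N \<dots> \<le> r * N (?x - ?y)"
    using N_square_diff_le[of ?x ?y r] sqrt_iter_bound[OF a] a by (simp add: N_half)
  also have "\<dots> \<le> r * r ^ k"
    using Suc \<open>0 \<le> r\<close> by (intro mult_left_mono)
  finally show ?case by simp
qed

text \<open>The constant \<open>c = r / (1 - r)\<close> solves \<open>c = r + r * c\<close>, which
  is exactly what the induction step needs, so it is uniform in \<open>k\<close>.\<close>

lemma sqrt_iter_lipschitz:
  assumes a: "a \<in> A" "N a \<le> r" and b: "b \<in> A" "N b \<le> r" and r: "r < 1"
  shows "N (sqrt_iter k a - sqrt_iter k b) \<le> r / (1 - r) * N (a - b)"
proof (induction k)
  case 0
  have "0 \<le> r" using N_nonneg[of a] assms by simp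
  then show ?case using a b r by (simp add: N_nonneg)
next
  case (Suc k)
  let ?x = "sqrt_iter k a" and ?y = "sqrt_iter k b"
  have "0 \<le> r" using N_nonneg[of a] assms by simp
  have "sqrt_iter (Suc k) a - sqrt_iter (Suc k) b =
      sc (1/2) ((a * a - b * b) + (?x * ?x - ?y * ?y))"
    by (simp add: sc_add_right sc_diff_right)
  also have "N \<dots> \<le> r * N (a - b) + r * N (?x - ?y)"
    using N_add[of "a * a - b * b" "?x * ?x - ?y * ?y"] N_square_diff_le[of a b r]
      N_square_diff_le[of ?x ?y r] sqrt_iter_bound[of a r k] sqrt_iter_bound[of b r k] assms
    by (simp add: N_half)
  also have "\<dots> \<le> r * N (a - b) + r * (r / (1 - r) * N (a - b))"
    using Suc \<open>0 \<le> r\<close> by (intro add_left_mono mult_left_mono)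
  also have "\<dots> = r / (1 - r) * N (a - b)"
    using r by (simp add: field_simps)
  finally show ?case .
qed

text \<open>A diagonal sequence: argument and number of iterations grow together. The change of
  argument is controlled by the uniform Lipschitz constant, the change of iteration number by the
  geometric bound.\<close>

lemma cauchy_sqrt_iter:
  assumes s: "s \<in> cauchy" "\<And>i. N (s i) \<le> r" and r: "r < 1"
  shows "(\<lambda>i. sqrt_iter i (s i)) \<in> cauchy"
proof -
  let ?b = "\<lambda>i. sqrt_iter i (s i)"
  have cl: "\<And>i. s i \<in> A" using s cauchyD by blast
  have r0: "0 \<le> r" using N_nonneg[of "s 0"] s(2)[of 0] cl by simp
  have step: "N (?b i - ?b j) \<le> r / (1 - r) * N (s i - s j) + r ^ j" if "j \<le> i" for i j
  proof -
    have "N (?b i - ?b j) \<le> N (?b i - sqrt_iter i (s j)) + N (sqrt_iter i (s j) - ?b j)"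
      using cl by (intro N_diff_triangle) auto
    then show ?thesis
      using sqrt_iter_lipschitz[of "s i" r "s j" i] sqrt_iter_cauchy[of "s j" r j "i - j"]
        s cl r that by fastforce
  qed
  show ?thesis
    unfolding cauchy_def
  proof (intro CollectI conjI allI impI)
    fix e :: real assume e: "0 < e"
    \<comment> \<open>The summand 1 makes \<open>C\<close> positive even when \<open>r = 0\<close>,
      so that division by \<open>C\<close> is possible.\<close>
    define C where "C = r / (1 - r) + 1"
    have C: "0 < C" "r / (1 - r) \<le> C" using r0 r by (simp_all add: C_def add_nonneg_pos)
    then have "0 < e / (2 * C)" using e by simp
    then obtain K where K: "\<And>i j. K \<le> i \<Longrightarrow> K \<le> j \<Longrightarrow> N (s i - s j) < e / (2 * C)"
      using cauchyE[OF s(1)] by blast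
    have "(\<lambda>k. r ^ k) \<longlonglongrightarrow> 0" using r0 r by (intro LIMSEQ_realpow_zero)
    then obtain K' where K': "\<And>k. K' \<le> k \<Longrightarrow> r ^ k < e / 2"
      using LIMSEQ_D[of "\<lambda>k. r ^ k" 0 "e / 2"] e r0 by auto
    have main: "N (?b i - ?b j) < e" if "j \<le> i" "max K K' \<le> j" for i j
    proof -
      have "r / (1 - r) * N (s i - s j) \<le> C * N (s i - s j)"
        using C cl by (intro mult_right_mono) (auto intro: N_nonneg)
      also have "\<dots> < C * (e / (2 * C))"
        using K[of i j] C that by (intro mult_strict_left_mono) auto
      also have "\<dots> = e / 2" using C by simp
      finally show ?thesis
        using step[OF that(1)] K'[of j] that by linarith
    qed
    show "\<exists>K. \<forall>i\<ge>K. \<forall>j\<ge>K. N (?b i - ?b j) < e"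
    proof (intro exI[of _ "max K K'"] allI impI)
      fix i j assume "max K K' \<le> i" "max K K' \<le> j"
      then show "N (?b i - ?b j) < e"
        using main[of j i] main[of i j] N_diff_commute[of "?b i" "?b j"] cl
        by (cases "j \<le> i") auto
    qed
  qed (use cl in simp)
qed

text \<open>
  As \<^const>\<open>star_hom\<close> is purely algebraic, this is what makes *-homomorphisms contractive.
\<close>

lemma seminorm_le_lim_norm:
  assumes M: "cstar_seminormed cauchy (\<lambda>c s i. sc c (s i)) (\<lambda>s i. st (s i)) M"
    and null: "\<And>s. s \<in> cauchy \<Longrightarrow> lim_norm s = 0 \<Longrightarrow> M s = 0"
    and s: "s \<in> cauchy"
  shows "M s \<le> lim_norm s"
proof -
  interpret C: cstar_seminormed cauchy "\<lambda>c s i. sc c (s i)" "\<lambda>s i. st (s i)" lim_norm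
    by (rule cstar_seminormed_cauchy)
  interpret M: cstar_seminormed cauchy "\<lambda>c s i. sc c (s i)" "\<lambda>s i. st (s i)" M
    by (rule M)
  \<comment> \<open>A bound below 1 on every term lets the iteration converge uniformly along
    \<open>t\<close>. The equation for the square root then holds up to a null sequence, which
    \<open>M\<close> does not see, and the unitary argument applies to \<open>M\<close>.\<close>
  have contraction: "M t \<le> 1"
    if t: "t \<in> cauchy" "\<And>i. st (t i) = t i" "\<And>i. N (t i) \<le> r" "r < 1" for t r
  proof -
    define b where "b = (\<lambda>i. sqrt_iter i (t i))"
    have cl: "\<And>i. t i \<in> A" using t cauchyD by blast
    have r0: "0 \<le> r" using N_nonneg[of "t 0"] t(3)[of 0] cl by simp
    have b: "b \<in> cauchy" unfolding b_def by (rule cauchy_sqrt_iter[OF t(1,3,4)])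
    have "t * t + b * b - (b + b) \<in> cauchy" using t b by simp
    moreover have "(\<lambda>i. N ((t * t + b * b - (b + b)) i)) \<longlonglongrightarrow> 0"
    proof (rule tendsto_sandwich[OF always_eventually always_eventually tendsto_const])
      show "(\<lambda>i. 2 * r ^ i) \<longlonglongrightarrow> 0"
        using tendsto_mult_right_zero[OF LIMSEQ_realpow_zero[OF r0 t(4)]] by simp
      show "\<forall>i. N ((t * t + b * b - (b + b)) i) \<le> 2 * r ^ i"
      proof
        fix i
        let ?x = "sqrt_iter i (t i)" and ?y = "sqrt_iter (Suc i) (t i)"
        have two: "sc 2 x = x + x" for x
          using sc_add_left[of 1 1 x] by (simp add: sc_one)
        \<comment> \<open>The defect of the equation is twice the next step of the iteration, hence
          geometrically small.\<close>
        have "(t * t + b * b - (b + b)) i = sc 2 (?y - ?x)"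
          by (simp add: b_def sc_diff_right sc_sc sc_one) (simp add: two)
        also have "N \<dots> = 2 * N (?y - ?x)"
          using cl by (subst N_sc) auto
        also have "\<dots> \<le> 2 * r ^ i"
          using sqrt_iter_cauchy[of "t i" r i 1] t cl by simp
        finally show "N ((t * t + b * b - (b + b)) i) \<le> 2 * r ^ i" .
      qed
      show "\<forall>i. 0 \<le> N ((t * t + b * b - (b + b)) i)"
        using cl by (auto simp: b_def intro!: N_nonneg)
    qed
    ultimately have "M.null_eq (t * t + b * b) (b + b)"
      using t b null by (simp add: M.null_eq_def lim_norm_eq_0_iff)
    moreover have "(\<lambda>i. st (t i)) = t" "(\<lambda>i. st (b i)) = b" "t * b = b * t"
      using t(2) by (simp_all add: fun_eq_iff b_def sqrt_iter_st sqrt_iter_commute)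
    ultimately show "M t \<le> 1"
      using t b by (intro M.N_le_1_if_part_of_unitary[of t b])
  qed
  have sa1: "M t \<le> 1" if t: "t \<in> cauchy" "\<And>i. st (t i) = t i" and less: "lim_norm t < 1" for t
  proof -
    obtain r where r: "lim_norm t < r" "r < 1" using less dense by blast
    obtain K where K: "\<And>i. K \<le> i \<Longrightarrow> N (t i) < r"
      using order_tendstoD(2)[OF cauchy_lim_norm[OF t(1)] r(1)]
      by (auto simp: eventually_sequentially)
    \<comment> \<open>Only the terms from \<open>K\<close> on are known to be below
      \<open>r\<close>. Dropping the others changes \<open>t\<close> by a null sequence and leaves
      \<open>M\<close> as it is.\<close>
    define t' where "t' = (\<lambda>i. t (i + K))"
    have t': "t' \<in> cauchy"
      unfolding cauchy_def
    proof (intro CollectI conjI allI impI)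
      show "t' i \<in> A" for i by (simp add: t'_def cauchyD[OF t(1)])
      fix e :: real assume "0 < e"
      then obtain L where "\<And>i j. L \<le> i \<Longrightarrow> L \<le> j \<Longrightarrow> N (t i - t j) < e"
        using cauchyE[OF t(1)] by blast
      then show "\<exists>L. \<forall>i\<ge>L. \<forall>j\<ge>L. N (t' i - t' j) < e"
        unfolding t'_def by (intro exI[of _ L]) auto
    qed
    have "(\<lambda>i. N ((t - t') i)) \<longlonglongrightarrow> 0"
    proof (rule LIMSEQ_I)
      fix e :: real assume "0 < e"
      then obtain L where "\<And>i j. L \<le> i \<Longrightarrow> L \<le> j \<Longrightarrow> N (t i - t j) < e"
        using cauchyE[OF t(1)] by blast
      then show "\<exists>L. \<forall>i\<ge>L. norm (N ((t - t') i) - 0) < e"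
        using cauchyD[OF t(1)] by (intro exI[of _ L]) (auto simp: t'_def N_nonneg)
    qed
    then have "M.null_eq t t'"
      using t(1) t' null by (simp add: M.null_eq_def lim_norm_eq_0_iff)
    then have "M t = M t'"
      by (rule M.null_eq_N)
    also have "M t' \<le> 1"
      using t t' K r by (intro contraction[of t' r]) (auto simp: t'_def intro: less_imp_le)
    finally show ?thesis .
  qed
  have sa: "M t \<le> lim_norm t" if t: "t \<in> cauchy" "\<And>i. st (t i) = t i" for t
  proof (rule dense_ge)
    fix x assume x: "lim_norm t < x"
    then have "0 < x" using C.N_nonneg[OF t(1)] by simp
    \<comment> \<open>Any \<open>x\<close> above the norm of \<open>t\<close> rescales
      \<open>t\<close> into the open unit ball.\<close>
    define u where "u = (\<lambda>i. sc (of_real (1 / x)) (t i))"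
    have u: "u \<in> cauchy" "\<And>i. st (u i) = u i"
      using t by (simp_all add: u_def cauchy_sc st_sc)
    have "lim_norm u = lim_norm t / x" "M u = M t / x"
      unfolding u_def using C.N_sc[OF t(1)] M.N_sc[OF t(1)] \<open>0 < x\<close> by (simp_all add: norm_divide)
    then show "M t \<le> x"
      using sa1[OF u] x \<open>0 < x\<close> by simp
  qed
  \<comment> \<open>The C*-identity for both seminorms reduces an arbitrary \<open>s\<close> to the
    self-adjoint product of its adjoint with \<open>s\<close>.\<close>
  have "(M s)\<^sup>2 \<le> (lim_norm s)\<^sup>2"
    using sa[of "(\<lambda>i. st (s i)) * s"] s
    by (simp add: M.N_st_mult C.N_st_mult cauchy_st st_mult st_st)
  then show ?thesis
    using C.N_nonneg[OF s] by (rule power2_le_imp_le)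
qed

end

section \<open>The free *-algebra\<close>

lemma poly_mapping_single_induct [case_names zero add single]:
  assumes "P 0" and add: "\<And>p q. P p \<Longrightarrow> P q \<Longrightarrow> P (p + q)"
    and single: "\<And>k c. P (Poly_Mapping.single k c)"
  shows "P (p :: 'a \<Rightarrow>\<^sub>0 'b::monoid_add)"
proof (induction p rule: update_induct)
  case (update p k c)
  have "Poly_Mapping.update k c p = p + Poly_Mapping.single k c"
    using update(1) by (intro poly_mapping_eqI)
      (auto simp: lookup_update lookup_add lookup_single in_keys_iff when_def)
  then show ?case using update add single by simp
qed (rule assms)

lemma poly_mapping_eq_sum_single:
  fixes p :: "'a \<Rightarrow>\<^sub>0 'b::comm_monoid_add"
  shows "p = (\<Sum>u\<in>Poly_Mapping.keys p. Poly_Mapping.single u (Poly_Mapping.lookup p u))"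
  by (intro poly_mapping_eqI)
    (auto simp: lookup_sum lookup_single when_def in_keys_iff)

lemma letters_0 [simp]: "letters 0 = []"
  and letters_add [simp]: "letters (u + v) = letters u @ letters v"
  by (simp_all add: zero_star_word_def plus_star_word_def)

text \<open>\<open>\<kappa>\<close> is the identity or complex conjugation.\<close>

definition lin_ext ::
  "(complex \<Rightarrow> complex) \<Rightarrow> ('x star_word \<Rightarrow> 'y star_poly) \<Rightarrow> 'x star_poly \<Rightarrow> 'y star_poly" where
  "lin_ext \<kappa> f p =
     (\<Sum>u\<in>Poly_Mapping.keys p. Poly_Mapping.single 0 (\<kappa> (Poly_Mapping.lookup p u)) * f u)"

lemma lin_ext_superset:
  assumes "finite K" "Poly_Mapping.keys p \<subseteq> K" "\<kappa> 0 = 0"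
  shows "lin_ext \<kappa> f p = (\<Sum>u\<in>K. Poly_Mapping.single 0 (\<kappa> (Poly_Mapping.lookup p u)) * f u)"
  unfolding lin_ext_def using assms
  by (intro sum.mono_neutral_left) (auto simp: in_keys_iff)

lemma lin_ext_0 [simp]: "lin_ext \<kappa> f 0 = 0"
  by (simp add: lin_ext_def)

lemma lin_ext_single: "\<kappa> 0 = 0 \<Longrightarrow>
    lin_ext \<kappa> f (Poly_Mapping.single u c) = Poly_Mapping.single 0 (\<kappa> c) * f u"
  by (subst lin_ext_superset[of "{u}"]) (auto simp: lookup_single)

lemma lin_ext_add:
  assumes "\<And>c d. \<kappa> (c + d) = \<kappa> c + \<kappa> d"
  shows "lin_ext \<kappa> f (p + q) = lin_ext \<kappa> f p + lin_ext \<kappa> f q"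
proof -
  let ?K = "Poly_Mapping.keys p \<union> Poly_Mapping.keys q"
  have "\<kappa> 0 = 0"
    using assms[of 0 0] by simp
  then show ?thesis
    using Poly_Mapping.keys_add[of p q]
    by (simp add: lin_ext_superset[of ?K] lookup_add assms single_add distrib_right sum.distrib)
qed

text \<open>The word \<open>0\<close> is empty, so \<open>Poly_Mapping.single 0 c\<close> is a
  scalar, and scalars are central. Scaling thereby becomes ring multiplication, and the ring laws
  take care of it.\<close>

lemma single_0_commute: "Poly_Mapping.single 0 (c::complex) * p = (p :: 'x star_poly) * Poly_Mapping.single 0 c"
  by (induction p rule: poly_mapping_single_induct)
    (auto simp: algebra_simps mult_single)

lemma poly_scale_eq: "poly_scale c p = Poly_Mapping.single 0 c * p"
  by (simp add: poly_scale_def mult_map_scale_conv_mult)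

lemma poly_star_eq: "poly_star p = lin_ext cnj (\<lambda>u. Poly_Mapping.single (word_star u) 1) p"
  by (simp add: poly_star_def lin_ext_def mult_single)

lemma word_star_add: "word_star (u + v) = word_star v + word_star u"
  by (simp add: word_star_def plus_star_word_def)

lemma word_star_word_star [simp]: "word_star (word_star u) = u"
  by (cases u) (simp add: word_star_def rev_map o_def case_prod_beta)

lemma word_star_0 [simp]: "word_star 0 = 0"
  by (simp add: word_star_def zero_star_word_def)

lemma poly_star_0 [simp]: "poly_star 0 = 0"
  by (simp add: poly_star_eq)

lemma poly_star_add: "poly_star (p + q) = poly_star p + poly_star q"
  by (simp add: poly_star_eq lin_ext_add)

lemma poly_star_single:
  "poly_star (Poly_Mapping.single u c) = Poly_Mapping.single (word_star u) (cnj c)"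
  by (simp add: poly_star_eq lin_ext_single mult_single)

lemma poly_star_mult: "poly_star (p * q) = poly_star q * poly_star p"
proof (induction p rule: poly_mapping_single_induct)
  case (single u c)
  show ?case
    by (induction q rule: poly_mapping_single_induct)
      (auto simp: algebra_simps poly_star_add poly_star_single mult_single word_star_add)
qed (auto simp: algebra_simps poly_star_add)

lemma poly_star_star: "poly_star (poly_star p) = p"
  by (induction p rule: poly_mapping_single_induct) (auto simp: poly_star_add poly_star_single)

lemma mult_poly_scale: "p * poly_scale c q = poly_scale c (p * q)"
  unfolding poly_scale_eq by (metis single_0_commute mult.assoc)

lemma poly_star_scale: "poly_star (poly_scale c p) = poly_scale (cnj c) (poly_star p)"
  unfolding poly_scale_eq poly_star_mult poly_star_single word_star_0
  by (rule single_0_commute[symmetric])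

lemma poly_gen_in_free [simp]: "x \<in> X \<Longrightarrow> poly_gen x \<in> free_star_alg X"
  by (auto simp: free_star_alg_def poly_gen_def)

lemma poly_scale_free:
  assumes "p \<in> free_star_alg X" shows "poly_scale c p \<in> free_star_alg X"
proof -
  have "Poly_Mapping.keys (poly_scale c p) \<subseteq> Poly_Mapping.keys p"
    by (auto simp: poly_scale_def in_keys_iff map.rep_eq when_def split: if_splits)
  then show ?thesis using assms by (auto simp: free_star_alg_def)
qed

interpretation free: star_algebra "free_star_alg X" poly_scale poly_star for X
proof
  fix p q c
  show "0 \<in> free_star_alg X" by (simp add: free_star_alg_def)
  show "p \<in> free_star_alg X \<Longrightarrow> q \<in> free_star_alg X \<Longrightarrow> p + q \<in> free_star_alg X"
    using Poly_Mapping.keys_add[of p q] by (fastforce simp: free_star_alg_def)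
  show "p * q \<in> free_star_alg X" if "p \<in> free_star_alg X" "q \<in> free_star_alg X"
    using keys_mult[of p q] that unfolding free_star_alg_def by (auto 4 5 simp: image_Un dest!: subsetD)
  show "p \<in> free_star_alg X \<Longrightarrow> poly_scale c p \<in> free_star_alg X"
    by (rule poly_scale_free)
  show "poly_star p \<in> free_star_alg X" if "p \<in> free_star_alg X"
  proof -
    have "Poly_Mapping.keys (poly_star p) \<subseteq> word_star ` Poly_Mapping.keys p"
      unfolding poly_star_def
      by (rule order_trans[OF Poly_Mapping.keys_sum]) (auto split: if_splits)
    moreover have "letters (word_star u) \<noteq> [] \<and> fst ` set (letters (word_star u)) \<subseteq> X"
      if "letters u \<noteq> []" "fst ` set (letters u) \<subseteq> X" for u
      using that by (auto simp: word_star_def)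
    ultimately show ?thesis
      using that unfolding free_star_alg_def by blast
  qed
  show "poly_scale c (poly_scale d p) = poly_scale (c * d) p" for d
    by (simp add: poly_scale_eq mult_single flip: mult.assoc)
qed (auto simp: mult_poly_scale poly_star_scale poly_star_add poly_star_mult poly_star_star,
    simp_all add: poly_scale_eq distrib_left distrib_right single_add mult.assoc)

text \<open>Elements are linear combinations of nonempty words, and a nonempty word is a product of
  generators and their adjoints. The empty word must never be reached, since its monomial is the
  unit, which is outside the algebra.\<close>

lemma free_star_alg_induct [consumes 1, case_names zero gen add mult scale star]:
  assumes p: "p \<in> free_star_alg X" and zero: "P 0"
    and gen: "\<And>x. x \<in> X \<Longrightarrow> P (poly_gen x)"
    and add: "\<And>p q. p \<in> free_star_alg X \<Longrightarrow> q \<in> free_star_alg X \<Longrightarrow> P p \<Longrightarrow> P q \<Longrightarrow> P (p + q)"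
    and mult: "\<And>p q. p \<in> free_star_alg X \<Longrightarrow> q \<in> free_star_alg X \<Longrightarrow> P p \<Longrightarrow> P q \<Longrightarrow> P (p * q)"
    and scale: "\<And>c p. p \<in> free_star_alg X \<Longrightarrow> P p \<Longrightarrow> P (poly_scale c p)"
    and star: "\<And>p. p \<in> free_star_alg X \<Longrightarrow> P p \<Longrightarrow> P (poly_star p)"
  shows "P p"
proof -
  have letter: "Poly_Mapping.single (Word [(x, b)]) 1 \<in> free_star_alg X \<and>
      P (Poly_Mapping.single (Word [(x, b)]) 1)" if "x \<in> X" for x b
  proof (cases b)
    case True
    have "Poly_Mapping.single (Word [(x, b)]) 1 = poly_star (poly_gen x)"
      by (simp add: poly_gen_def poly_star_single word_star_def True)
    then show ?thesis using star[OF _ gen] that by simp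
  next
    case False
    then show ?thesis using gen[OF that] that by (simp add: poly_gen_def free_star_alg_def)
  qed
  have word: "Poly_Mapping.single (Word l) 1 \<in> free_star_alg X \<and> P (Poly_Mapping.single (Word l) 1)"
    if "l \<noteq> []" "fst ` set l \<subseteq> X" for l
    using that
  proof (induction l rule: list_nonempty_induct)
    case (single a)
    then show ?case using letter[of "fst a" "snd a"] by simp
  next
    case (cons a l)
    have "Poly_Mapping.single (Word (a # l)) (1::complex) =
        Poly_Mapping.single (Word [(fst a, snd a)]) 1 * Poly_Mapping.single (Word l) 1"
      by (simp add: mult_single plus_star_word_def)
    then show ?case
      using cons letter[of "fst a" "snd a"] mult by simp
  qed
  have "(\<Sum>u\<in>K. Poly_Mapping.single u (Poly_Mapping.lookup p u)) \<in> free_star_alg X \<and>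
      P (\<Sum>u\<in>K. Poly_Mapping.single u (Poly_Mapping.lookup p u))"
    if "finite K" "K \<subseteq> Poly_Mapping.keys p" for K
    using that
  proof (induction K rule: finite_induct)
    case (insert u K)
    have "Poly_Mapping.single u (Poly_Mapping.lookup p u) =
        poly_scale (Poly_Mapping.lookup p u) (Poly_Mapping.single (Word (letters u)) 1)"
      by (simp add: poly_scale_eq mult_single)
    moreover have "Poly_Mapping.single (Word (letters u)) 1 \<in> free_star_alg X \<and>
        P (Poly_Mapping.single (Word (letters u)) 1)"
      using p insert by (intro word) (auto simp: free_star_alg_def)
    ultimately show ?case
      using insert scale add by simp
  qed (simp add: zero)
  from this[of "Poly_Mapping.keys p"] show ?thesis
    using poly_mapping_eq_sum_single[of p] by simp
qed

section \<open>Substitution: the universal property of the free *-algebra\<close>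

definition subst_word :: "('x \<Rightarrow> 'y star_poly) \<Rightarrow> 'x star_word \<Rightarrow> 'y star_poly" where
  "subst_word \<sigma> u = prod_list (map (\<lambda>(x, b). if b then poly_star (\<sigma> x) else \<sigma> x) (letters u))"

definition poly_subst :: "('x \<Rightarrow> 'y star_poly) \<Rightarrow> 'x star_poly \<Rightarrow> 'y star_poly" where
  "poly_subst \<sigma> = lin_ext id (subst_word \<sigma>)"

lemma subst_word_add: "subst_word \<sigma> (u + v) = subst_word \<sigma> u * subst_word \<sigma> v"
  by (simp add: subst_word_def)

lemma poly_star_1 [simp]: "poly_star 1 = 1"
  unfolding single_one[symmetric] poly_star_single by simp

lemma subst_word_star: "subst_word \<sigma> (word_star u) = poly_star (subst_word \<sigma> u)"
proof -
  have "prod_list (map (\<lambda>(x, b). if b then poly_star (\<sigma> x) else \<sigma> x)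
      (rev (map (\<lambda>(x, b). (x, \<not> b)) l))) =
      poly_star (prod_list (map (\<lambda>(x, b). if b then poly_star (\<sigma> x) else \<sigma> x) l))" for l
    by (induction l) (auto simp: poly_star_mult poly_star_star)
  then show ?thesis
    by (simp add: subst_word_def word_star_def)
qed

lemma poly_subst_0 [simp]: "poly_subst \<sigma> 0 = 0"
  by (simp add: poly_subst_def)

lemma poly_subst_add: "poly_subst \<sigma> (p + q) = poly_subst \<sigma> p + poly_subst \<sigma> q"
  by (simp add: poly_subst_def lin_ext_add)

lemma poly_subst_minus: "poly_subst \<sigma> (- p) = - poly_subst \<sigma> p"
  using poly_subst_add[of \<sigma> p "- p"] by (simp add: eq_neg_iff_add_eq_0 add.commute)

lemma poly_subst_diff: "poly_subst \<sigma> (p - q) = poly_subst \<sigma> p - poly_subst \<sigma> q"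
  using poly_subst_add[of \<sigma> p "- q"] by (simp add: poly_subst_minus)

lemma poly_subst_sum: "poly_subst \<sigma> (sum f I) = (\<Sum>i\<in>I. poly_subst \<sigma> (f i))"
  by (induction I rule: infinite_finite_induct) (auto simp: poly_subst_add)

lemma poly_subst_single:
  "poly_subst \<sigma> (Poly_Mapping.single u c) = Poly_Mapping.single 0 c * subst_word \<sigma> u"
  by (simp add: poly_subst_def lin_ext_single)

lemma poly_subst_gen [simp]: "poly_subst \<sigma> (poly_gen x) = \<sigma> x"
  by (simp add: poly_gen_def poly_subst_single subst_word_def)

lemma poly_subst_mult: "poly_subst \<sigma> (p * q) = poly_subst \<sigma> p * poly_subst \<sigma> q"
proof (induction p rule: poly_mapping_single_induct)
  case (single u c)
  show ?case
  proof (induction q rule: poly_mapping_single_induct)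
    case (single v d)
    have "Poly_Mapping.single 0 c * subst_word \<sigma> u * (Poly_Mapping.single 0 d * subst_word \<sigma> v) =
        Poly_Mapping.single 0 c * (subst_word \<sigma> u * Poly_Mapping.single 0 d) * subst_word \<sigma> v"
      by (simp add: mult.assoc)
    also have "\<dots> = Poly_Mapping.single 0 c * Poly_Mapping.single 0 d *
        (subst_word \<sigma> u * subst_word \<sigma> v)"
      by (simp only: single_0_commute[of d "subst_word \<sigma> u", symmetric] mult.assoc)
    finally show ?case
      by (simp add: poly_subst_single mult_single subst_word_add)
  qed (auto simp: algebra_simps poly_subst_add)
qed (auto simp: algebra_simps poly_subst_add)

lemma poly_subst_star: "poly_subst \<sigma> (poly_star p) = poly_star (poly_subst \<sigma> p)"
proof (induction p rule: poly_mapping_single_induct)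
  case (single u c)
  show ?case
    by (simp add: poly_star_single poly_subst_single subst_word_star poly_star_mult)
      (rule single_0_commute)
qed (auto simp: poly_subst_add poly_star_add)

lemma poly_subst_scale: "poly_subst \<sigma> (poly_scale c p) = poly_scale c (poly_subst \<sigma> p)"
  by (simp add: poly_scale_eq poly_subst_mult poly_subst_single subst_word_def)

lemma poly_subst_closed:
  assumes "p \<in> free_star_alg X" "\<And>x. x \<in> X \<Longrightarrow> \<sigma> x \<in> free_star_alg Y"
  shows "poly_subst \<sigma> p \<in> free_star_alg Y"
  using assms(1)
  by (induction p rule: free_star_alg_induct)
    (auto simp: poly_subst_add poly_subst_mult poly_subst_scale poly_subst_star assms(2))

section \<open>The universal seminorm\<close>

lemma cstar_seminorm_iff:
  "cstar_seminorm X N \<longleftrightarrow> cstar_seminormed (free_star_alg X) poly_scale poly_star N"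
  unfolding cstar_seminorm_def cstar_seminormed_def cstar_seminormed_axioms_def
  using free.star_algebra_axioms by auto

definition rel_seminorms :: "'x set \<Rightarrow> 'x star_poly set \<Rightarrow> ('x star_poly \<Rightarrow> real) set" where
  "rel_seminorms X R = {N. cstar_seminorm X N \<and> (\<forall>r\<in>R. N r = 0)}"

text \<open>The universal seminorm is a supremum of reals, which is meaningful only where the values
  are bounded. Boundedness on generators suffices, because every operation of the *-algebra turns
  bounds into bounds.\<close>

locale bounded_relations =
  fixes X :: "'x set" and R :: "'x star_poly set"
  assumes bounded_gen: "x \<in> X \<Longrightarrow> bdd_above ((\<lambda>N. N (poly_gen x)) ` rel_seminorms X R)"
begin

abbreviation "F \<equiv> free_star_alg X"
abbreviation "U \<equiv> universal_seminorm X R"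

text \<open>Makes the supremum range over a nonempty set and yields its nonnegativity.\<close>

lemma zero_in_rel_seminorms: "(\<lambda>_. 0) \<in> rel_seminorms X R"
  by (simp add: rel_seminorms_def cstar_seminorm_def)

lemma rel_seminormD: "N \<in> rel_seminorms X R \<Longrightarrow> cstar_seminormed F poly_scale poly_star N"
  by (simp add: rel_seminorms_def cstar_seminorm_iff)

lemma rel_seminorms_bounded:
  assumes "p \<in> F" shows "bdd_above ((\<lambda>N. N p) ` rel_seminorms X R)"
  using assms
proof (induction p rule: free_star_alg_induct)
  case zero
  show ?case
    by (intro bdd_aboveI2[of _ _ 0])
      (auto simp: cstar_seminormed.N_zero[OF rel_seminormD])
next
  case (gen x)
  then show ?case by (rule bounded_gen)
next
  case (add p q)
  then obtain B B' where "\<And>N. N \<in> rel_seminorms X R \<Longrightarrow> N p \<le> B"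
    "\<And>N. N \<in> rel_seminorms X R \<Longrightarrow> N q \<le> B'"
    by (auto simp: bdd_above_def)
  then show ?case
    using add cstar_seminormed.N_add[OF rel_seminormD, of _ p q]
    by (intro bdd_aboveI2[of _ _ "B + B'"]) (meson add_mono order_trans)
next
  case (mult p q)
  then obtain B B' where "\<And>N. N \<in> rel_seminorms X R \<Longrightarrow> N p \<le> B"
    "\<And>N. N \<in> rel_seminorms X R \<Longrightarrow> N q \<le> B'"
    by (auto simp: bdd_above_def)
  then show ?case
    using mult cstar_seminormed.N_mult_le[OF rel_seminormD, of _ p q B B']
    by (intro bdd_aboveI2[of _ _ "B * B'"]) auto
next
  case (scale c p)
  then obtain B where "\<And>N. N \<in> rel_seminorms X R \<Longrightarrow> N p \<le> B"
    by (auto simp: bdd_above_def)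
  then show ?case
    using scale by (intro bdd_aboveI2[of _ _ "cmod c * B"])
      (auto simp: cstar_seminormed.N_sc[OF rel_seminormD] intro: mult_left_mono)
next
  case (star p)
  then show ?case
    by (simp add: cstar_seminormed.N_st[OF rel_seminormD] cong: image_cong)
qed

lemma U_eq: "U p = (SUP N\<in>rel_seminorms X R. N p)"
  by (simp add: universal_seminorm_def rel_seminorms_def)

lemma seminorm_le_U: "N \<in> rel_seminorms X R \<Longrightarrow> p \<in> F \<Longrightarrow> N p \<le> U p"
  unfolding U_eq by (intro cSUP_upper rel_seminorms_bounded)

lemma U_least: "(\<And>N. N \<in> rel_seminorms X R \<Longrightarrow> N p \<le> B) \<Longrightarrow> U p \<le> B"
  unfolding U_eq using zero_in_rel_seminorms by (intro cSUP_least) auto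

lemma U_nonneg: "p \<in> F \<Longrightarrow> 0 \<le> U p"
  using seminorm_le_U[OF zero_in_rel_seminorms] by simp

sublocale cstar_seminormed "free_star_alg X" poly_scale poly_star "universal_seminorm X R"
proof
  fix p q c
  show "p \<in> F \<Longrightarrow> 0 \<le> U p" by (rule U_nonneg)
  show "U (p + q) \<le> U p + U q" if "p \<in> F" "q \<in> F"
  proof (rule U_least)
    fix N assume "N \<in> rel_seminorms X R"
    then show "N (p + q) \<le> U p + U q"
      using cstar_seminormed.N_add[OF rel_seminormD] seminorm_le_U that by (meson add_mono order_trans)
  qed
  show "U (p * q) \<le> U p * U q" if "p \<in> F" "q \<in> F"
    by (rule U_least)
      (auto intro!: cstar_seminormed.N_mult_le[OF rel_seminormD] seminorm_le_U that)
  show "U (poly_scale c p) = cmod c * U p" if p: "p \<in> F"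
  proof (rule antisym)
    show "U (poly_scale c p) \<le> cmod c * U p"
      by (rule U_least)
        (auto simp: cstar_seminormed.N_sc[OF rel_seminormD p] intro!: mult_left_mono seminorm_le_U p)
    show "cmod c * U p \<le> U (poly_scale c p)"
    proof (cases "c = 0")
      case False
      \<comment> \<open>A bound on the supremum is obtained from bounds on the bare values
        \<open>N p\<close>, so the factor is moved to the other side first. For the C*-identity
        \<open>sqrt\<close> does the same to the square.\<close>
      have "U p \<le> U (poly_scale c p) / cmod c"
      proof (rule U_least)
        fix N assume "N \<in> rel_seminorms X R"
        then show "N p \<le> U (poly_scale c p) / cmod c"
          using seminorm_le_U[of N "poly_scale c p"] cstar_seminormed.N_sc[OF rel_seminormD p, of N c]
            False p by (simp add: field_simps)
      qed
      then show ?thesis using False by (simp add: field_simps)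
    qed (use U_nonneg[of "poly_scale c p"] p in simp)
  qed
  show "U (poly_star p * p) = (U p)\<^sup>2" if p: "p \<in> F"
  proof (rule antisym)
    show "U (poly_star p * p) \<le> (U p)\<^sup>2"
    proof (rule U_least)
      fix N assume N: "N \<in> rel_seminorms X R"
      then show "N (poly_star p * p) \<le> (U p)\<^sup>2"
        using cstar_seminormed.N_st_mult[OF rel_seminormD[OF N] p] seminorm_le_U[OF N p]
          cstar_seminormed.N_nonneg[OF rel_seminormD[OF N] p] by (simp add: power_mono)
    qed
    have "U p \<le> sqrt (U (poly_star p * p))"
    proof (rule U_least)
      fix N assume N: "N \<in> rel_seminorms X R"
      then have "(N p)\<^sup>2 \<le> U (poly_star p * p)"
        using cstar_seminormed.N_st_mult[OF rel_seminormD p] seminorm_le_U[of N "poly_star p * p"] p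
        by simp
      then show "N p \<le> sqrt (U (poly_star p * p))"
        by (rule real_le_rsqrt)
    qed
    then have "(U p)\<^sup>2 \<le> (sqrt (U (poly_star p * p)))\<^sup>2"
      using U_nonneg[OF p] by (rule power_mono)
    then show "(U p)\<^sup>2 \<le> U (poly_star p * p)"
      using U_nonneg[of "poly_star p * p"] p by simp
  qed
qed

notation null_eq (infix "\<approx>" 50)

lemma U_rel: "r \<in> R \<Longrightarrow> r \<in> F \<Longrightarrow> r \<approx> 0"
  using U_least[of r 0] U_nonneg[of r] by (auto simp: null_eq_0_iff rel_seminorms_def)

lemma cauchy_seqs_eq: "cauchy_seqs X R = cauchy"
  by (simp add: cauchy_seqs_def cauchy_def)

end

section \<open>The universal C*-algebra\<close>

context bounded_relations
begin

abbreviation "K \<equiv> universal_class X R"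
abbreviation "C \<equiv> universal_cstar X R"

interpretation seq: cstar_seminormed cauchy "\<lambda>c s i. poly_scale c (s i)" "\<lambda>s i. poly_star (s i)" lim_norm
  by (rule cstar_seminormed_cauchy)

lemma null_rel_iff: "(s, t) \<in> null_rel X R \<longleftrightarrow> seq.null_eq s t"
proof -
  have "(\<lambda>i. U (s i - t i)) = (\<lambda>i. U ((s - t) i))" by simp
  then show ?thesis
    using lim_norm_eq_0_iff[of "s - t"] seq.diff_closed[of s t]
    by (auto simp: null_rel_def seq.null_eq_def cauchy_seqs_eq)
qed

lemma equiv_null_rel: "equiv cauchy (null_rel X R)"
proof (intro equivI refl_onI symI transI)
  show "null_rel X R \<subseteq> cauchy \<times> cauchy"
    by (auto simp: null_rel_iff seq.null_eq_def)
qed (auto simp: null_rel_iff intro: seq.null_eq_sym seq.null_eq_trans)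

lemma class_eq_iff: "s \<in> cauchy \<Longrightarrow> t \<in> cauchy \<Longrightarrow> K s = K t \<longleftrightarrow> lim_norm (s - t) = 0"
  unfolding universal_class_def
  by (simp add: eq_equiv_class_iff[OF equiv_null_rel] null_rel_iff seq.null_eq_def)

lemma in_class_iff: "t \<in> K s \<longleftrightarrow> seq.null_eq s t"
  by (simp add: universal_class_def null_rel_iff)

lemma carrier_universal: "carrier C = K ` cauchy"
  by (auto simp: universal_cstar_def quotient_def universal_class_def cauchy_seqs_eq)

lemma class_carrier: "s \<in> cauchy \<Longrightarrow> K s \<in> carrier C"
  by (simp add: carrier_universal)

lemma class_eqI: "seq.null_eq s t \<Longrightarrow> K s = K t"
  by (auto simp: class_eq_iff seq.null_eq_def)

text \<open>The operations of \<open>universal_cstar\<close> are unions over all representatives. If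
  the operation respects null sequences, all members of the union are one and the same
  class.\<close>

lemma UN_class:
  assumes "s \<in> cauchy" "\<And>t. seq.null_eq s t \<Longrightarrow> f t = f s"
  shows "(\<Union>t\<in>K s. f t) = f s"
proof (rule SUP_eq_const)
  show "K s \<noteq> {}"
    using seq.null_eq_refl[OF assms(1)] by (auto simp flip: in_class_iff)
qed (rule assms(2), simp only: in_class_iff)

lemma cadd_class:
  assumes "s \<in> cauchy" "t \<in> cauchy" shows "cadd C (K s) (K t) = K (s + t)"
proof -
  have "cadd C (K s) (K t) = (\<Union>s'\<in>K s. \<Union>t'\<in>K t. K (s' + t'))"
    by (simp add: universal_cstar_def plus_fun_def)
  also have "\<dots> = (\<Union>s'\<in>K s. K (s' + t))"
    using assms by (intro SUP_cong refl UN_class class_eqI seq.null_eq_add)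
      (auto intro: seq.null_eq_sym simp: in_class_iff seq.null_eq_def[of s])
  also have "\<dots> = K (s + t)"
    using assms by (intro UN_class class_eqI seq.null_eq_add) (auto intro: seq.null_eq_sym)
  finally show ?thesis .
qed

lemma cmult_class:
  assumes "s \<in> cauchy" "t \<in> cauchy" shows "cmult C (K s) (K t) = K (s * t)"
proof -
  have "cmult C (K s) (K t) = (\<Union>s'\<in>K s. \<Union>t'\<in>K t. K (s' * t'))"
    by (simp add: universal_cstar_def times_fun_def)
  also have "\<dots> = (\<Union>s'\<in>K s. K (s' * t))"
    using assms by (intro SUP_cong refl UN_class class_eqI seq.null_eq_mult)
      (auto intro: seq.null_eq_sym simp: in_class_iff seq.null_eq_def[of s])
  also have "\<dots> = K (s * t)"
    using assms by (intro UN_class class_eqI seq.null_eq_mult) (auto intro: seq.null_eq_sym)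
  finally show ?thesis .
qed

lemma cscale_class:
  assumes "s \<in> cauchy" shows "cscale C c (K s) = K (\<lambda>i. poly_scale c (s i))"
proof -
  have "cscale C c (K s) = (\<Union>s'\<in>K s. K (\<lambda>i. poly_scale c (s' i)))"
    by (simp add: universal_cstar_def)
  also have "\<dots> = K (\<lambda>i. poly_scale c (s i))"
    using assms by (intro UN_class class_eqI seq.null_eq_sc) (auto intro: seq.null_eq_sym)
  finally show ?thesis .
qed

lemma cstar_class:
  assumes "s \<in> cauchy" shows "cstar C (K s) = K (\<lambda>i. poly_star (s i))"
proof -
  have "cstar C (K s) = (\<Union>s'\<in>K s. K (\<lambda>i. poly_star (s' i)))"
    by (simp add: universal_cstar_def)
  also have "\<dots> = K (\<lambda>i. poly_star (s i))"
    using assms by (intro UN_class class_eqI seq.null_eq_st) (auto intro: seq.null_eq_sym)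
  finally show ?thesis .
qed

lemma czero_class: "czero C = K 0"
  by (simp add: universal_cstar_def zero_fun_def)

lemma cnorm_class:
  assumes "s \<in> cauchy" shows "cnorm C (K s) = lim_norm s"
proof -
  have "(\<lambda>s. lim (\<lambda>i. U (s i))) ` K s = {lim_norm s}"
    unfolding lim_norm_def[symmetric]
    using assms seq.null_eq_N[of s] seq.null_eq_refl[of s] by (auto simp: in_class_iff)
  then show ?thesis
    by (simp add: universal_cstar_def)
qed

text \<open>Constant sequences map the free *-algebra onto a dense subalgebra of the completion;
  there computations can be done with polynomials modulo null elements.\<close>

definition cls :: "'x star_poly \<Rightarrow> 'x univ_elt" where
  "cls p = K (\<lambda>i. p)"

lemma cls_carrier [simp]: "p \<in> F \<Longrightarrow> cls p \<in> carrier C"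
  by (simp add: cls_def class_carrier cauchy_const)

lemma cls_eqI: "p \<approx> q \<Longrightarrow> cls p = cls q"
  unfolding cls_def
  using lim_norm_const[of "p - q"]
  by (subst class_eq_iff) (auto simp: null_eq_def cauchy_const fun_diff_def)

lemma cls_add: "p \<in> F \<Longrightarrow> q \<in> F \<Longrightarrow> cadd C (cls p) (cls q) = cls (p + q)"
  by (simp add: cls_def cadd_class cauchy_const plus_fun_def)

lemma cls_mult: "p \<in> F \<Longrightarrow> q \<in> F \<Longrightarrow> cmult C (cls p) (cls q) = cls (p * q)"
  by (simp add: cls_def cmult_class cauchy_const times_fun_def)

lemma cls_scale: "p \<in> F \<Longrightarrow> cscale C c (cls p) = cls (poly_scale c p)"
  by (simp add: cls_def cscale_class cauchy_const)

lemma cls_star: "p \<in> F \<Longrightarrow> cstar C (cls p) = cls (poly_star p)"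
  by (simp add: cls_def cstar_class cauchy_const)

lemma cls_zero: "czero C = cls 0"
  by (simp add: cls_def czero_class zero_fun_def)

lemma universal_gen_eq: "universal_gen X R x = cls (poly_gen x)"
  by (simp add: universal_gen_def cls_def)

abbreviation (input) "add_monoid \<equiv> \<lparr>carrier = carrier C, monoid.mult = cadd C, one = czero C\<rparr>"

text \<open>\<open>csum\<close> is a \<open>finprod\<close>, whose recursion is available in a
  commutative monoid.\<close>

lemma comm_monoid_universal: "comm_monoid add_monoid"
  by (rule comm_monoidI) (auto simp: carrier_universal cadd_class czero_class ac_simps)

lemma csum_cong_cls:
  assumes "finite I" "\<And>i. i \<in> I \<Longrightarrow> f i \<in> F" "\<And>i. i \<in> I \<Longrightarrow> g i = cls (f i)"
  shows "csum C g I = cls (sum f I)"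
proof -
  interpret G: comm_monoid add_monoid by (rule comm_monoid_universal)
  show ?thesis
    unfolding csum_def using assms
  proof (induction I rule: finite_induct)
    case (insert i I)
    then have "g \<in> I \<rightarrow> carrier add_monoid" by auto
    then show ?case using insert by (simp add: cls_add)
  next
    case empty
    show ?case by (simp only: G.finprod_empty sum.empty) (simp add: cls_zero)
  qed
qed

lemma star_homD:
  assumes "star_hom C B h"
  shows "a \<in> carrier C \<Longrightarrow> h a \<in> carrier B"
    and "a \<in> carrier C \<Longrightarrow> b \<in> carrier C \<Longrightarrow> h (cadd C a b) = cadd B (h a) (h b)"
    and "a \<in> carrier C \<Longrightarrow> b \<in> carrier C \<Longrightarrow> h (cmult C a b) = cmult B (h a) (h b)"
    and "a \<in> carrier C \<Longrightarrow> h (cscale C c a) = cscale B c (h a)"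
    and "a \<in> carrier C \<Longrightarrow> h (cstar C a) = cstar B (h a)"
  using assms by (auto simp: star_hom_def)

end

lemma star_hom_comp:
  "star_hom A B f \<Longrightarrow> star_hom B D g \<Longrightarrow> star_hom A D (\<lambda>a. g (f a))"
  by (auto simp: star_hom_def Pi_iff)

section \<open>*-homomorphisms between universal C*-algebras: contractivity, uniqueness,
  existence\<close>

locale bounded_relations_pair =
  dom: bounded_relations X R + cod: bounded_relations Y S
  for X :: "'x set" and R :: "'x star_poly set" and Y :: "'y set" and S :: "'y star_poly set"
begin

interpretation ds: cstar_seminormed dom.cauchy "\<lambda>c s i. poly_scale c (s i)"
    "\<lambda>s i. poly_star (s i)" dom.lim_norm
  by (rule dom.cstar_seminormed_cauchy)

interpretation cs: cstar_seminormed cod.cauchy "\<lambda>c s i. poly_scale c (s i)"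
    "\<lambda>s i. poly_star (s i)" cod.lim_norm
  by (rule cod.cstar_seminormed_cauchy)

text \<open>The codomain norm pulled back along \<open>h\<close> is a C*-seminorm on the Cauchy
  sequences of the domain and vanishes on null sequences, so \<open>seminorm_le_lim_norm\<close>
  bounds it.\<close>

lemma star_hom_norm_le:
  assumes h: "star_hom dom.C cod.C h" and s: "s \<in> dom.cauchy"
  shows "cnorm cod.C (h (dom.K s)) \<le> dom.lim_norm s"
proof -
  define M where "M s = cnorm cod.C (h (dom.K s))" for s
  have rep: "\<exists>t. t \<in> cod.cauchy \<and> h (dom.K s) = cod.K t" if "s \<in> dom.cauchy" for s
    using dom.star_homD(1)[OF h dom.class_carrier[OF that]] by (auto simp: cod.carrier_universal)
  have "cstar_seminormed dom.cauchy (\<lambda>c s i. poly_scale c (s i)) (\<lambda>s i. poly_star (s i)) M"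
  proof
    fix s t c
    assume s: "s \<in> dom.cauchy"
    then obtain s' where s': "s' \<in> cod.cauchy" "h (dom.K s) = cod.K s'" using rep by blast
    show "0 \<le> M s"
      using s' by (simp add: M_def cod.cnorm_class cs.N_nonneg)
    have "h (dom.K (\<lambda>i. poly_scale c (s i))) = cod.K (\<lambda>i. poly_scale c (s' i))"
      using dom.star_homD(4)[OF h dom.class_carrier[OF s]] s s'
      by (simp add: dom.cscale_class cod.cscale_class)
    then show "M (\<lambda>i. poly_scale c (s i)) = cmod c * M s"
      using s' cs.sc_closed[of s' c] by (simp add: M_def cod.cnorm_class cs.N_sc)
    have st: "h (dom.K (\<lambda>i. poly_star (s i))) = cod.K (\<lambda>i. poly_star (s' i))"
      using dom.star_homD(5)[OF h dom.class_carrier[OF s]] s s'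
      by (simp add: dom.cstar_class cod.cstar_class)
    have "h (dom.K ((\<lambda>i. poly_star (s i)) * s)) = cod.K ((\<lambda>i. poly_star (s' i)) * s')"
      using dom.star_homD(3)[OF h dom.class_carrier dom.class_carrier, of "\<lambda>i. poly_star (s i)" s]
        s s' st ds.st_closed[OF s] cs.st_closed[of s']
      by (simp add: dom.cmult_class cod.cmult_class)
    then show "M ((\<lambda>i. poly_star (s i)) * s) = (M s)\<^sup>2"
      using s' cs.mult_closed[OF cs.st_closed, of s' s']
      by (simp add: M_def cod.cnorm_class cs.N_st_mult)
    assume t: "t \<in> dom.cauchy"
    then obtain t' where t': "t' \<in> cod.cauchy" "h (dom.K t) = cod.K t'" using rep by blast
    have "h (dom.K (s + t)) = cod.K (s' + t')"
      using dom.star_homD(2)[OF h dom.class_carrier dom.class_carrier, of s t] s s' t t'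
      by (simp add: dom.cadd_class cod.cadd_class)
    then show "M (s + t) \<le> M s + M t"
      using s' t' by (simp add: M_def cod.cnorm_class cs.N_add)
    have "h (dom.K (s * t)) = cod.K (s' * t')"
      using dom.star_homD(3)[OF h dom.class_carrier dom.class_carrier, of s t] s s' t t'
      by (simp add: dom.cmult_class cod.cmult_class)
    then show "M (s * t) \<le> M s * M t"
      using s' t' by (simp add: M_def cod.cnorm_class cs.N_mult)
  qed
  moreover have "M s = 0" if "s \<in> dom.cauchy" "dom.lim_norm s = 0" for s
  proof -
    \<comment> \<open>Preservation of zero is not among the clauses of \<open>star_hom\<close>; it
      follows from compatibility with scaling by 0.\<close>
    have "dom.K s = dom.K (\<lambda>i. poly_scale 0 (s i))"
      using that by (simp add: dom.class_eq_iff flip: zero_fun_def)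
    then have "h (dom.K s) = cscale cod.C 0 (h (dom.K s))"
      using dom.star_homD(4)[OF h dom.class_carrier[OF that(1)], of 0]
        dom.cscale_class[OF that(1), of 0] by metis
    moreover obtain t where "t \<in> cod.cauchy" "h (dom.K s) = cod.K t"
      using rep \<open>s \<in> dom.cauchy\<close> by blast
    ultimately have "h (dom.K s) = cod.K 0"
      by (simp add: cod.cscale_class zero_fun_def)
    then show ?thesis
      by (simp add: M_def cod.cnorm_class)
  qed
  ultimately have "M s \<le> dom.lim_norm s"
    using s by (rule dom.seminorm_le_lim_norm)
  then show ?thesis by (simp add: M_def)
qed

lemma star_hom_zero:
  assumes h: "star_hom dom.C cod.C h" shows "h (dom.cls 0) = cod.cls 0"
proof -
  have "dom.cls 0 = cscale dom.C 0 (dom.cls 0)"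
    by (simp add: dom.cls_scale)
  then show ?thesis
    using dom.star_homD(4)[OF h, of "dom.cls 0" 0] dom.star_homD(1)[OF h, of "dom.cls 0"]
    by (auto simp: cod.carrier_universal cod.cscale_class cod.cls_def)
qed

lemma star_hom_csum:
  assumes h: "star_hom dom.C cod.C h" and I: "finite I"
    and fg: "\<And>i. i \<in> I \<Longrightarrow> f i \<in> dom.F" "\<And>i. i \<in> I \<Longrightarrow> g i \<in> cod.F"
    and a: "\<And>i. i \<in> I \<Longrightarrow> a i = dom.cls (f i)"
    and ha: "\<And>i. i \<in> I \<Longrightarrow> h (a i) = cod.cls (g i)"
  shows "h (csum dom.C a I) = cod.cls (sum g I)"
proof -
  have "h (dom.cls (sum f J)) = cod.cls (sum g J)" if "J \<subseteq> I" for J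
    using finite_subset[OF that I] that
  proof (induction J rule: finite_induct)
    case (insert i J)
    have "f i \<in> dom.F" "g i \<in> cod.F" "sum f J \<in> dom.F" "sum g J \<in> cod.F"
      using insert.prems fg by (auto intro!: free.sum_closed)
    then show ?case
      using insert a[of i] ha[of i] dom.star_homD(2)[OF h, of "dom.cls (f i)" "dom.cls (sum f J)"]
      by (simp add: dom.cls_add cod.cls_add)
  qed (simp add: star_hom_zero[OF h])
  then show ?thesis
    using dom.csum_cong_cls[of I f a] I fg a by simp
qed

lemma star_hom_cls_eqI:
  assumes f: "star_hom dom.C cod.C f" and g: "star_hom dom.C cod.C g"
    and gen: "\<And>x. x \<in> X \<Longrightarrow> f (dom.cls (poly_gen x)) = g (dom.cls (poly_gen x))"
    and p: "p \<in> dom.F"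
  shows "f (dom.cls p) = g (dom.cls p)"
  using p
proof (induction p rule: free_star_alg_induct)
  case zero
  show ?case by (simp add: star_hom_zero[OF f] star_hom_zero[OF g])
next
  case (scale c p)
  then show ?case
    using dom.star_homD(4)[OF f, of "dom.cls p" c] dom.star_homD(4)[OF g, of "dom.cls p" c]
    by (simp add: dom.cls_scale)
next
  case (star p)
  then show ?case
    using dom.star_homD(5)[OF f, of "dom.cls p"] dom.star_homD(5)[OF g, of "dom.cls p"]
    by (simp add: dom.cls_star)
next
  case (add p q)
  then show ?case
    using dom.star_homD(2)[OF f, of "dom.cls p" "dom.cls q"]
      dom.star_homD(2)[OF g, of "dom.cls p" "dom.cls q"]
    by (simp add: dom.cls_add)
next
  case (mult p q)
  then show ?case
    using dom.star_homD(3)[OF f, of "dom.cls p" "dom.cls q"]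
      dom.star_homD(3)[OF g, of "dom.cls p" "dom.cls q"]
    by (simp add: dom.cls_mult)
qed (rule gen)

text \<open>A late term of \<open>s\<close>, taken as a constant sequence, is within
  \<open>e / 2\<close> of \<open>a\<close>. Both maps agree on it and do not increase distances, so
  their values at \<open>a\<close> are within \<open>e\<close>.\<close>

lemma star_hom_eqI:
  assumes f: "star_hom dom.C cod.C f" and g: "star_hom dom.C cod.C g"
    and gen: "\<And>x. x \<in> X \<Longrightarrow> f (universal_gen X R x) = g (universal_gen X R x)"
    and a: "a \<in> carrier dom.C"
  shows "f a = g a"
proof -
  obtain s where s: "s \<in> dom.cauchy" "a = dom.K s"
    using a by (auto simp: dom.carrier_universal)
  obtain t where t: "t \<in> cod.cauchy" "f a = cod.K t"
    using dom.star_homD(1)[OF f a] by (auto simp: cod.carrier_universal)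
  obtain u where u: "u \<in> cod.cauchy" "g a = cod.K u"
    using dom.star_homD(1)[OF g a] by (auto simp: cod.carrier_universal)
  have "cod.lim_norm (t - u) \<le> 0"
  proof (rule field_le_epsilon)
    fix e :: real assume e: "0 < e"
    obtain i where i: "\<And>k j. i \<le> k \<Longrightarrow> i \<le> j \<Longrightarrow> dom.U (s k - s j) < e / 2"
      using dom.cauchyE[OF s(1), of "e / 2"] e by auto
    let ?c = "\<lambda>_::nat. s i"
    have c: "?c \<in> dom.cauchy" "s i \<in> dom.F"
      using dom.cauchyD[OF s(1)] by (simp_all add: dom.cauchy_const)
    have lim: "dom.lim_norm (s - ?c) \<le> e / 2"
    proof (rule LIMSEQ_le_const2[OF dom.cauchy_lim_norm])
      show "s - ?c \<in> dom.cauchy" using s c by simp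
      show "\<exists>N. \<forall>n\<ge>N. dom.U ((s - ?c) n) \<le> e / 2"
        using i by (intro exI[of _ i]) (auto intro: less_imp_le)
    qed
    obtain v where v: "v \<in> cod.cauchy" "f (dom.K ?c) = cod.K v"
      using dom.star_homD(1)[OF f dom.class_carrier[OF c(1)]] by (auto simp: cod.carrier_universal)
    have gv: "g (dom.K ?c) = cod.K v"
      using star_hom_cls_eqI[OF f g, of "s i"] gen v(2) c(2)
      by (simp add: dom.cls_def dom.universal_gen_eq)
    have diff: "cod.lim_norm (x - v) \<le> e / 2"
      if h: "star_hom dom.C cod.C h" and x: "x \<in> cod.cauchy" "h a = cod.K x"
        and hv: "h (dom.K ?c) = cod.K v" for h x
    proof -
      \<comment> \<open>Differences are reached through addition and scaling by -1, the operations
        that \<open>h\<close> is known to preserve.\<close>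
      have "h (dom.K (\<lambda>i. poly_scale (-1) (?c i))) = cod.K (\<lambda>i. poly_scale (-1) (v i))"
        using dom.star_homD(4)[OF h dom.class_carrier[OF c(1)], of "-1"] hv c v
        by (simp add: dom.cscale_class cod.cscale_class)
      then have "h (dom.K (s + (\<lambda>i. poly_scale (-1) (?c i)))) =
          cod.K (x + (\<lambda>i. poly_scale (-1) (v i)))"
        using dom.star_homD(2)[OF h dom.class_carrier[OF s(1)] dom.class_carrier[OF ds.sc_closed[OF c(1)]], of "-1"]
          s c x v ds.sc_closed[OF c(1), of "-1"] cs.sc_closed[OF v(1), of "-1"]
        by (simp add: dom.cadd_class cod.cadd_class)
      then have "h (dom.K (s - ?c)) = cod.K (x - v)"
        by (simp add: ds.sc_minus_one cs.sc_minus_one)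
      then show ?thesis
        using star_hom_norm_le[OF h, of "s - ?c"] lim s c x v by (simp add: cod.cnorm_class)
    qed
    have "cod.lim_norm (t - u) \<le> cod.lim_norm (t - v) + cod.lim_norm (v - u)"
      using t u v by (intro cs.N_diff_triangle)
    also have "\<dots> \<le> e / 2 + e / 2"
      using diff[OF f t v(2)] diff[OF g u gv] cs.N_diff_commute[OF u(1) v(1)] by simp
    finally show "cod.lim_norm (t - u) \<le> 0 + e" by simp
  qed
  then show ?thesis
    using t u cs.N_nonneg[of "t - u"] by (simp add: cod.class_eq_iff)
qed

text \<open>Composing the universal seminorm of the codomain with substitution gives a C*-seminorm
  that kills \<open>R\<close>, hence one of those whose supremum is the universal seminorm of the
  domain. Substitution is therefore contractive and acts termwise on Cauchy sequences.\<close>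

lemma star_hom_exists:
  assumes \<sigma>: "\<And>x. x \<in> X \<Longrightarrow> \<sigma> x \<in> cod.F" and R: "R \<subseteq> dom.F" and S: "S \<subseteq> cod.F"
    and rel: "\<And>r. r \<in> R \<Longrightarrow> cod.U (poly_subst \<sigma> r) = 0"
  shows "\<exists>h. star_hom dom.C cod.C h \<and> (\<forall>p\<in>dom.F. h (dom.cls p) = cod.cls (poly_subst \<sigma> p))"
proof -
  define \<phi> where "\<phi> = poly_subst \<sigma>"
  note \<phi>_simps = poly_subst_add[of \<sigma>, folded \<phi>_def] poly_subst_diff[of \<sigma>, folded \<phi>_def]
    poly_subst_mult[of \<sigma>, folded \<phi>_def] poly_subst_scale[of \<sigma>, folded \<phi>_def]
    poly_subst_star[of \<sigma>, folded \<phi>_def]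
  have cl: "\<phi> p \<in> cod.F" if "p \<in> dom.F" for p
    unfolding \<phi>_def using that \<sigma> by (rule poly_subst_closed)
  have "(\<lambda>p. cod.U (\<phi> p)) \<in> rel_seminorms X R"
    unfolding rel_seminorms_def cstar_seminorm_def
    using rel cod.N_sc cod.N_st_mult
    by (auto simp: \<phi>_simps cl cod.N_nonneg cod.N_add cod.N_mult simp flip: \<phi>_def)
  then have le: "cod.U (\<phi> p) \<le> dom.U p" if "p \<in> dom.F" for p
    using dom.seminorm_le_U that by blast
  define \<Phi> where "\<Phi> s = (\<lambda>i. \<phi> (s i))" for s :: "nat \<Rightarrow> _"
  have \<Phi>: "\<Phi> s \<in> cod.cauchy" if s: "s \<in> dom.cauchy" for s
    unfolding cod.cauchy_def
  proof (intro CollectI conjI allI impI)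
    show "\<Phi> s i \<in> cod.F" for i using dom.cauchyD[OF s] by (simp add: \<Phi>_def cl)
    fix e :: real assume "0 < e"
    then obtain K where K: "\<And>i j. K \<le> i \<Longrightarrow> K \<le> j \<Longrightarrow> dom.U (s i - s j) < e"
      using dom.cauchyE[OF s] by blast
    have "cod.U (\<Phi> s i - \<Phi> s j) < e" if "K \<le> i" "K \<le> j" for i j
      using K[OF that] le[of "s i - s j"] dom.cauchyD[OF s] by (simp add: \<Phi>_def \<phi>_simps)
    then show "\<exists>K. \<forall>i\<ge>K. \<forall>j\<ge>K. cod.U (\<Phi> s i - \<Phi> s j) < e" by blast
  qed
  have \<Phi>_le: "cod.lim_norm (\<Phi> s) \<le> dom.lim_norm s" if s: "s \<in> dom.cauchy" for s
    using le dom.cauchyD[OF s]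
    by (intro LIMSEQ_le[OF cod.cauchy_lim_norm[OF \<Phi>[OF s]] dom.cauchy_lim_norm[OF s]])
      (auto simp: \<Phi>_def)
  have \<Phi>_diff: "\<Phi> (s - t) = \<Phi> s - \<Phi> t" for s t
    by (simp add: \<Phi>_def \<phi>_simps fun_eq_iff)
  define h where "h a = (\<Union>s\<in>a. cod.K (\<Phi> s))" for a
  have h: "h (dom.K s) = cod.K (\<Phi> s)" if s: "s \<in> dom.cauchy" for s
    unfolding h_def
  proof (rule dom.UN_class[OF s])
    fix t assume "ds.null_eq s t"
    then show "cod.K (\<Phi> t) = cod.K (\<Phi> s)"
      using \<Phi>_le[of "t - s"] cs.N_nonneg[of "\<Phi> t - \<Phi> s"] ds.N_diff_commute[of s t] \<Phi>
      by (simp add: ds.null_eq_def cod.class_eq_iff \<Phi>_diff)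
  qed
  have ops: "\<Phi> (s + t) = \<Phi> s + \<Phi> t" "\<Phi> (s * t) = \<Phi> s * \<Phi> t"
    "\<Phi> (\<lambda>i. poly_scale c (s i)) = (\<lambda>i. poly_scale c (\<Phi> s i))"
    "\<Phi> (\<lambda>i. poly_star (s i)) = (\<lambda>i. poly_star (\<Phi> s i))" for s t c
    by (simp_all add: \<Phi>_def \<phi>_simps fun_eq_iff)
  have "star_hom dom.C cod.C h"
    unfolding star_hom_def
    by (auto simp: dom.carrier_universal h cod.class_carrier \<Phi> dom.cadd_class dom.cmult_class
        dom.cscale_class dom.cstar_class cod.cadd_class cod.cmult_class cod.cscale_class
        cod.cstar_class ops ds.sc_closed ds.st_closed)
  moreover have "h (dom.cls p) = cod.cls (\<phi> p)" if "p \<in> dom.F" for p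
    using h[OF dom.cauchy_const[OF that]] by (simp add: dom.cls_def cod.cls_def \<Phi>_def)
  ultimately show ?thesis
    unfolding \<phi>_def by blast
qed

end

section \<open>Relations in graph C*-algebras\<close>

lemma (in wf_digraph) graph_rels_closed: "graph_rels G \<subseteq> free_star_alg (graph_gens G)"
proof -
  have "pv v \<in> free_star_alg (graph_gens G)" if "v \<in> verts G" for v
    using that by (intro poly_gen_in_free) (simp add: graph_gens_def)
  moreover have "pe e \<in> free_star_alg (graph_gens G)" if "e \<in> arcs G" for e
    using that by (intro poly_gen_in_free) (simp add: graph_gens_def)
  moreover have "(\<Sum>e\<in>out_arcs G v. pe e * poly_star (pe e)) \<in> free_star_alg (graph_gens G)" for v
    using calculation(2) by (intro free.sum_closed) simp
  ultimately show ?thesis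
    unfolding graph_rels_def reg_def by (auto simp del: in_out_arcs_conv)
qed

text \<open>A vertex is a projection, so its seminorm equals its own square and is at most 1; the
  square of the seminorm of an arc is the seminorm of its head.\<close>

lemma (in wf_digraph) bounded_graph_relations: "bounded_relations (graph_gens G) (graph_rels G)"
proof
  fix x assume x: "x \<in> graph_gens G"
  show "bdd_above ((\<lambda>N. N (poly_gen x)) ` rel_seminorms (graph_gens G) (graph_rels G))"
  proof (rule bdd_aboveI2)
    fix N assume N: "N \<in> rel_seminorms (graph_gens G) (graph_rels G)"
    interpret cstar_seminormed "free_star_alg (graph_gens G)" poly_scale poly_star N
      using N by (simp add: rel_seminorms_def cstar_seminorm_iff)
    have rel: "null_eq p q" if "p - q \<in> graph_rels G" "p \<in> free_star_alg (graph_gens G)"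
      "q \<in> free_star_alg (graph_gens G)" for p q
      using N that by (auto simp: rel_seminorms_def null_eq_def)
    have vert: "N (pv v) \<le> 1" if v: "v \<in> verts G" for v
    proof -
      have cl: "pv v \<in> free_star_alg (graph_gens G)"
        using v by (intro poly_gen_in_free) (simp add: graph_gens_def)
      have "null_eq (poly_star (pv v) * pv v) (pv v * pv v)"
        using v cl by (intro null_eq_mult[OF rel null_eq_refl]) (auto simp: graph_rels_def)
      also have "null_eq (pv v * pv v) (pv v)"
        using v cl by (intro rel) (auto simp: graph_rels_def intro!: exI[of _ v])
      finally have "(N (pv v))\<^sup>2 = N (pv v)"
        using null_eq_N cl by (simp flip: N_st_mult)
      then show ?thesis
        by (auto simp: power2_eq_square)
    qed
    show "N (poly_gen x) \<le> 1"
    proof (cases x)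
      case (GVert v)
      then show ?thesis using x vert by (auto simp: graph_gens_def)
    next
      case (GArc e)
      then have e: "e \<in> arcs G" using x by (auto simp: graph_gens_def)
      then have cl: "pe e \<in> free_star_alg (graph_gens G)" "pv (head G e) \<in> free_star_alg (graph_gens G)"
        by (auto intro!: poly_gen_in_free simp: graph_gens_def)
      have "null_eq (poly_star (pe e) * pe e) (pv (head G e))"
        using e cl by (intro rel) (auto simp: graph_rels_def intro!: exI[of _ e])
      then have "(N (pe e))\<^sup>2 = N (pv (head G e))"
        using null_eq_N cl by (simp flip: N_st_mult)
      also have "\<dots> \<le> 1\<^sup>2"
        using vert e by simp
      finally show ?thesis
        using GArc by (simp add: power2_le_imp_le)
    qed
  qed
qed

locale graph_algebra = wf_digraph G for G :: "('v, 'e) pre_digraph"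
begin

sublocale alg: bounded_relations "graph_gens G" "graph_rels G"
  by (rule bounded_graph_relations)

notation alg.null_eq (infix "\<approx>" 50)

lemma graph_cstar_eq: "graph_cstar G = alg.C"
  by (simp add: graph_cstar_def)

lemma SV_eq: "SV G v = alg.cls (pv v)"
  and SE_eq: "SE G e = alg.cls (pe e)"
  by (simp_all add: SV_def SE_def alg.universal_gen_eq)

lemma pv_closed [simp]: "v \<in> verts G \<Longrightarrow> pv v \<in> alg.F"
  and pe_closed [simp]: "e \<in> arcs G \<Longrightarrow> pe e \<in> alg.F"
  by (auto intro!: poly_gen_in_free simp: graph_gens_def)

lemma rel_null_eq: "p - q \<in> graph_rels G \<Longrightarrow> p \<in> alg.F \<Longrightarrow> q \<in> alg.F \<Longrightarrow> p \<approx> q"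
  using alg.U_rel[of "p - q"] by (simp add: alg.null_eq_def)

lemma star_pv: "v \<in> verts G \<Longrightarrow> poly_star (pv v) \<approx> pv v"
  by (rule rel_null_eq) (auto simp: graph_rels_def)

lemma pv_pv: "u \<in> verts G \<Longrightarrow> v \<in> verts G \<Longrightarrow> pv u * pv v \<approx> (if u = v then pv u else 0)"
  by (rule rel_null_eq) (simp_all add: graph_rels_def, blast)

lemma star_pe_pe:
  "e \<in> arcs G \<Longrightarrow> f \<in> arcs G \<Longrightarrow> poly_star (pe e) * pe f \<approx> (if e = f then pv (head G e) else 0)"
  by (rule rel_null_eq) (simp_all add: graph_rels_def, blast)

lemma pv_tail_pe: "e \<in> arcs G \<Longrightarrow> pv (tail G e) * pe e \<approx> pe e"
  by (rule rel_null_eq) (auto simp: graph_rels_def)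

lemma reg_sum: "v \<in> reg G \<Longrightarrow> pv v \<approx> (\<Sum>e\<in>out_arcs G v. pe e * poly_star (pe e))"
  by (rule rel_null_eq, simp add: graph_rels_def, blast, simp add: reg_def, rule free.sum_closed, simp)

lemma pv_pe:
  assumes "v \<in> verts G" "e \<in> arcs G"
  shows "pv v * pe e \<approx> (if v = tail G e then pe e else 0)"
proof -
  have "pv v * pe e \<approx> pv v * (pv (tail G e) * pe e)"
    using assms by (intro alg.null_eq_mult alg.null_eq_sym[OF pv_tail_pe]) simp_all
  also have "pv v * (pv (tail G e) * pe e) = pv v * pv (tail G e) * pe e"
    by (simp add: mult.assoc)
  also have "\<dots> \<approx> (if v = tail G e then pv v else 0) * pe e"
    using assms by (intro alg.null_eq_mult pv_pv) simp_all
  also have "\<dots> \<approx> (if v = tail G e then pe e else 0)"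
    using assms by (auto simp: pv_tail_pe)
  finally show ?thesis .
qed

text \<open>
  The C*-identity turns this into \<open>(pe e * q - pe e)\<^sup>* (pe e * q - pe e) = 0\<close> for \<open>q = pv (head G e)\<close>.
\<close>

lemma pe_pv_head:
  assumes e: "e \<in> arcs G" shows "pe e * pv (head G e) \<approx> pe e"
proof -
  let ?q = "pv (head G e)" and ?p = "pe e"
  let ?d = "?p * ?q - ?p"
  have cl: "?q \<in> alg.F" "?p \<in> alg.F" "?d \<in> alg.F" using e by simp_all
  have pp: "poly_star ?p * ?p \<approx> ?q" using star_pe_pe[OF e e] by simp
  have qq: "?q * ?q \<approx> ?q" using pv_pv[of "head G e" "head G e"] e by simp
  have "poly_star ?p * ?d = poly_star ?p * ?p * ?q - poly_star ?p * ?p"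
    by (simp add: algebra_simps)
  also have "\<dots> \<approx> ?q * ?q - ?q"
    using cl by (intro alg.null_eq_diff alg.null_eq_mult pp) simp_all
  also have "\<dots> \<approx> ?q - ?q"
    using cl by (intro alg.null_eq_diff qq) simp_all
  finally have 0: "poly_star ?p * ?d \<approx> 0" by simp
  have "poly_star ?d * ?d = poly_star ?q * (poly_star ?p * ?d) - poly_star ?p * ?d"
    by (simp add: free.st_diff poly_star_mult algebra_simps)
  also have "\<dots> \<approx> poly_star ?q * 0 - 0"
    using cl by (intro alg.null_eq_diff alg.null_eq_mult 0) simp_all
  finally have "alg.U (poly_star ?d * ?d) = 0"
    by (simp add: alg.null_eq_0_iff)
  then show ?thesis
    using cl by (simp add: alg.N_st_mult alg.null_eq_diff_0_iff)
qed

lemma star_pe_pv: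
  assumes "v \<in> verts G" "e \<in> arcs G"
  shows "poly_star (pe e) * pv v \<approx> (if v = tail G e then poly_star (pe e) else 0)"
proof -
  have "poly_star (pe e) * pv v \<approx> poly_star (pe e) * poly_star (pv v)"
    using assms by (intro alg.null_eq_mult alg.null_eq_sym[OF star_pv]) simp_all
  also have "\<dots> = poly_star (pv v * pe e)"
    by (simp add: poly_star_mult)
  also have "\<dots> \<approx> poly_star (if v = tail G e then pe e else 0)"
    using assms by (intro alg.null_eq_st pv_pe)
  finally show ?thesis by (auto split: if_splits)
qed

section \<open>Paths and the graph inverse semigroup\<close>

text \<open>The vertex in front makes a path of length 0 its vertex projection instead of the empty
  product 1, which is outside \<open>alg.F\<close>. On longer paths it is absorbed by the first
  arc.\<close>

definition path_poly :: "('v, 'e) path \<Rightarrow> ('v, 'e) graph_gen star_poly" where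
  "path_poly \<alpha> = pv (fst \<alpha>) * prod_list (map pe (snd \<alpha>))"

text \<open>The factor \<open>a\<close> carries the induction: the bare product of arcs is 1 for the
  empty list.\<close>

lemma mult_arcs_closed:
  "a \<in> alg.F \<Longrightarrow> set p \<subseteq> arcs G \<Longrightarrow> a * prod_list (map pe p) \<in> alg.F"
proof (induction p arbitrary: a)
  case (Cons e p)
  then show ?case using Cons.IH[of "a * pe e"] by (simp add: mult.assoc)
qed simp

lemma null_eq_mult_arcs:
  "a \<approx> b \<Longrightarrow> set p \<subseteq> arcs G \<Longrightarrow> a * prod_list (map pe p) \<approx> b * prod_list (map pe p)"
proof (induction p arbitrary: a b)
  case (Cons e p)
  then show ?case
    using Cons.IH[of "a * pe e" "b * pe e"] by (simp add: mult.assoc alg.null_eq_mult)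
qed simp

lemma path_poly_closed [simp]: "awalk u p v \<Longrightarrow> path_poly (u, p) \<in> alg.F"
  unfolding path_poly_def by (rule mult_arcs_closed) (auto simp: awalk_def)

lemma pv_path_poly:
  assumes "awalk u p v" "u' \<in> verts G"
  shows "pv u' * path_poly (u, p) \<approx> (if u' = u then path_poly (u, p) else 0)"
proof -
  have u: "u \<in> verts G" and p: "set p \<subseteq> arcs G" using assms by (auto simp: awalk_def)
  have "pv u' * pv u * prod_list (map pe p) \<approx> (if u' = u then pv u' else 0) * prod_list (map pe p)"
    using u p assms by (intro null_eq_mult_arcs pv_pv)
  then show ?thesis
    by (auto simp: path_poly_def mult.assoc)
qed

lemma path_poly_Cons:
  assumes e: "e \<in> arcs G" and p: "awalk (head G e) p v"
  shows "path_poly (tail G e, e # p) \<approx> pe e * path_poly (head G e, p)"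
proof -
  have ps: "set p \<subseteq> arcs G" using p by (auto simp: awalk_def)
  have "path_poly (tail G e, e # p) = (pv (tail G e) * pe e) * prod_list (map pe p)"
    by (simp add: path_poly_def mult.assoc)
  also have "\<dots> \<approx> (pe e * pv (head G e)) * prod_list (map pe p)"
    using e ps alg.null_eq_sym[OF pe_pv_head[OF e]] pv_tail_pe[OF e]
    by (intro null_eq_mult_arcs) (auto intro: alg.null_eq_trans)
  finally show ?thesis
    by (simp add: path_poly_def mult.assoc)
qed

lemma path_poly_append:
  "awalk u p x \<Longrightarrow> awalk x q y \<Longrightarrow> path_poly (u, p) * path_poly (x, q) \<approx> path_poly (u, p @ q)"
proof (induction p arbitrary: u)
  case Nil
  then show ?case
    using pv_path_poly[of x q y x] by (auto simp: path_poly_def awalk_Nil_iff mult.assoc)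
next
  case (Cons e p)
  then have e: "e \<in> arcs G" "u = tail G e" and p: "awalk (head G e) p x" and pq: "awalk (head G e) (p @ q) y"
    by (auto simp: awalk_Cons_iff)
  have "path_poly (u, e # p) * path_poly (x, q) \<approx> (pe e * path_poly (head G e, p)) * path_poly (x, q)"
    unfolding e(2) using Cons.prems
    by (intro alg.null_eq_mult path_poly_Cons[OF e(1) p] alg.null_eq_refl) simp
  also have "\<dots> = pe e * (path_poly (head G e, p) * path_poly (x, q))"
    by (simp add: mult.assoc)
  also have "\<dots> \<approx> pe e * path_poly (head G e, p @ q)"
    using e Cons.IH[OF p Cons.prems(2)] by (intro alg.null_eq_mult) simp_all
  also have "\<dots> \<approx> path_poly (u, (e # p) @ q)"
    unfolding e(2) using path_poly_Cons[OF e(1) pq] by (auto intro: alg.null_eq_sym)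
  finally show ?case .
qed

text \<open>Equal first arcs cancel and leave the projection at their head, which the rest of the
  second path absorbs; different first arcs give 0. What survives is the tail of the longer
  path.\<close>

lemma star_path_poly_mult:
  assumes "awalk u p x" "awalk u' q y"
  shows "poly_star (path_poly (u, p)) * path_poly (u', q) \<approx>
    (if path_ext (u, p) (u', q) then path_poly (x, drop (length p) q)
     else if path_ext (u', q) (u, p) then poly_star (path_poly (y, drop (length q) p)) else 0)"
  using assms
proof (induction p arbitrary: u u' q)
  case Nil
  then have u: "u \<in> verts G" "x = u" by (auto simp: awalk_Nil_iff)
  have "poly_star (path_poly (u, [])) * path_poly (u', q) \<approx> pv u * path_poly (u', q)"
    using alg.null_eq_mult[OF star_pv[OF u(1)] alg.null_eq_refl[OF path_poly_closed[OF Nil(2)]]]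
    by (simp add: path_poly_def)
  also have "\<dots> \<approx> (if u = u' then path_poly (u', q) else 0)"
    using pv_path_poly[OF Nil(2) u(1)] by simp
  finally show ?case
    using u by (simp add: path_ext_def split: if_splits)
next
  case (Cons e p)
  note IH = Cons.IH
  from Cons have e: "e \<in> arcs G" "u = tail G e" and p: "awalk (head G e) p x"
    by (auto simp: awalk_Cons_iff)
  let ?P = "path_poly (head G e, p)"
  have P: "?P \<in> alg.F" using p by simp
  have "poly_star (path_poly (u, e # p)) \<approx> poly_star (pe e * ?P)"
    unfolding e(2) by (rule alg.null_eq_st[OF path_poly_Cons[OF e(1) p]])
  then have 1: "poly_star (path_poly (u, e # p)) * path_poly (u', q) \<approx>
      poly_star ?P * (poly_star (pe e) * path_poly (u', q))"
    using alg.null_eq_mult[OF _ alg.null_eq_refl, of "poly_star (path_poly (u, e # p))"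
        "poly_star (pe e * ?P)" "path_poly (u', q)"] Cons.prems
    by (simp add: poly_star_mult mult.assoc)
  show ?case
  proof (cases q)
    case Nil
    then have u': "u' \<in> verts G" "y = u'" using Cons.prems by (auto simp: awalk_Nil_iff)
    have "poly_star ?P * (poly_star (pe e) * path_poly (u', q)) \<approx>
        poly_star ?P * (if u' = u then poly_star (pe e) else 0)"
      using star_pe_pv[OF u'(1) e(1)] P e(2) Nil
      by (intro alg.null_eq_mult) (simp_all add: path_poly_def)
    also have "\<dots> \<approx> (if u' = u then poly_star (path_poly (u, e # p)) else 0)"
      using alg.null_eq_st[OF alg.null_eq_sym[OF path_poly_Cons[OF e(1) p]]] e(2)
      by (auto simp: poly_star_mult)
    finally have "poly_star (path_poly (u, e # p)) * path_poly (u', q) \<approx>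
        (if u' = u then poly_star (path_poly (u, e # p)) else 0)"
      using 1 alg.null_eq_trans by blast
    then show ?thesis
      using Nil u' by (auto simp: path_ext_def split: if_splits)
  next
    case (Cons f q')
    then have f: "f \<in> arcs G" "u' = tail G f" and q': "awalk (head G f) q' y"
      using Cons.prems by (auto simp: awalk_Cons_iff)
    let ?Q = "path_poly (head G f, q')"
    have Q: "?Q \<in> alg.F" using q' by simp
    have "poly_star (pe e) * path_poly (u', q) \<approx> poly_star (pe e) * (pe f * ?Q)"
      unfolding Cons f(2) using e
      by (intro alg.null_eq_mult path_poly_Cons[OF f(1) q'] alg.null_eq_refl) simp
    also have "\<dots> = poly_star (pe e) * pe f * ?Q"
      by (simp add: mult.assoc)
    also have "\<dots> \<approx> (if e = f then pv (head G e) else 0) * ?Q"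
      using e f Q by (intro alg.null_eq_mult star_pe_pe) simp_all
    also have "\<dots> \<approx> (if e = f then ?Q else 0)"
      using pv_path_poly[OF q', of "head G f"] f by auto
    finally have "poly_star ?P * (poly_star (pe e) * path_poly (u', q)) \<approx>
        poly_star ?P * (if e = f then ?Q else 0)"
      using P by (intro alg.null_eq_mult) simp_all
    then have 2: "poly_star (path_poly (u, e # p)) * path_poly (u', q) \<approx>
        (if e = f then poly_star ?P * ?Q else 0)"
      using alg.null_eq_trans[OF 1] by (cases "e = f") simp_all
    show ?thesis
    proof (cases "e = f")
      case True
      with 2 have "poly_star (path_poly (u, e # p)) * path_poly (u', q) \<approx> poly_star ?P * ?Q"
        by simp
      from alg.null_eq_trans[OF this IH[OF p q']] show ?thesis
        using e(2) f(2) True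
        by (cases "prefix p q'"; cases "prefix q' p") (simp_all add: path_ext_def Cons)
    next
      case False
      then show ?thesis using 2 Cons by (auto simp: path_ext_def)
    qed
  qed
qed

text \<open>A polynomial representing \<open>S_gis\<close>, so that identities can be checked modulo
  null elements before passing to classes.\<close>

fun gis_poly :: "('v, 'e) gis \<Rightarrow> ('v, 'e) graph_gen star_poly" where
  "gis_poly (Some (\<alpha>, \<beta>)) = path_poly \<alpha> * poly_star (path_poly \<beta>)"
| "gis_poly None = 0"

lemma path_target_eq: "awalk u p v \<Longrightarrow> path_target G (u, p) = v"
  by (simp add: path_target_def)

lemma FP_iff: "(u, p) \<in> FP G \<longleftrightarrow> (\<exists>v. awalk u p v)"
  by (simp add: FP_def)

lemma gis_carrier_iff:
  "Some ((u, p), (v, q)) \<in> gis_carrier G \<longleftrightarrow> (\<exists>x. awalk u p x \<and> awalk v q x)"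
  by (auto simp: gis_carrier_def FP_iff path_target_eq)

lemma gis_carrierE:
  assumes "s \<in> gis_carrier G"
  obtains "s = None"
  | u p v q x where "s = Some ((u, p), (v, q))" "awalk u p x" "awalk v q x"
proof (cases s)
  case (Some a)
  then obtain u p v q where a: "s = Some ((u, p), (v, q))" by (metis surj_pair)
  then show thesis using assms that(2) by (auto simp: gis_carrier_iff)
qed (rule that(1))

lemma gis_poly_closed [simp]: "s \<in> gis_carrier G \<Longrightarrow> gis_poly s \<in> alg.F"
  by (erule gis_carrierE) auto

lemma gis_poly_inv: "gis_poly (gis_inv s) = poly_star (gis_poly s)"
  by (cases s rule: gis_inv.cases) (simp_all add: poly_star_mult poly_star_star)

text \<open>\<open>star_path_poly_mult\<close> evaluates the two inner factors, and the surviving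
  tail continues the outer path on its side. The three outcomes are the three branches of
  \<open>gis_mult\<close>.\<close>

lemma gis_poly_mult:
  assumes "s \<in> gis_carrier G" "t \<in> gis_carrier G"
  shows "gis_poly s * gis_poly t \<approx> gis_poly (gis_mult s t)"
proof (cases "s = None \<or> t = None")
  case False
  obtain u p v q x where s: "s = Some ((u, p), (v, q))" "awalk u p x" "awalk v q x"
    by (rule gis_carrierE[OF assms(1)]) (use False in auto)
  obtain u' p' v' q' y where
    t: "t = Some ((u', p'), (v', q'))" "awalk u' p' y" "awalk v' q' y"
    by (rule gis_carrierE[OF assms(2)]) (use False in auto)
  let ?P = "path_poly (u, p)" and ?Q = "poly_star (path_poly (v', q'))"
  let ?M = "poly_star (path_poly (v, q)) * path_poly (u', p')"
  have cl: "?P \<in> alg.F" "?Q \<in> alg.F" using s t by simp_all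
  have eq: "gis_poly s * gis_poly t = ?P * ?M * ?Q"
    by (simp add: s(1) t(1) mult.assoc)
  note M = star_path_poly_mult[OF s(3) t(2)]
  consider (ext) "path_ext (v, q) (u', p')" | (ext') "\<not> path_ext (v, q) (u', p')" "path_ext (u', p') (v, q)"
    | (none) "\<not> path_ext (v, q) (u', p')" "\<not> path_ext (u', p') (v, q)" by blast
  then show ?thesis
  proof cases
    case ext
    then obtain r where r: "u' = v" "p' = q @ r" by (auto simp: path_ext_def prefix_def)
    have r': "awalk x r y" using t(2) s(3) r by (auto dest: awalk_ends_eqD)
    have "?P * ?M \<approx> ?P * path_poly (x, r)"
      using M ext r cl by (intro alg.null_eq_mult) simp_all
    also have "\<dots> \<approx> path_poly (u, p @ r)"
      by (rule path_poly_append[OF s(2) r'])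
    finally show ?thesis
      unfolding eq using alg.null_eq_mult[OF _ alg.null_eq_refl[OF cl(2)]] ext r
      by (simp add: s(1) t(1) path_app_def)
  next
    case ext'
    then obtain r where r: "u' = v" "q = p' @ r" by (auto simp: path_ext_def prefix_def)
    have r': "awalk y r x" using t(2) s(3) r by (auto dest: awalk_ends_eqD)
    have "?M * ?Q \<approx> poly_star (path_poly (y, r)) * ?Q"
      using M ext' r cl by (intro alg.null_eq_mult) simp_all
    also have "\<dots> = poly_star (path_poly (v', q') * path_poly (y, r))"
      by (simp add: poly_star_mult)
    also have "\<dots> \<approx> poly_star (path_poly (v', q' @ r))"
      by (intro alg.null_eq_st path_poly_append[OF t(3) r'])
    finally show ?thesis
      unfolding eq using alg.null_eq_mult[OF alg.null_eq_refl[OF cl(1)]] ext' r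
      by (simp add: s(1) t(1) path_app_def mult.assoc)
  next
    case none
    then have "?P * ?M * ?Q \<approx> ?P * 0 * ?Q"
      using M cl by (intro alg.null_eq_mult) simp_all
    then show ?thesis
      unfolding eq using none by (simp add: s(1) t(1))
  qed
qed auto

lemma S_path_eq: "awalk u p v \<Longrightarrow> S_path G (u, p) = alg.cls (path_poly (u, p))"
proof (induction p arbitrary: u)
  case Nil
  then show ?case by (simp add: SV_eq path_poly_def)
next
  case (Cons e p)
  then have e: "e \<in> arcs G" "u = tail G e" and p: "awalk (head G e) p v"
    by (auto simp: awalk_Cons_iff)
  have eq: "alg.cls (path_poly (u, e # p)) = alg.cls (pe e * path_poly (head G e, p))"
    unfolding e(2) by (rule alg.cls_eqI[OF path_poly_Cons[OF e(1) p]])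
  show ?case
  proof (cases p)
    case Nil
    then show ?thesis
      using eq alg.cls_eqI[OF pe_pv_head[OF e(1)]] by (simp add: SE_eq path_poly_def)
  next
    case (Cons f q)
    then show ?thesis
      using eq Cons.IH[OF p] e p by (simp add: SE_eq graph_cstar_eq alg.cls_mult)
  qed
qed

lemma S_gis_eq: "s \<in> gis_carrier G \<Longrightarrow> S_gis G s = alg.cls (gis_poly s)"
  by (erule gis_carrierE)
    (auto simp: graph_cstar_eq alg.cls_zero S_path_eq alg.cls_star alg.cls_mult)

end

section \<open>Homomorphisms of graph C*-algebras\<close>

locale graph_algebra_pair = dom: graph_algebra G + cod: graph_algebra H
  for G :: "('v, 'e) pre_digraph" and H :: "('u, 'x) pre_digraph"
begin

sublocale alg: bounded_relations_pair "graph_gens G" "graph_rels G" "graph_gens H" "graph_rels H"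
  by unfold_locales

text \<open>The premises say that \<open>\<sigma>\<close> is a Cuntz-Krieger family modulo null
  elements.\<close>

lemma star_hom_exists:
  fixes \<sigma> :: "('v, 'e) graph_gen \<Rightarrow> ('u, 'x) graph_gen star_poly"
  assumes vert: "\<And>v. v \<in> verts G \<Longrightarrow> \<sigma> (GVert v) \<in> cod.alg.F"
    and arc: "\<And>e. e \<in> arcs G \<Longrightarrow> \<sigma> (GArc e) \<in> cod.alg.F"
    and star_vert: "\<And>v. v \<in> verts G \<Longrightarrow>
      cod.alg.null_eq (poly_star (\<sigma> (GVert v))) (\<sigma> (GVert v))"
    and vert_vert: "\<And>u v. u \<in> verts G \<Longrightarrow> v \<in> verts G \<Longrightarrow>
      cod.alg.null_eq (\<sigma> (GVert u) * \<sigma> (GVert v)) (if u = v then \<sigma> (GVert u) else 0)"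
    and arc_arc: "\<And>e f. e \<in> arcs G \<Longrightarrow> f \<in> arcs G \<Longrightarrow>
      cod.alg.null_eq (poly_star (\<sigma> (GArc e)) * \<sigma> (GArc f)) (if e = f then \<sigma> (GVert (head G e)) else 0)"
    and vert_arc: "\<And>e. e \<in> arcs G \<Longrightarrow>
      cod.alg.null_eq (\<sigma> (GVert (tail G e)) * \<sigma> (GArc e)) (\<sigma> (GArc e))"
    and reg: "\<And>v. v \<in> reg G \<Longrightarrow> cod.alg.null_eq (\<sigma> (GVert v))
      (\<Sum>e\<in>out_arcs G v. \<sigma> (GArc e) * poly_star (\<sigma> (GArc e)))"
  obtains h where "star_hom (graph_cstar G) (graph_cstar H) h"
    "\<And>v. v \<in> verts G \<Longrightarrow> h (SV G v) = cod.alg.cls (\<sigma> (GVert v))"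
    "\<And>e. e \<in> arcs G \<Longrightarrow> h (SE G e) = cod.alg.cls (\<sigma> (GArc e))"
proof -
  have subst_if: "poly_subst \<sigma> (if b then p else 0) = (if b then poly_subst \<sigma> p else 0)" for b p
    by simp
  have "\<sigma> x \<in> cod.alg.F" if "x \<in> graph_gens G" for x
    using that vert arc by (auto simp: graph_gens_def)
  moreover have "cod.alg.U (poly_subst \<sigma> r) = 0" if "r \<in> graph_rels G" for r
    using that unfolding graph_rels_def[of G]
    using star_vert vert_vert arc_arc vert_arc reg
    by (elim UnE CollectE exE conjE)
      (simp_all only: cod.alg.null_eq_def poly_subst_diff poly_subst_mult poly_subst_star
        poly_subst_gen poly_subst_sum subst_if)
  ultimately obtain h where h: "star_hom dom.alg.C cod.alg.C h"
    "\<And>p. p \<in> dom.alg.F \<Longrightarrow> h (dom.alg.cls p) = cod.alg.cls (poly_subst \<sigma> p)"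
    using alg.star_hom_exists[OF _ dom.graph_rels_closed cod.graph_rels_closed, of \<sigma>] by blast
  then show thesis
    by (intro that[of h])
      (simp_all add: dom.graph_cstar_eq cod.graph_cstar_eq dom.SV_eq dom.SE_eq)
qed

lemma star_hom_eqI:
  assumes "star_hom (graph_cstar G) (graph_cstar H) f" "star_hom (graph_cstar G) (graph_cstar H) g"
    and "\<And>v. v \<in> verts G \<Longrightarrow> f (SV G v) = g (SV G v)"
    and "\<And>e. e \<in> arcs G \<Longrightarrow> f (SE G e) = g (SE G e)"
    and "a \<in> carrier (graph_cstar G)"
  shows "f a = g a"
  using assms unfolding dom.graph_cstar_eq cod.graph_cstar_eq
  by (intro alg.star_hom_eqI[of f g a]) (auto simp: SV_def SE_def graph_gens_def)

text \<open>All relations except those at regular vertices are identities between products and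
  inverses in the inverse semigroup, so multiplicativity of \<open>\<phi>\<close> transports them.
  The relation at a regular vertex contains a sum, which the inverse semigroup cannot express; it is
  therefore a premise.\<close>

lemma pushforward_exists:
  assumes \<phi>: "ext_path_hom G H \<phi>"
    and inv: "\<And>s. s \<in> gis_carrier G \<Longrightarrow> \<phi> (gis_inv s) = gis_inv (\<phi> s)"
    and reg: "\<And>u. u \<in> reg G \<Longrightarrow> cod.alg.null_eq (cod.gis_poly (\<phi> (Some (vpath u, vpath u))))
      (\<Sum>e\<in>out_arcs G u. cod.gis_poly (\<phi> (Some (epath G e, epath G e))))"
  shows "\<exists>\<Psi>. is_pushforward G H \<phi> \<Psi>"
proof -
  let ?v = "\<lambda>u. Some (vpath u, vpath u)" and ?e = "\<lambda>e. Some (epath G e, vpath (head G e))"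
  define \<sigma> where "\<sigma> x = cod.gis_poly (\<phi> (case x of GVert u \<Rightarrow> ?v u | GArc e \<Rightarrow> ?e e))" for x
  have v: "?v u \<in> gis_carrier G" if "u \<in> verts G" for u
    using that by (simp add: vpath_def dom.gis_carrier_iff dom.awalk_Nil_iff)
  have e: "?e e \<in> gis_carrier G" if "e \<in> arcs G" for e
    using that by (simp add: vpath_def epath_def dom.gis_carrier_iff dom.awalk_simps)
  have e': "gis_inv (?e e) \<in> gis_carrier G" if "e \<in> arcs G" for e
    using that by (simp add: vpath_def epath_def dom.gis_carrier_iff dom.awalk_simps)
  have cl: "\<phi> s \<in> gis_carrier H" if "s \<in> gis_carrier G" for s
    using \<phi> that by (auto simp: ext_path_hom_def)
  have mult: "cod.alg.null_eq (cod.gis_poly (\<phi> s) * cod.gis_poly (\<phi> t)) (cod.gis_poly (\<phi> (gis_mult s t)))"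
    if "s \<in> gis_carrier G" "t \<in> gis_carrier G" for s t
    using cod.gis_poly_mult[OF cl[OF that(1)] cl[OF that(2)]] \<phi> that by (simp add: ext_path_hom_def)
  have star: "poly_star (cod.gis_poly (\<phi> s)) = cod.gis_poly (\<phi> (gis_inv s))"
    if "s \<in> gis_carrier G" for s
    using inv[OF that] by (simp add: cod.gis_poly_inv)
  have None: "\<phi> None = None" using \<phi> by (simp add: ext_path_hom_def)
  have ee: "gis_mult (?e e) (gis_inv (?e e)) = Some (epath G e, epath G e)" for e
    by (simp add: vpath_def epath_def path_ext_def path_app_def)
  obtain h where h: "star_hom (graph_cstar G) (graph_cstar H) h"
    "\<And>v. v \<in> verts G \<Longrightarrow> h (SV G v) = cod.alg.cls (\<sigma> (GVert v))"
    "\<And>e. e \<in> arcs G \<Longrightarrow> h (SE G e) = cod.alg.cls (\<sigma> (GArc e))"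
  proof (rule star_hom_exists[of \<sigma>])
    fix u v assume "u \<in> verts G" "v \<in> verts G"
    then show "cod.alg.null_eq (\<sigma> (GVert u) * \<sigma> (GVert v)) (if u = v then \<sigma> (GVert u) else 0)"
      using mult[OF v v, of u v] None by (auto simp: \<sigma>_def vpath_def path_ext_def path_app_def)
  next
    fix u assume u: "u \<in> verts G"
    then show "cod.alg.null_eq (poly_star (\<sigma> (GVert u))) (\<sigma> (GVert u))"
      using star[OF v[OF u]] cl[OF v[OF u]] by (simp add: \<sigma>_def)
  next
    fix a b assume "a \<in> arcs G" "b \<in> arcs G"
    then show "cod.alg.null_eq (poly_star (\<sigma> (GArc a)) * \<sigma> (GArc b))
        (if a = b then \<sigma> (GVert (head G a)) else 0)"
      using mult[OF e' e, of a b] star[OF e, of a] None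
      by (auto simp: \<sigma>_def vpath_def epath_def path_ext_def path_app_def)
  next
    fix a assume "a \<in> arcs G"
    then show "cod.alg.null_eq (\<sigma> (GVert (tail G a)) * \<sigma> (GArc a)) (\<sigma> (GArc a))"
      using mult[OF v e, of "tail G a" a] by (simp add: \<sigma>_def vpath_def epath_def path_ext_def path_app_def)
  next
    fix u assume u: "u \<in> reg G"
    have "cod.alg.null_eq (\<sigma> (GArc a) * poly_star (\<sigma> (GArc a)))
        (cod.gis_poly (\<phi> (Some (epath G a, epath G a))))" if "a \<in> out_arcs G u" for a
      using mult[OF e e', of a a] star[OF e, of a] that ee[of a] by (simp add: \<sigma>_def del: gis_inv.simps gis_mult.simps)
    then have "cod.alg.null_eq (\<Sum>a\<in>out_arcs G u. cod.gis_poly (\<phi> (Some (epath G a, epath G a))))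
        (\<Sum>a\<in>out_arcs G u. \<sigma> (GArc a) * poly_star (\<sigma> (GArc a)))"
      by (rule cod.alg.null_eq_sym[OF cod.alg.null_eq_sum])
    then show "cod.alg.null_eq (\<sigma> (GVert u)) (\<Sum>a\<in>out_arcs G u. \<sigma> (GArc a) * poly_star (\<sigma> (GArc a)))"
      using cod.alg.null_eq_trans[OF reg[OF u]] by (simp add: \<sigma>_def)
  qed (use v e cl in \<open>simp_all add: \<sigma>_def\<close>)
  have "is_pushforward G H \<phi> h"
    using h v e cl by (simp add: is_pushforward_def cod.S_gis_eq \<sigma>_def)
  then show ?thesis by blast
qed

end

section \<open>The multi-out-split homomorphism\<close>

locale multi_out_splitting = wf_digraph G for G :: "('v, 'e) pre_digraph" +
  fixes m :: "'v \<Rightarrow> nat" and P :: "'v \<Rightarrow> nat \<Rightarrow> 'e set"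
  assumes partition: "multi_out_partition G m P"
begin

abbreviation "GO \<equiv> multi_out_split G m P"

lemma verts_split: "verts GO = {(v, i). v \<in> verts G \<and> i \<in> {1..m v}}"
  and arcs_split: "arcs GO = {(e, i). e \<in> arcs G \<and> i \<in> {1..m (head G e)}}"
  and head_split: "head GO (e, i) = (head G e, i)"
  by (auto simp: multi_out_split_def split: prod.splits)

lemma vert_fiber:
  "v \<in> verts G \<Longrightarrow> {u \<in> verts GO. fst multi_out_split_hom u = v} = Pair v ` {1..m v}"
  by (auto simp: verts_split multi_out_split_hom_def)

lemma arc_fiber:
  "e \<in> arcs G \<Longrightarrow> {x \<in> arcs GO. snd multi_out_split_hom x = e} = Pair e ` {1..m (head G e)}"
  by (auto simp: arcs_split multi_out_split_hom_def)

lemma m_pos: "v \<in> verts G \<Longrightarrow> 1 \<le> m v"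
  using partition by (auto simp: multi_out_partition_def split: if_splits)

lemma partition_out_arcs:
  assumes "v \<in> verts G" "out_arcs G v \<noteq> {}"
  shows "(\<Union>i\<in>{1..m v}. P v i) = out_arcs G v" "disjoint_family_on (P v) {1..m v}"
    "\<And>i. i \<in> {1..m v} \<Longrightarrow> P v i \<noteq> {}"
  using bspec[OF partition[unfolded multi_out_partition_def] assms(1), unfolded if_not_P[OF assms(2)]]
  by blast+

lemma tail_split_eq:
  assumes "e \<in> arcs G" "i \<in> {1..m (tail G e)}" "e \<in> P (tail G e) i"
  shows "tail GO (e, k) = (tail G e, i)"
proof -
  have "tail G e \<in> verts G" "out_arcs G (tail G e) \<noteq> {}" using assms(1) by auto
  then have "disjoint_family_on (P (tail G e)) {1..m (tail G e)}"
    by (rule partition_out_arcs)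
  then have "(THE j. j \<in> {1..m (tail G e)} \<and> e \<in> P (tail G e) j) = i"
    using assms unfolding disjoint_family_on_def by (intro the_equality) blast+
  then show ?thesis by (simp add: multi_out_split_def)
qed

lemma arc_classE:
  assumes "e \<in> arcs G"
  obtains i where "i \<in> {1..m (tail G e)}" "e \<in> P (tail G e) i"
proof -
  have "tail G e \<in> verts G" "out_arcs G (tail G e) \<noteq> {}" using assms by auto
  note part = partition_out_arcs(1)[OF this]
  have "e \<in> out_arcs G (tail G e)" using assms by simp
  then show thesis using that unfolding part[symmetric] by blast
qed

lemma wf_digraph_split: "wf_digraph GO"
proof
  fix x assume "x \<in> arcs GO"
  then obtain e k where x: "x = (e, k)" "e \<in> arcs G" "k \<in> {1..m (head G e)}"
    by (auto simp: arcs_split)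
  obtain i where "i \<in> {1..m (tail G e)}" "e \<in> P (tail G e) i"
    using arc_classE[OF x(2)] by blast
  then show "tail GO x \<in> verts GO"
    using x by (simp add: tail_split_eq verts_split)
  show "head GO x \<in> verts GO"
    using x by (simp add: head_split verts_split)
qed

lemma out_arcs_split:
  assumes "v \<in> verts G" "out_arcs G v \<noteq> {}" "i \<in> {1..m v}"
  shows "out_arcs GO (v, i) = (SIGMA e:P v i. {1..m (head G e)})"
proof (intro Set.set_eqI iffI)
  fix x assume x: "x \<in> out_arcs GO (v, i)"
  then obtain e k where e: "x = (e, k)" "e \<in> arcs G" "k \<in> {1..m (head G e)}"
    by (auto simp: arcs_split)
  obtain j where j: "j \<in> {1..m (tail G e)}" "e \<in> P (tail G e) j"
    using arc_classE[OF e(2)] by blast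
  then show "x \<in> (SIGMA e:P v i. {1..m (head G e)})"
    using x e by (auto simp: tail_split_eq)
next
  note part = partition_out_arcs[OF assms(1,2)]
  fix x assume "x \<in> (SIGMA e:P v i. {1..m (head G e)})"
  then obtain e k where e: "x = (e, k)" "e \<in> P v i" "k \<in> {1..m (head G e)}" by auto
  then have "e \<in> out_arcs G v" using part(1) assms(3) by blast
  then show "x \<in> out_arcs GO (v, i)"
    using e tail_split_eq[of e i k] assms(3) by (auto simp: arcs_split)
qed

text \<open>A block of a finite set is finite, and each of its arcs has at least one and only
  finitely many copies.\<close>

lemma reg_split:
  assumes "v \<in> reg G" "i \<in> {1..m v}" shows "(v, i) \<in> reg GO"
proof -
  have v: "v \<in> verts G" "out_arcs G v \<noteq> {}" "finite (out_arcs G v)"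
    using assms by (auto simp: reg_def)
  note part = partition_out_arcs[OF v(1,2)]
  have "P v i \<subseteq> out_arcs G v" using part(1) assms(2) by blast
  then have "finite (P v i)" using v(3) finite_subset by blast
  moreover obtain e where e: "e \<in> P v i" using part(3)[OF assms(2)] by blast
  then have "e \<in> out_arcs G v" using part(1) assms(2) by blast
  then have "1 \<le> m (head G e)" using m_pos by auto
  then have "(e, 1) \<in> out_arcs GO (v, i)" using e v assms by (simp add: out_arcs_split)
  then have "out_arcs GO (v, i) \<noteq> {}" by blast
  ultimately show ?thesis
    using v assms unfolding reg_def by (auto simp: out_arcs_split verts_split)
qed

text \<open>Each generator goes to the sum over its fiber. Products of such sums are double sums, in
  which the terms off the diagonal vanish because different copies of a vertex are
  orthogonal.\<close>

lemma pullback_exists: "\<exists>\<Psi>. is_pullback GO G multi_out_split_hom \<Psi>"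
proof -
  interpret graph_algebra_pair G GO
    using wf_digraph_axioms wf_digraph_split by (simp add: graph_algebra_pair_def graph_algebra_def)
  define \<sigma> where "\<sigma> x = (case x of GVert v \<Rightarrow> \<Sum>i\<in>{1..m v}. pv (v, i)
      | GArc e \<Rightarrow> \<Sum>i\<in>{1..m (head G e)}. pe (e, i))" for x
  have pv: "pv (v, i) \<in> cod.alg.F" if "v \<in> verts G" "i \<in> {1..m v}" for v i
    using that by (simp add: verts_split)
  have pe: "pe (e, i) \<in> cod.alg.F" if "e \<in> arcs G" "i \<in> {1..m (head G e)}" for e i
    using that by (simp add: arcs_split)
  obtain h where h: "star_hom (graph_cstar G) (graph_cstar GO) h"
    "\<And>v. v \<in> verts G \<Longrightarrow> h (SV G v) = cod.alg.cls (\<sigma> (GVert v))"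
    "\<And>e. e \<in> arcs G \<Longrightarrow> h (SE G e) = cod.alg.cls (\<sigma> (GArc e))"
  proof (rule star_hom_exists[of \<sigma>])
    fix v assume "v \<in> verts G"
    then show "cod.alg.null_eq (poly_star (\<sigma> (GVert v))) (\<sigma> (GVert v))"
      unfolding \<sigma>_def by (auto simp: free.st_sum verts_split intro!: cod.alg.null_eq_sum cod.star_pv)
  next
    fix u v assume u: "u \<in> verts G" and v: "v \<in> verts G"
    have "cod.alg.null_eq (\<Sum>i\<in>{1..m u}. \<Sum>j\<in>{1..m v}. pv (u, i) * pv (v, j))
        (\<Sum>i\<in>{1..m u}. \<Sum>j\<in>{1..m v}. if (u, i) = (v, j) then pv (u, i) else 0)"
      using u v by (intro cod.alg.null_eq_sum cod.pv_pv) (auto simp: verts_split)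
    also have "\<dots> = (if u = v then \<Sum>i\<in>{1..m u}. pv (u, i) else 0)"
      by (simp add: sum.delta' cong: if_cong)
    finally show "cod.alg.null_eq (\<sigma> (GVert u) * \<sigma> (GVert v)) (if u = v then \<sigma> (GVert u) else 0)"
      unfolding \<sigma>_def by (cases "u = v") (simp_all add: sum_product)
  next
    fix e f assume e: "e \<in> arcs G" and f: "f \<in> arcs G"
    have "cod.alg.null_eq
        (\<Sum>i\<in>{1..m (head G e)}. \<Sum>j\<in>{1..m (head G f)}. poly_star (pe (e, i)) * pe (f, j))
        (\<Sum>i\<in>{1..m (head G e)}. \<Sum>j\<in>{1..m (head G f)}.
          if (e, i) = (f, j) then pv (head GO (e, i)) else 0)"
      using e f by (intro cod.alg.null_eq_sum cod.star_pe_pe) (auto simp: arcs_split)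
    also have "\<dots> = (if e = f then \<Sum>i\<in>{1..m (head G e)}. pv (head G e, i) else 0)"
      by (simp add: sum.delta' head_split cong: if_cong)
    finally show "cod.alg.null_eq (poly_star (\<sigma> (GArc e)) * \<sigma> (GArc f))
        (if e = f then \<sigma> (GVert (head G e)) else 0)"
      unfolding \<sigma>_def by (cases "e = f") (simp_all add: sum_product free.st_sum)
  next
    fix e assume e: "e \<in> arcs G"
    then obtain j where j: "j \<in> {1..m (tail G e)}" "e \<in> P (tail G e) j"
      by (rule arc_classE)
    have "cod.alg.null_eq
        (\<Sum>i\<in>{1..m (tail G e)}. \<Sum>k\<in>{1..m (head G e)}. pv (tail G e, i) * pe (e, k))
        (\<Sum>i\<in>{1..m (tail G e)}. \<Sum>k\<in>{1..m (head G e)}.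
          if (tail G e, i) = tail GO (e, k) then pe (e, k) else 0)"
      using e by (intro cod.alg.null_eq_sum cod.pv_pe) (auto simp: arcs_split verts_split)
    \<comment> \<open>All copies of \<open>e\<close> start at the same copy of the source, namely
      the one whose block contains \<open>e\<close>.\<close>
    also have "\<dots> = (\<Sum>k\<in>{1..m (head G e)}. \<Sum>i\<in>{1..m (tail G e)}. if i = j then pe (e, k) else 0)"
      using e j by (subst sum.swap) (simp add: tail_split_eq)
    also have "\<dots> = (\<Sum>k\<in>{1..m (head G e)}. pe (e, k))"
      using j by simp
    finally show "cod.alg.null_eq (\<sigma> (GVert (tail G e)) * \<sigma> (GArc e)) (\<sigma> (GArc e))"
      by (simp add: \<sigma>_def sum_product)
  next
    fix v assume v: "v \<in> reg G"
    then have v': "v \<in> verts G" "out_arcs G v \<noteq> {}" "finite (out_arcs G v)"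
      by (auto simp: reg_def)
    note part = partition_out_arcs[OF v'(1,2)]
    have fin: "finite (P v i)" if "i \<in> {1..m v}" for i
      using v'(3) part(1) that by (metis UN_upper finite_subset)
    have "cod.alg.null_eq (\<Sum>i\<in>{1..m v}. pv (v, i))
        (\<Sum>i\<in>{1..m v}. \<Sum>x\<in>out_arcs GO (v, i). pe x * poly_star (pe x))"
      using v by (intro cod.alg.null_eq_sum cod.reg_sum reg_split)
    also have "\<dots> = (\<Sum>i\<in>{1..m v}. \<Sum>e\<in>P v i. \<Sum>k\<in>{1..m (head G e)}. pe (e, k) * poly_star (pe (e, k)))"
    proof (intro sum.cong refl)
      fix i assume i: "i \<in> {1..m v}"
      show "(\<Sum>x\<in>out_arcs GO (v, i). pe x * poly_star (pe x)) =
          (\<Sum>e\<in>P v i. \<Sum>k\<in>{1..m (head G e)}. pe (e, k) * poly_star (pe (e, k)))"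
        unfolding out_arcs_split[OF v'(1,2) i] using fin[OF i]
        by (subst sum.Sigma) (auto intro!: sum.cong)
    qed
    \<comment> \<open>The blocks partition the arcs leaving \<open>v\<close>, so the sum over blocks
      and their arcs is a sum over arcs.\<close>
    also have "\<dots> = (\<Sum>e\<in>out_arcs G v. \<Sum>k\<in>{1..m (head G e)}. pe (e, k) * poly_star (pe (e, k)))"
      unfolding part(1)[symmetric] using part(2) fin
      by (intro sum.UNION_disjoint[symmetric]) (auto simp: disjoint_family_on_def)
    also have "cod.alg.null_eq \<dots>
        (\<Sum>e\<in>out_arcs G v. \<Sum>k\<in>{1..m (head G e)}. \<Sum>l\<in>{1..m (head G e)}. pe (e, k) * poly_star (pe (e, l)))"
    proof (intro cod.alg.null_eq_sum)
      fix e k assume e: "e \<in> out_arcs G v" and k: "k \<in> {1..m (head G e)}"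
      then have ek: "(e, l) \<in> arcs GO" if "l \<in> {1..m (head G e)}" for l
        using that by (simp add: arcs_split)
      \<comment> \<open>Inserting the target projections on both sides shows that two different
        copies of \<open>e\<close>, having orthogonal targets, contribute nothing. This lets the
        single sum over \<open>k\<close> become the double sum that factors.\<close>
      have "cod.alg.null_eq (pe (e, k) * poly_star (pe (e, l)))
          (if k = l then pe (e, k) * poly_star (pe (e, k)) else 0)"
        if l: "l \<in> {1..m (head G e)}" for l
      proof -
        have hd: "(head G e, k) \<in> verts GO" "(head G e, l) \<in> verts GO"
          using e k l by (auto simp: verts_split)
        have "cod.alg.null_eq (pe (e, k) * poly_star (pe (e, l)))
            ((pe (e, k) * pv (head G e, k)) * poly_star (pe (e, l) * pv (head G e, l)))"
          using cod.alg.null_eq_mult[OF cod.alg.null_eq_sym[OF cod.pe_pv_head[OF ek[OF k]]]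
              cod.alg.null_eq_st[OF cod.alg.null_eq_sym[OF cod.pe_pv_head[OF ek[OF l]]]]]
          by (simp add: head_split)
        also have "\<dots> = pe (e, k) * (pv (head G e, k) * poly_star (pv (head G e, l))) * poly_star (pe (e, l))"
          by (simp add: poly_star_mult mult.assoc)
        also have "cod.alg.null_eq \<dots>
            (pe (e, k) * (pv (head G e, k) * pv (head G e, l)) * poly_star (pe (e, l)))"
          using ek[OF k] ek[OF l] hd
          by (intro cod.alg.null_eq_mult cod.star_pv cod.alg.null_eq_refl free.st_closed) simp_all
        also have "cod.alg.null_eq \<dots>
            (pe (e, k) * (if (head G e, k) = (head G e, l) then pv (head G e, k) else 0) * poly_star (pe (e, l)))"
          using ek[OF k] ek[OF l] hd
          by (intro cod.alg.null_eq_mult cod.pv_pv cod.alg.null_eq_refl free.st_closed) simp_all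
        also have "cod.alg.null_eq \<dots> (if k = l then pe (e, k) * poly_star (pe (e, k)) else 0)"
          using cod.pe_pv_head[OF ek[OF k]] ek[OF k] by (auto simp: head_split intro!: cod.alg.null_eq_mult)
        finally show ?thesis .
      qed
      then have "cod.alg.null_eq (\<Sum>l\<in>{1..m (head G e)}. pe (e, k) * poly_star (pe (e, l)))
          (\<Sum>l\<in>{1..m (head G e)}. if k = l then pe (e, k) * poly_star (pe (e, k)) else 0)"
        by (rule cod.alg.null_eq_sum)
      from cod.alg.null_eq_sym[OF this] show "cod.alg.null_eq (pe (e, k) * poly_star (pe (e, k)))
          (\<Sum>l\<in>{1..m (head G e)}. pe (e, k) * poly_star (pe (e, l)))"
        using k by simp
    qed
    finally show "cod.alg.null_eq (\<sigma> (GVert v))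
        (\<Sum>e\<in>out_arcs G v. \<sigma> (GArc e) * poly_star (\<sigma> (GArc e)))"
      by (simp add: \<sigma>_def sum_product free.st_sum)
  next
    fix v assume "v \<in> verts G"
    then show "\<sigma> (GVert v) \<in> cod.alg.F"
      unfolding \<sigma>_def graph_gen.case by (intro free.sum_closed pv)
  next
    fix e assume "e \<in> arcs G"
    then show "\<sigma> (GArc e) \<in> cod.alg.F"
      unfolding \<sigma>_def graph_gen.case by (intro free.sum_closed pe)
  qed (rule that)
  have "csum (graph_cstar GO) (SV GO) (Pair v ` {1..m v}) = cod.alg.cls (\<sigma> (GVert v))"
    if v: "v \<in> verts G" for v
  proof -
    have "csum cod.alg.C (SV GO) (Pair v ` {1..m v}) = cod.alg.cls (sum pv (Pair v ` {1..m v}))"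
      using pv[OF v] by (intro cod.alg.csum_cong_cls) (auto simp: cod.SV_eq)
    then show ?thesis
      by (simp add: cod.graph_cstar_eq \<sigma>_def sum.reindex inj_on_def)
  qed
  moreover have "csum (graph_cstar GO) (SE GO) (Pair e ` {1..m (head G e)}) =
      cod.alg.cls (\<sigma> (GArc e))" if e: "e \<in> arcs G" for e
  proof -
    have "csum cod.alg.C (SE GO) (Pair e ` {1..m (head G e)}) =
        cod.alg.cls (sum pe (Pair e ` {1..m (head G e)}))"
      using pe[OF e] by (intro cod.alg.csum_cong_cls) (auto simp: cod.SE_eq)
    then show ?thesis
      by (simp add: cod.graph_cstar_eq \<sigma>_def sum.reindex inj_on_def)
  qed
  ultimately have "is_pullback GO G multi_out_split_hom h"
    using h by (simp add: is_pullback_def vert_fiber arc_fiber)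
  then show ?thesis by blast
qed

end

section \<open>Balanced in-splits\<close>

locale in_splitting = wf_digraph E for E :: "('v, 'e) pre_digraph" +
  fixes w :: 'v and n :: nat and P :: "nat \<Rightarrow> 'e set"
  assumes partition: "in_partition E w n P"
begin

abbreviation "EI \<equiv> in_split E w n P"

text \<open>Meaningful for arcs with head \<open>w\<close>; any other arc lies in no set of the
  partition.\<close>

definition idx :: "'e \<Rightarrow> nat" where
  "idx e = (THE j. j \<in> {1..n} \<and> e \<in> P j)"

lemma verts_EI: "(v, i) \<in> verts EI \<longleftrightarrow> v \<in> verts E \<and> v \<noteq> w \<and> i = 1 \<or> v = w \<and> i \<in> {1..n}"
  and arcs_EI: "(e, i) \<in> arcs EI \<longleftrightarrow> e \<in> arcs E \<and> (if tail E e = w then i \<in> {1..n} else i = 1)"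
  and tail_EI: "tail EI (e, i) = (tail E e, i)"
  and head_EI: "head EI (e, i) = (if head E e \<noteq> w then (head E e, 1) else (w, idx e))"
  by (auto simp: in_split_def idx_def)

lemma idx_eq: assumes "j \<in> {1..n}" "e \<in> P j" shows "idx e = j"
  unfolding idx_def
proof (rule the_equality)
  fix k assume "k \<in> {1..n} \<and> e \<in> P k"
  then show "k = j"
    using partition assms unfolding in_partition_def disjoint_family_on_def by blast
qed (use assms in simp)

lemma idx: assumes "e \<in> arcs E" "head E e = w" shows "idx e \<in> {1..n}" "e \<in> P (idx e)"
proof -
  have "e \<in> in_arcs E w" using assms by simp
  then obtain j where "j \<in> {1..n}" "e \<in> P j"
    using partition unfolding in_partition_def by blast
  then show "idx e \<in> {1..n}" "e \<in> P (idx e)" using idx_eq by auto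
qed

lemma wf_digraph_EI: "wf_digraph EI"
proof
  fix x assume "x \<in> arcs EI"
  then show "tail EI x \<in> verts EI" "head EI x \<in> verts EI"
    by (cases x, auto simp: arcs_EI verts_EI tail_EI head_EI dest: idx split: if_splits)+
qed

lemma out_arcs_EI:
  "(v, i) \<in> verts EI \<Longrightarrow> out_arcs EI (v, i) = (\<lambda>e. (e, i)) ` out_arcs E v"
  by (auto simp: arcs_EI verts_EI tail_EI split: if_splits)

lemma reg_EI: "(v, i) \<in> verts EI \<Longrightarrow> v \<in> reg E \<Longrightarrow> (v, i) \<in> reg EI"
  by (simp add: reg_def out_arcs_EI)

end

lemma (in graph_algebra) path_poly_arc:
  assumes "e \<in> arcs G" shows "path_poly (tail G e, [e]) \<approx> pe e"
  using pv_tail_pe[OF assms] by (simp add: path_poly_def)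

lemma (in graph_algebra) path_poly_arc_arc:
  assumes "e \<in> arcs G" "f \<in> arcs G" shows "path_poly (tail G e, [e, f]) \<approx> pe e * pe f"
  using alg.null_eq_mult[OF pv_tail_pe alg.null_eq_refl, of e "pe f"] assms
  by (simp add: path_poly_def mult.assoc)

section \<open>The complete split of the copies of \<open>w\<close>\<close>

locale balanced_in_split =
  l: in_splitting E w n L + r: in_splitting E w n R
  for E :: "('v, 'e) pre_digraph" and w n L R +
  assumes w_reg: "w \<in> reg E"
    and no_loop: "e \<in> arcs E \<Longrightarrow> tail E e = w \<Longrightarrow> head E e \<noteq> w"
begin

declare One_nat_def [simp del]

abbreviation "EL \<equiv> in_split E w n L"
abbreviation "ER \<equiv> in_split E w n R"

definition "N = card (out_arcs E w)"

text \<open>One enumeration serves all copies of \<open>w\<close>: the number \<open>k\<close> of a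
  split vertex over \<open>(w, i)\<close> names the arc \<open>f k\<close> whatever \<open>i\<close>
  is. Exchanging the copy of \<open>w\<close> thus keeps the arc.\<close>

definition "f = (SOME h. bij_betw h {1..N} (out_arcs E w))"

lemma f: "bij_betw f {1..N} (out_arcs E w)"
  unfolding f_def N_def
  using w_reg by (intro someI_ex[of "\<lambda>h. bij_betw h _ _"] ex_bij_betw_nat_finite_1) (simp add: reg_def)

lemma f_arc: "k \<in> {1..N} \<Longrightarrow> f k \<in> arcs E \<and> tail E (f k) = w \<and> head E (f k) \<noteq> w"
  using f no_loop by (auto dest!: bij_betwE bspec)

lemma f_inj: "k \<in> {1..N} \<Longrightarrow> l \<in> {1..N} \<Longrightarrow> f k = f l \<longleftrightarrow> k = l"
  using f by (auto simp: bij_betw_def inj_on_eq_iff)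

lemma f_cases: assumes "e \<in> arcs E" "tail E e = w" obtains k where "k \<in> {1..N}" "e = f k"
proof -
  have "e \<in> f ` {1..N}" using assms f by (simp add: bij_betw_def)
  then show thesis using that by blast
qed

lemma N_pos: "1 \<le> N"
  using w_reg by (simp add: N_def reg_def Suc_le_eq card_gt_0_iff One_nat_def)

text \<open>Each copy of \<open>w\<close> is split completely; no other vertex is split.\<close>

definition m :: "'v \<times> nat \<Rightarrow> nat" where
  "m x = (if fst x = w then N else 1)"

lemma m_simps [simp]: "m (w, i) = N" "v \<noteq> w \<Longrightarrow> m (v, i) = 1"
  by (simp_all add: m_def)

definition P :: "'v \<times> nat \<Rightarrow> nat \<Rightarrow> ('e \<times> nat) set" where
  "P x k = (if fst x = w then {(f k, snd x)} else out_arcs EL x)"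

lemma multi_out_partition_EL: "multi_out_partition EL m P"
  unfolding multi_out_partition_def
proof
  fix x assume x: "x \<in> verts EL"
  obtain v i where vi: "x = (v, i)" by (cases x)
  show "if out_arcs EL x = {} then m x = 1
    else 1 \<le> m x \<and> (\<Union>i\<in>{1..m x}. P x i) = out_arcs EL x \<and> disjoint_family_on (P x) {1..m x} \<and>
      (\<forall>i\<in>{1..m x}. P x i \<noteq> {}) \<and>
      (\<forall>i\<in>{1..m x}. \<forall>j\<in>{1..m x}. infinite (P x i) \<and> infinite (P x j) \<longrightarrow> i = j)"
  proof (cases "v = w")
    case True
    have "out_arcs EL x = (\<lambda>e. (e, i)) ` f ` {1..N}"
      using l.out_arcs_EI[of v i] x vi True f by (simp add: bij_betw_def)
    moreover have "disjoint_family_on (P x) {1..m x}"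
      using True vi f_inj by (auto simp: disjoint_family_on_def P_def m_def)
    ultimately show ?thesis
      using N_pos True vi by (auto simp: P_def m_def)
  next
    case False
    then show ?thesis using vi by (auto simp: P_def m_def disjoint_family_on_def)
  qed
qed

sublocale EL: wf_digraph EL by (rule l.wf_digraph_EI)

sublocale ER: graph_algebra ER
  unfolding graph_algebra_def by (rule r.wf_digraph_EI)

sublocale hat: multi_out_splitting EL m P
  by unfold_locales (rule multi_out_partition_EL)

abbreviation "EH \<equiv> multi_out_split EL m P"

sublocale EH: graph_algebra EH
  unfolding graph_algebra_def by (rule hat.wf_digraph_split)

lemma verts_EH: "((v, i), k) \<in> verts EH \<longleftrightarrow>
    v \<in> verts E \<and> v \<noteq> w \<and> i = 1 \<and> k = 1 \<or> v = w \<and> i \<in> {1..n} \<and> k \<in> {1..N}"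
  by (auto simp: hat.verts_split l.verts_EI m_def)

lemma arcs_EH: "((e, i), k) \<in> arcs EH \<longleftrightarrow> e \<in> arcs E \<and> (if tail E e = w then i \<in> {1..n} else i = 1) \<and>
    (if head E e = w then k \<in> {1..N} else k = 1)"
  by (auto simp: hat.arcs_split l.arcs_EI m_def l.head_EI)

lemma head_EH: "head EH ((e, i), k) = (if head E e \<noteq> w then (head E e, 1) else (w, l.idx e), k)"
  by (simp add: hat.head_split l.head_EI)

lemma tail_EH_w:
  assumes "i \<in> {1..n}" "k \<in> {1..N}" shows "tail EH ((f k, i), l) = ((w, i), k)"
  using hat.tail_split_eq[of "(f k, i)" k l] assms f_arc[OF assms(2)]
  by (simp add: l.arcs_EI l.tail_EI m_def P_def)

lemma tail_EH:
  assumes "e \<in> arcs E" "tail E e \<noteq> w" shows "tail EH ((e, 1), k) = ((tail E e, 1), 1)"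
  using hat.tail_split_eq[of "(e, 1)" 1 k] assms
  by (simp add: l.arcs_EI l.tail_EI m_def P_def)

text \<open>The cases are disjoint as no arc goes from \<open>w\<close> to \<open>w\<close>. Only
  arcs into \<open>w\<close> have more than one number to choose from, and the number tells which
  \<open>f k\<close> is to follow.\<close>

lemma arcs_EH_cases [consumes 1, case_names from_w to_w other]:
  assumes "x \<in> arcs EH"
  obtains k i where "x = ((f k, i), 1)" "k \<in> {1..N}" "i \<in> {1..n}"
      "tail EH x = ((w, i), k)" "head EH x = ((head E (f k), 1), 1)" "head E (f k) \<noteq> w"
  | e k where "x = ((e, 1), k)" "e \<in> arcs E" "tail E e \<noteq> w" "head E e = w" "k \<in> {1..N}"
      "tail EH x = ((tail E e, 1), 1)" "head EH x = ((w, l.idx e), k)"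
  | e where "x = ((e, 1), 1)" "e \<in> arcs E" "tail E e \<noteq> w" "head E e \<noteq> w"
      "tail EH x = ((tail E e, 1), 1)" "head EH x = ((head E e, 1), 1)"
proof -
  obtain e i k where x: "x = ((e, i), k)" by (metis surj_pair)
  show thesis
  proof (cases "tail E e = w")
    case True
    then obtain k' where k': "k' \<in> {1..N}" "e = f k'"
      using assms x by (auto simp: arcs_EH elim: f_cases)
    then show ?thesis
      using that(1)[of k' i] assms x True f_arc[of k'] by (simp add: arcs_EH head_EH tail_EH_w)
  next
    case False
    then show ?thesis
      using that(2)[of e k] that(3)[of e] assms x
      by (cases "head E e = w") (auto simp: arcs_EH head_EH tail_EH)
  qed
qed

section \<open>The path map and the multiplicativity of \<xi>\<close>

text \<open>
  On vertices and arcs, \<open>\<xi> v = S\<^bsub>base v\<^esub> S\<^bsub>base v\<^esub>\<^sup>*\<close> and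
  \<open>\<xi> e = S\<^bsub>base (s e)\<^esub> S\<^bsub>ext e\<^esub> S\<^bsub>base (t e)\<^esub>\<^sup>*\<close>. Hence \<open>\<xi>\<close> is given by
  the prefix-preserving and prefix-reflecting path map \<open>path_map\<close>.
\<close>

fun base :: "('v \<times> nat) \<times> nat \<Rightarrow> ('e \<times> nat) list" where
  "base ((v, i), k) = (if v = w then [(f k, i)] else [])"

text \<open>An arc leaving a copy of \<open>w\<close> contributes nothing, since it has been read in
  advance: by \<open>base\<close> if the path starts there, otherwise together with the arc that
  leads into \<open>w\<close>. In the latter case the copy of \<open>f k\<close> is the one dictated
  by the partition \<open>R\<close>.\<close>

fun ext :: "('e \<times> nat) \<times> nat \<Rightarrow> ('e \<times> nat) list" where
  "ext ((e, i), k) = (if tail E e = w then [] else if head E e = w then [(e, i), (f k, r.idx e)]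
     else [(e, i)])"

fun base_target :: "('v \<times> nat) \<times> nat \<Rightarrow> 'v \<times> nat" where
  "base_target ((v, i), k) = (if v = w then (head E (f k), 1) else (v, i))"

definition path_map :: "(('v \<times> nat) \<times> nat, ('e \<times> nat) \<times> nat) path \<Rightarrow> ('v \<times> nat, 'e \<times> nat) path" where
  "path_map \<alpha> = (fst (fst \<alpha>), base (fst \<alpha>) @ concat (map ext (snd \<alpha>)))"

definition \<xi> :: "(('v \<times> nat) \<times> nat, ('e \<times> nat) \<times> nat) gis \<Rightarrow> ('v \<times> nat, 'e \<times> nat) gis" where
  "\<xi> = map_option (map_prod path_map path_map)"

lemma \<xi>_simps [simp]: "\<xi> None = None" "\<xi> (Some (\<alpha>, \<beta>)) = Some (path_map \<alpha>, path_map \<beta>)"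
  by (simp_all add: \<xi>_def)

lemma base_awalk: assumes "x \<in> verts EH" shows "ER.awalk (fst x) (base x) (base_target x)"
proof -
  obtain v i k where x: "x = ((v, i), k)" by (metis surj_pair)
  show ?thesis
    using assms f_arc[of k] unfolding x
    by (cases "v = w") (simp_all add: verts_EH ER.awalk_simps r.verts_EI r.arcs_EI r.tail_EI r.head_EI)
qed

text \<open>The pieces join at \<open>base_target\<close>, beyond the arc read in advance. For an
  arc into \<open>w\<close> the source graph moves to copy \<open>l.idx e\<close> of
  \<open>w\<close> and the image passes through copy \<open>r.idx e\<close>, but the arcs
  \<open>f k\<close> out of both end at the same vertex.\<close>

lemma ext_awalk:
  assumes "x \<in> arcs EH" shows "ER.awalk (base_target (tail EH x)) (ext x) (base_target (head EH x))"
  using assms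
proof (cases rule: arcs_EH_cases)
  case (from_w k i)
  then show ?thesis
    using f_arc[of k] by (simp add: ER.awalk_simps r.verts_EI)
next
  case (to_w e k)
  then show ?thesis
    using f_arc[of k] r.idx[of e] by (simp add: ER.awalk_simps r.arcs_EI r.tail_EI r.head_EI r.verts_EI)
next
  case (other e)
  then show ?thesis
    by (simp add: ER.awalk_simps r.arcs_EI r.tail_EI r.head_EI r.verts_EI)
qed

lemma path_map_awalk:
  assumes "EH.awalk x p y"
  shows "ER.awalk (fst x) (snd (path_map (x, p))) (base_target y)"
proof -
  have "ER.awalk (base_target x) (concat (map ext p)) (base_target y)"
    using assms
  proof (induction p arbitrary: x)
    case Nil
    then show ?case using base_awalk[of x] by (auto simp: EH.awalk_Nil_iff ER.awalk_Nil_iff)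
  next
    case (Cons e p)
    then have e: "e \<in> arcs EH" "x = tail EH e" "EH.awalk (head EH e) p y"
      by (auto simp: EH.awalk_Cons_iff)
    show ?case
      using ER.awalk_appendI[OF ext_awalk[OF e(1)] Cons.IH[OF e(3)]] e(2) by simp
  qed
  moreover have "x \<in> verts EH" using assms by (rule EH.awalk_hd_in_verts)
  ultimately show ?thesis
    using ER.awalk_appendI[OF base_awalk] by (simp add: path_map_def)
qed

text \<open>A copy of \<open>w\<close> emits one arc only. Elsewhere the first letter of the image
  determines \<open>e\<close> and, if \<open>e\<close> enters \<open>w\<close>, the second letter
  determines its number; hence arbitrary continuations do no harm.\<close>

lemma ext_prefix_inj:
  assumes "a \<in> arcs EH" "b \<in> arcs EH" "tail EH a = tail EH b" and pre: "prefix (ext a @ s) (ext b @ t)"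
  shows "a = b"
  using assms(1)
proof (cases rule: arcs_EH_cases)
  case a: (from_w k i)
  from assms(2) show ?thesis
    using assms(3) a by (cases rule: arcs_EH_cases) auto
next
  case a: (to_w e k)
  from assms(2) show ?thesis
  proof (cases rule: arcs_EH_cases)
    case (from_w k' i)
    then show ?thesis using assms(3) a by auto
  next
    case (to_w e' k')
    then show ?thesis using pre a f_inj[of k k'] by auto
  next
    case (other e')
    then show ?thesis using pre a by auto
  qed
next
  case a: (other e)
  from assms(2) show ?thesis
    using assms(3) a pre by (cases rule: arcs_EH_cases) auto
qed

text \<open>Comparability, not the order, is reflected: arcs leaving \<open>w\<close> have empty
  image, so an arc into \<open>w\<close> and its continuation by one more arc have the same
  image.\<close>

lemma ext_reflects_prefix:
  assumes "EH.awalk x p y" "EH.awalk x q z" "prefix (concat (map ext p)) (concat (map ext q))"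
  shows "prefix p q \<or> prefix q p"
  using assms
proof (induction p arbitrary: x q)
  case (Cons a p)
  show ?case
  proof (cases q)
    case q: (Cons b q')
    have "a = b"
      using Cons.prems q by (intro ext_prefix_inj[of a b]) (auto simp: EH.awalk_Cons_iff)
    then show ?thesis
      using Cons.IH[of "head EH a" q'] Cons.prems q by (auto simp: EH.awalk_Cons_iff)
  qed simp
qed simp

lemma path_map_reflects:
  assumes p: "EH.awalk x p y" and q: "EH.awalk x' q z"
    and ext: "path_ext (path_map (x, p)) (path_map (x', q))"
  shows "path_ext (x, p) (x', q) \<or> path_ext (x', q) (x, p)"
proof -
  obtain v i k where x: "x = ((v, i), k)" by (metis surj_pair)
  obtain v' i' k' where x': "x' = ((v', i'), k')" by (metis surj_pair)
  have verts: "x \<in> verts EH" "x' \<in> verts EH" using p q EH.awalk_hd_in_verts by auto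
  have vi: "v = v'" "i = i'" using ext by (simp_all add: path_ext_def path_map_def x x')
  have x'': "x' = ((v, i), k')" using x' vi by simp
  \<comment> \<open>The image shows the number of a vertex over \<open>w\<close> in its first arc;
    any other vertex has only the copy 1.\<close>
  have "k = k'"
  proof (cases "v = w")
    case True
    then have "k \<in> {1..N}" "k' \<in> {1..N}" using verts by (simp_all add: x x'' verts_EH)
    moreover have "f k = f k'"
      using ext True by (simp add: path_ext_def path_map_def x x'')
    ultimately show ?thesis using f_inj by simp
  next
    case False
    then show ?thesis using verts by (simp add: x x'' verts_EH)
  qed
  with vi have "x = x'" by (simp add: x x')
  then show ?thesis
    using ext ext_reflects_prefix[OF p] q by (auto simp: path_ext_def path_map_def)
qed

lemma path_map_ext: "path_ext \<beta> \<gamma> \<Longrightarrow> path_ext (path_map \<beta>) (path_map \<gamma>)"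
  by (auto simp: path_ext_def path_map_def prefix_def)

lemma path_map_app:
  "path_ext \<beta> \<gamma> \<Longrightarrow> path_map (path_app \<alpha> \<beta> \<gamma>) = path_app (path_map \<alpha>) (path_map \<beta>) (path_map \<gamma>)"
  by (auto simp: path_ext_def path_app_def path_map_def prefix_def)

lemma \<xi>_mult:
  assumes "s \<in> gis_carrier EH" "t \<in> gis_carrier EH"
  shows "\<xi> (gis_mult s t) = gis_mult (\<xi> s) (\<xi> t)"
proof (cases "s = None \<or> t = None")
  case False
  obtain a p b q x where s: "s = Some ((a, p), (b, q))" "EH.awalk b q x"
    by (rule EH.gis_carrierE[OF assms(1)]) (use False in auto)
  obtain c p' d q' y where t: "t = Some ((c, p'), (d, q'))" "EH.awalk c p' y"
    by (rule EH.gis_carrierE[OF assms(2)]) (use False in auto)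
  let ?\<beta> = "(b, q)" and ?\<gamma> = "(c, p')"
  \<comment> \<open>Images may extend each other both ways although the paths do not, so
    \<open>gis_mult\<close> may take its first branch on the images and its second on the originals.
    Mutual extension means equality, and both branches then give the same value.\<close>
  have antisym: "path_app \<alpha> \<beta>' \<gamma>' = \<alpha>" if "path_ext \<beta>' \<gamma>'" "path_ext \<gamma>' \<beta>'"
    for \<alpha> \<beta>' \<gamma>' :: "('v \<times> nat, 'e \<times> nat) path"
    using that prefix_order.antisym[of "snd \<beta>'" "snd \<gamma>'"] by (auto simp: path_ext_def path_app_def)
  consider "path_ext ?\<beta> ?\<gamma>" | "\<not> path_ext ?\<beta> ?\<gamma>" "path_ext ?\<gamma> ?\<beta>"
    | "\<not> path_ext ?\<beta> ?\<gamma>" "\<not> path_ext ?\<gamma> ?\<beta>" by blast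
  then show ?thesis
  proof cases
    case 1
    then show ?thesis by (simp add: s(1) t(1) path_map_ext path_map_app)
  next
    case 2
    then show ?thesis
      using antisym[of "path_map ?\<beta>" "path_map ?\<gamma>"] antisym[of "path_map ?\<gamma>" "path_map ?\<beta>"]
      by (simp add: s(1) t(1) path_map_ext path_map_app)
  next
    case 3
    then show ?thesis
      using path_map_reflects[OF s(2) t(2)] path_map_reflects[OF t(2) s(2)]
      by (auto simp: s(1) t(1))
  qed
qed auto

lemma \<xi>_carrier: "s \<in> gis_carrier EH \<Longrightarrow> \<xi> s \<in> gis_carrier ER"
proof (erule EH.gis_carrierE)
  fix u p v q x assume s: "s = Some ((u, p), (v, q))" "EH.awalk u p x" "EH.awalk v q x"
  have "ER.awalk (fst u) (snd (path_map (u, p))) (base_target x)"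
    "ER.awalk (fst v) (snd (path_map (v, q))) (base_target x)"
    using s path_map_awalk by blast+
  then have "Some ((fst u, snd (path_map (u, p))), (fst v, snd (path_map (v, q)))) \<in> gis_carrier ER"
    using ER.gis_carrier_iff by blast
  then show "\<xi> s \<in> gis_carrier ER"
    by (simp add: s(1) path_map_def)
qed (simp add: gis_carrier_def)

lemma ext_path_hom_\<xi>: "ext_path_hom EH ER \<xi>"
  by (auto simp: ext_path_hom_def \<xi>_mult \<xi>_carrier)

lemma \<xi>_inv: "\<xi> (gis_inv s) = gis_inv (\<xi> s)"
  by (cases s rule: gis_inv.cases) auto

section \<open>Images of vertices and arcs; regularity of \<xi>\<close>

lemma path_map_vpath: "path_map (vpath u) = (fst u, base u)"
  by (simp add: path_map_def vpath_def)

lemma path_map_epath_w: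
  "k \<in> {1..N} \<Longrightarrow> i \<in> {1..n} \<Longrightarrow> path_map (epath EH ((f k, i), l)) = ((w, i), [(f k, i)])"
  using f_arc[of k] by (simp add: path_map_def epath_def tail_EH_w)

lemma path_map_epath:
  "e \<in> arcs E \<Longrightarrow> tail E e \<noteq> w \<Longrightarrow> path_map (epath EH ((e, 1), k)) =
    ((tail E e, 1), if head E e = w then [(e, 1), (f k, r.idx e)] else [(e, 1)])"
  by (simp add: path_map_def epath_def tail_EH)

text \<open>The product of \<open>t\<close> with its inverse is \<open>(\<alpha>, \<alpha>)\<close>,
  and its product with \<open>(\<beta>, \<beta>)\<close> is the idempotent of the longer path;
  \<open>t\<close> is equal to it.\<close>

lemma gis_le_idempotentD:
  assumes "gis_le t (Some (\<beta>, \<beta>))" "t \<noteq> None"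
  obtains \<alpha> where "t = Some (\<alpha>, \<alpha>)" "path_ext \<beta> \<alpha>"
proof -
  obtain \<alpha> \<delta> where t: "t = Some (\<alpha>, \<delta>)" using assms(2) by (metis option.exhaust surj_pair)
  have "path_ext \<delta> \<delta>" "path_app \<alpha> \<delta> \<delta> = \<alpha>" by (simp_all add: path_ext_def path_app_def)
  moreover have app: "path_app \<alpha> \<alpha> \<beta> = \<beta>" if "path_ext \<alpha> \<beta>" for \<alpha> \<beta> :: "('x, 'y) path"
    using that by (cases \<alpha>; cases \<beta>) (auto simp: path_ext_def path_app_def prefix_def)
  moreover have "path_ext \<beta> \<beta>" by (simp add: path_ext_def)
  ultimately show thesis
    using assms(1) that[of \<alpha>] app[of \<alpha> \<beta>] app[of \<beta> \<alpha>]
    by (auto simp: gis_le_def t split: if_splits)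
qed

lemma out_arcs_EH_w:
  assumes "i \<in> {1..n}" "k \<in> {1..N}" shows "out_arcs EH ((w, i), k) = {((f k, i), 1 :: nat)}"
proof (intro equalityI subsetI)
  fix x assume "x \<in> out_arcs EH ((w, i), k)"
  then have "x \<in> arcs EH" "tail EH x = ((w, i), k)" by auto
  then show "x \<in> {((f k, i), 1 :: nat)}"
    by (cases rule: arcs_EH_cases) auto
next
  fix x assume "x \<in> {((f k, i), 1 :: nat)}"
  then show "x \<in> out_arcs EH ((w, i), k)"
    using assms f_arc[OF assms(2)] by (simp add: arcs_EH tail_EH_w)
qed

text \<open>Idempotents of comparable paths have nonzero product. So an arc leaving \<open>u\<close>
  is sought whose image is comparable with the given path \<open>\<alpha>\<close>, and the first two
  arcs of \<open>\<alpha>\<close> tell which one.\<close>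

lemma regular_\<xi>: "regular_ext_path_hom EH ER \<xi>"
  unfolding regular_ext_path_hom_def
proof (intro conjI ballI impI ext_path_hom_\<xi>)
  fix u t assume u: "u \<in> reg EH" and t: "t \<in> gis_carrier ER"
    "t \<noteq> None \<and> gis_le t (\<xi> (Some (vpath u, vpath u)))"
  obtain v i k where vik: "u = ((v, i), k)" by (metis surj_pair)
  have uv: "u \<in> verts EH" "out_arcs EH u \<noteq> {}" using u by (auto simp: reg_def)
  obtain \<alpha> where \<alpha>: "t = Some (\<alpha>, \<alpha>)" "path_ext (path_map (vpath u)) \<alpha>"
    using t by (auto elim: gis_le_idempotentD)
  obtain z where \<alpha>_walk: "ER.awalk (fst \<alpha>) (snd \<alpha>) z"
    using t(1) \<alpha>(1) ER.gis_carrier_iff[of "fst \<alpha>" "snd \<alpha>" "fst \<alpha>" "snd \<alpha>"] by auto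
  have fst_\<alpha>: "fst \<alpha> = (v, i)" using \<alpha>(2) vik by (simp add: path_ext_def path_map_vpath)
  have "\<exists>e\<in>out_arcs EH u. path_ext (path_map (epath EH e)) \<alpha> \<or> path_ext \<alpha> (path_map (epath EH e))"
  proof (cases "v = w")
    case True
    then have "i \<in> {1..n}" "k \<in> {1..N}" using uv vik by (auto simp: verts_EH)
    then show ?thesis
      using \<alpha>(2) vik True by (simp add: out_arcs_EH_w path_map_epath_w path_map_vpath)
  next
    case False
    then have ik: "i = 1" "k = 1" "v \<in> verts E" using uv vik by (auto simp: verts_EH)
    show ?thesis
    proof (cases "snd \<alpha>")
      case Nil
      obtain x where x: "x \<in> out_arcs EH u" using uv by blast
      then have "x \<in> arcs EH" "tail EH x = u" by auto
      then have "path_ext \<alpha> (path_map (epath EH x))"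
        using Nil fst_\<alpha> vik by (simp add: path_ext_def path_map_def epath_def)
      then show ?thesis using x by blast
    next
      case (Cons a p)
      obtain e j where ej: "a = (e, j)" by (cases a)
      have "ER.awalk (v, 1) ((e, j) # p) z"
        using \<alpha>_walk by (simp only: fst_\<alpha> Cons ej ik)
      then have *: "(e, j) \<in> arcs ER" "(v, 1) = tail ER (e, j)" "ER.awalk (head ER (e, j)) p z"
        by (simp_all only: ER.awalk_Cons_iff)
      have e: "e \<in> arcs E" "tail E e = v" "j = 1"
        using *(1,2) by (simp_all add: r.arcs_EI r.tail_EI)
      have p: "ER.awalk (head ER (e, 1)) p z"
        using *(3) e(3) by simp
      have arc: "((e, 1), l) \<in> out_arcs EH u" if "if head E e = w then l \<in> {1..N} else l = 1" for l
        using e that False ik vik tail_EH[of e l] by (auto simp: arcs_EH)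
      \<comment> \<open>If \<open>e\<close> enters \<open>w\<close>, the second arc of
        \<open>\<alpha>\<close> selects the number of the copy. If \<open>\<alpha>\<close> ends
        after \<open>e\<close>, every copy is comparable, and copy 1 exists because \<open>w\<close>
        emits an arc.\<close>
      consider "head E e \<noteq> w" | "head E e = w" "p = []" | b p' where "head E e = w" "p = b # p'"
        by (cases p) auto
      then show ?thesis
      proof cases
        case 1
        then have "path_ext (path_map (epath EH ((e, 1), 1))) \<alpha>"
          using e False Cons ej fst_\<alpha> ik by (simp add: path_map_epath path_ext_def)
        then show ?thesis using arc[of 1] 1 by auto
      next
        case 2
        then have "path_ext \<alpha> (path_map (epath EH ((e, 1), 1)))"
          using e False Cons ej fst_\<alpha> ik by (simp add: path_map_epath path_ext_def)
        then show ?thesis using arc[of 1] 2 N_pos by auto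
      next
        case (3 b p')
        obtain g j' where gj: "b = (g, j')" by (cases b)
        have g: "g \<in> arcs E" "tail E g = w" "j' = r.idx e"
          using p 3 gj by (auto simp: ER.awalk_Cons_iff r.arcs_EI r.tail_EI r.head_EI)
        then obtain l where l: "l \<in> {1..N}" "g = f l" by (auto elim: f_cases)
        then have "path_ext (path_map (epath EH ((e, 1), l))) \<alpha>"
          using e False Cons ej fst_\<alpha> ik 3 gj g by (simp add: path_map_epath path_ext_def)
        then show ?thesis using arc[of l] 3 l by auto
      qed
    qed
  qed
  moreover have "gis_mult t (\<xi> (Some (\<beta>, \<beta>))) \<noteq> None"
    if "path_ext (path_map \<beta>) \<alpha> \<or> path_ext \<alpha> (path_map \<beta>)" for \<beta>
    using that by (cases "path_ext \<alpha> (path_map \<beta>)") (simp_all add: \<alpha>(1))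
  ultimately show "\<exists>e\<in>out_arcs EH u. gis_mult t (\<xi> (Some (epath EH e, epath EH e))) \<noteq> None"
    by blast
qed

section \<open>Images of the generators and the relations of the split graph in C*(E_R)\<close>

lemma vert_poly:
  assumes "x \<in> verts ER" "fst x \<noteq> w"
  shows "ER.alg.null_eq (ER.gis_poly (\<xi> (Some (vpath (x, k), vpath (x, k))))) (pv x)"
proof -
  have "base (x, k) = []" using assms(2) by (cases x) simp
  then have "ER.gis_poly (\<xi> (Some (vpath (x, k), vpath (x, k)))) = pv x * poly_star (pv x)"
    by (simp add: path_map_vpath ER.path_poly_def)
  also have "ER.alg.null_eq \<dots> (pv x * pv x)"
    using assms(1) by (intro ER.alg.null_eq_mult ER.star_pv ER.alg.null_eq_refl) simp_all
  also have "ER.alg.null_eq \<dots> (pv x)"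
    using ER.pv_pv[OF assms(1) assms(1)] by simp
  finally show ?thesis .
qed

lemma sum_f: "(\<Sum>k\<in>{1..N}. g (f k)) = (\<Sum>e\<in>out_arcs E w. g e)"
  by (rule sum.reindex_bij_betw[OF f])

lemma pv_w:
  assumes i: "i \<in> {1..n}"
  shows "ER.alg.null_eq (pv (w, i)) (\<Sum>k\<in>{1..N}. pe (f k, i) * poly_star (pe (f k, i)))"
proof -
  have v: "(w, i) \<in> verts ER" using i by (simp add: r.verts_EI)
  have eq: "(\<Sum>x\<in>out_arcs ER (w, i). pe x * poly_star (pe x)) =
      (\<Sum>k\<in>{1..N}. pe (f k, i) * poly_star (pe (f k, i)))"
    unfolding r.out_arcs_EI[OF v] sum_f[of "\<lambda>e. pe (e, i) * poly_star (pe (e, i))"]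
    by (simp add: sum.reindex inj_on_def)
  show ?thesis
    using ER.reg_sum[OF r.reg_EI[OF v w_reg]] unfolding eq .
qed

lemma arc_arc_poly:
  assumes e: "e \<in> arcs E" "tail E e \<noteq> w" "head E e = w" and k: "k \<in> {1..N}"
  shows "ER.alg.null_eq (ER.path_poly (path_map (epath EH ((e, 1), k)))) (pe (e, 1) * pe (f k, r.idx e))"
proof -
  have "(e, 1) \<in> arcs ER" "(f k, r.idx e) \<in> arcs ER"
    using e f_arc[OF k] r.idx[of e] by (simp_all add: r.arcs_EI)
  from ER.path_poly_arc_arc[OF this] show ?thesis
    using e by (simp add: path_map_epath r.tail_EI)
qed

text \<open>A split vertex over \<open>w\<close> and its only arc have the same image. At other
  vertices the relation of E_R at \<open>v\<close> applies, and each summand whose arc enters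
  \<open>w\<close> is refined by the relation at the copy of \<open>w\<close> where it ends.\<close>

lemma reg_sum_\<xi>:
  assumes u: "u \<in> reg EH"
  shows "ER.alg.null_eq (ER.gis_poly (\<xi> (Some (vpath u, vpath u))))
    (\<Sum>x\<in>out_arcs EH u. ER.gis_poly (\<xi> (Some (epath EH x, epath EH x))))"
proof -
  obtain v i k where vik: "u = ((v, i), k)" by (metis surj_pair)
  have uv: "u \<in> verts EH" "out_arcs EH u \<noteq> {}" "finite (out_arcs EH u)" using u by (auto simp: reg_def)
  show ?thesis
  proof (cases "v = w")
    case True
    then have ik: "i \<in> {1..n}" "k \<in> {1..N}" using uv vik by (auto simp: verts_EH)
    have "Some (vpath u, vpath u) \<in> gis_carrier EH"
      using uv(1) by (simp add: vpath_def EH.gis_carrier_iff EH.awalk_Nil_iff)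
    from ER.gis_poly_closed[OF \<xi>_carrier[OF this]] show ?thesis
      using vik True ik by (simp add: out_arcs_EH_w path_map_epath_w path_map_vpath)
  next
    case False
    then have ik: "i = 1" "k = 1" "v \<in> verts E" using uv vik by (auto simp: verts_EH)
    have vL: "(v, 1) \<in> verts EL" and vR: "(v, 1) \<in> verts ER"
      using ik False by (simp_all add: l.verts_EI r.verts_EI)
    have fiber: "x \<in> out_arcs EH u \<longleftrightarrow> (\<exists>e\<in>out_arcs E v. \<exists>l\<in>{1..if head E e = w then N else 1}. x = ((e, 1), l))" for x
    proof
      assume "x \<in> out_arcs EH u"
      then have "x \<in> arcs EH" "tail EH x = u" by auto
      then show "\<exists>e\<in>out_arcs E v. \<exists>l\<in>{1..if head E e = w then N else 1}. x = ((e, 1), l)"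
        using vik False by (cases rule: arcs_EH_cases) auto
    next
      assume "\<exists>e\<in>out_arcs E v. \<exists>l\<in>{1..if head E e = w then N else 1}. x = ((e, 1), l)"
      then obtain e l where x: "x = ((e, 1), l)" "e \<in> arcs E" "tail E e = v"
        "l \<in> {1..if head E e = w then N else 1}" by auto
      then show "x \<in> out_arcs EH u"
        using vik ik False tail_EH[of e l] by (cases "head E e = w") (simp_all add: arcs_EH)
    qed
    let ?I = "\<lambda>e. {1..if head E e = w then N else 1}"
    have eq: "out_arcs EH u = (\<lambda>(e, l). ((e, 1), l)) ` (SIGMA e:out_arcs E v. ?I e)"
      using fiber by (auto simp: image_iff)
    have I1: "1 \<in> ?I e" for e using N_pos by auto
    \<comment> \<open>Regularity was assumed in the split graph; it descends to \<open>E\<close>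
      because every arc has a copy with number 1.\<close>
    have "out_arcs E v \<subseteq> (\<lambda>x. fst (fst x)) ` out_arcs EH u"
    proof
      fix e assume "e \<in> out_arcs E v"
      then have "((e, 1), 1) \<in> out_arcs EH u" using fiber I1 by blast
      then show "e \<in> (\<lambda>x. fst (fst x)) ` out_arcs EH u" by force
    qed
    then have fin: "finite (out_arcs E v)" using uv(3) finite_surj by blast
    have "out_arcs E v \<noteq> {}" using uv(2) eq by auto
    then have v: "v \<in> reg E" using fin ik by (simp add: reg_def)
    have "ER.alg.null_eq (ER.gis_poly (\<xi> (Some (vpath u, vpath u)))) (pv (v, 1))"
      using vert_poly[OF vR] False vik ik by simp
    also have "ER.alg.null_eq (pv (v, 1)) (\<Sum>x\<in>out_arcs ER (v, 1). pe x * poly_star (pe x))"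
      by (rule ER.reg_sum[OF r.reg_EI[OF vR v]])
    also have "\<dots> = (\<Sum>e\<in>out_arcs E v. pe (e, 1) * poly_star (pe (e, 1)))"
      unfolding r.out_arcs_EI[OF vR] by (simp add: sum.reindex inj_on_def)
    also have "ER.alg.null_eq \<dots> (\<Sum>e\<in>out_arcs E v. \<Sum>l\<in>?I e.
        ER.gis_poly (\<xi> (Some (epath EH ((e, 1), l), epath EH ((e, 1), l)))))"
    proof (rule ER.alg.null_eq_sum)
      fix e assume "e \<in> out_arcs E v"
      then have e: "e \<in> arcs E" "tail E e = v" "tail E e \<noteq> w" using False by auto
      then have e': "(e, 1) \<in> arcs ER" by (simp add: r.arcs_EI)
      show "ER.alg.null_eq (pe (e, 1) * poly_star (pe (e, 1))) (\<Sum>l\<in>?I e.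
        ER.gis_poly (\<xi> (Some (epath EH ((e, 1), l), epath EH ((e, 1), l)))))"
      proof (cases "head E e = w")
        case True
        let ?\<kappa> = "r.idx e"
        have \<kappa>: "?\<kappa> \<in> {1..n}" using r.idx e True by blast
        have hd: "head ER (e, 1) = (w, ?\<kappa>)" using True by (simp add: r.head_EI)
        have fk: "(f k, ?\<kappa>) \<in> arcs ER" if "k \<in> {1..N}" for k
          using f_arc[OF that] \<kappa> by (simp add: r.arcs_EI)
        \<comment> \<open>Insert the target projection of \<open>e\<close> and expand it over the
          arcs \<open>f k\<close>: the terms are the range projections of the images of the copies
          of \<open>e\<close>.\<close>
        have "ER.alg.null_eq (pe (e, 1) * poly_star (pe (e, 1)))
            ((pe (e, 1) * pv (w, ?\<kappa>)) * poly_star (pe (e, 1)))"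
          using ER.pe_pv_head[OF e'] e' unfolding hd
          by (intro ER.alg.null_eq_mult[OF ER.alg.null_eq_sym ER.alg.null_eq_refl]) simp_all
        also have "ER.alg.null_eq \<dots> ((pe (e, 1) * (\<Sum>k\<in>{1..N}. pe (f k, ?\<kappa>) * poly_star (pe (f k, ?\<kappa>))))
            * poly_star (pe (e, 1)))"
          using e' by (intro ER.alg.null_eq_mult pv_w[OF \<kappa>] ER.alg.null_eq_refl free.st_closed) simp_all
        also have "\<dots> = (\<Sum>k\<in>{1..N}. (pe (e, 1) * pe (f k, ?\<kappa>)) * poly_star (pe (e, 1) * pe (f k, ?\<kappa>)))"
          by (simp add: sum_distrib_left sum_distrib_right poly_star_mult mult.assoc)
        also have "ER.alg.null_eq \<dots> (\<Sum>l\<in>{1..N}.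
            ER.gis_poly (\<xi> (Some (epath EH ((e, 1), l), epath EH ((e, 1), l)))))"
          unfolding \<xi>_simps ER.gis_poly.simps
          using ER.alg.null_eq_sym[OF arc_arc_poly[OF e(1,3) True]]
          by (intro ER.alg.null_eq_sum ER.alg.null_eq_mult ER.alg.null_eq_st) simp_all
        finally show ?thesis using True by simp
      next
        case False
        have "ER.alg.null_eq (pe (e, 1)) (ER.path_poly (path_map (epath EH ((e, 1), 1))))"
          using ER.alg.null_eq_sym[OF ER.path_poly_arc[OF e']] e False
          by (simp add: path_map_epath r.tail_EI)
        from ER.alg.null_eq_mult[OF this ER.alg.null_eq_st[OF this]] show ?thesis
          using False by simp
      qed
    qed
    also have "\<dots> = (\<Sum>x\<in>out_arcs EH u. ER.gis_poly (\<xi> (Some (epath EH x, epath EH x))))"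
      unfolding eq using fin
      by (subst sum.Sigma) (auto simp: sum.reindex inj_on_def intro!: sum.cong)
    finally show ?thesis .
  qed
qed

text \<open>Over \<open>w\<close> the summands are the range projections of all arcs leaving
  \<open>(w, i)\<close>, which add up by the relation there; elsewhere the fiber is a single
  vertex.\<close>

lemma sum_vert_\<xi>:
  assumes x: "x \<in> verts EL"
  shows "ER.alg.null_eq (\<Sum>u\<in>Pair x ` {1..m x}. ER.gis_poly (\<xi> (Some (vpath u, vpath u)))) (pv x)"
proof -
  obtain v i where vi: "x = (v, i)" by (cases x)
  have xR: "x \<in> verts ER" using x by (simp add: vi l.verts_EI r.verts_EI)
  show ?thesis
  proof (cases "v = w")
    case True
    then have i: "i \<in> {1..n}" using x vi by (simp add: l.verts_EI)
    have "ER.alg.null_eq (ER.path_poly ((w, i), [(f k, i)])) (pe (f k, i))" if "k \<in> {1..N}" for k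
      using ER.path_poly_arc[of "(f k, i)"] f_arc[OF that] i by (simp add: r.arcs_EI r.tail_EI)
    then have "ER.alg.null_eq
        (\<Sum>k\<in>{1..N}. ER.path_poly ((w, i), [(f k, i)]) * poly_star (ER.path_poly ((w, i), [(f k, i)])))
        (\<Sum>k\<in>{1..N}. pe (f k, i) * poly_star (pe (f k, i)))"
      by (intro ER.alg.null_eq_sum ER.alg.null_eq_mult ER.alg.null_eq_st)
    also have "ER.alg.null_eq \<dots> (pv (w, i))"
      by (rule ER.alg.null_eq_sym[OF pv_w[OF i]])
    finally show ?thesis
      by (simp add: vi True sum.reindex inj_on_def path_map_vpath)
  next
    case False
    then show ?thesis
      using vert_poly[OF xR, of 1] vi by simp
  qed
qed

lemma sum_arc_\<xi>:
  assumes e: "(e, i) \<in> arcs EL" "head E e \<noteq> w"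
  shows "ER.alg.null_eq (\<Sum>x\<in>Pair (e, i) ` {1..m (head EL (e, i))}.
    ER.gis_poly (\<xi> (Some (epath EH x, vpath (head EH x))))) (pe (e, i))"
proof -
  have eR: "(e, i) \<in> arcs ER" using e(1) unfolding l.arcs_EI r.arcs_EI .
  have hd: "head ER (e, i) = (head E e, 1)" using e(2) by (simp add: r.head_EI)
  \<comment> \<open>An arc leaving \<open>w\<close> comes from \<open>base\<close> of its source,
    any other from \<open>ext\<close>; the resulting path is the same.\<close>
  have map: "path_map (epath EH ((e, i), 1)) = ((tail E e, i), [(e, i)])"
  proof (cases "tail E e = w")
    case True
    then have i: "i \<in> {1..n}" and "e \<in> arcs E" using e(1) by (auto simp: l.arcs_EI)
    then obtain k where "k \<in> {1..N}" "e = f k" using True f_cases by blast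
    then show ?thesis using path_map_epath_w[of k i 1] i True by simp
  next
    case False
    then show ?thesis using e by (simp add: path_map_epath l.arcs_EI)
  qed
  have "ER.alg.null_eq (ER.path_poly ((tail E e, i), [(e, i)]) * poly_star (pv (head E e, 1)))
      (pe (e, i) * pv (head E e, 1))"
    using ER.path_poly_arc[OF eR] ER.star_pv[OF ER.head_in_verts[OF eR]] unfolding hd
    by (intro ER.alg.null_eq_mult) (simp_all add: r.tail_EI)
  also have "ER.alg.null_eq \<dots> (pe (e, i))"
    using ER.pe_pv_head[OF eR] by (simp add: hd)
  finally show ?thesis
    using e(2) by (simp add: l.head_EI head_EH map path_map_vpath ER.path_poly_def)
qed

text \<open>Copy \<open>k\<close> of \<open>e\<close> contributes \<open>e\<close>, then
  \<open>f k\<close> in copy \<open>r.idx e\<close>, then the adjoint of \<open>f k\<close> in copy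
  \<open>l.idx e\<close>. These are the summands in the definition of the balanced in-split
  homomorphism.\<close>

lemma sum_arc_w_\<xi>:
  assumes e: "e \<in> arcs E" "head E e = w"
  shows "ER.alg.null_eq (\<Sum>x\<in>Pair (e, 1) ` {1..m (head EL (e, 1))}.
    ER.gis_poly (\<xi> (Some (epath EH x, vpath (head EH x)))))
    (pe (e, 1) * (\<Sum>g\<in>out_arcs E w. pe (g, r.idx e) * poly_star (pe (g, l.idx e))))"
proof -
  have tl: "tail E e \<noteq> w" using e no_loop by blast
  have "ER.alg.null_eq (ER.path_poly ((w, l.idx e), [(f k, l.idx e)])) (pe (f k, l.idx e))"
    if "k \<in> {1..N}" for k
    using ER.path_poly_arc[of "(f k, l.idx e)"] f_arc[OF that] l.idx[OF e]
    by (simp add: r.arcs_EI r.tail_EI)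
  then have "ER.alg.null_eq
      (\<Sum>k\<in>{1..N}. ER.path_poly (path_map (epath EH ((e, 1), k))) *
        poly_star (ER.path_poly ((w, l.idx e), [(f k, l.idx e)])))
      (\<Sum>k\<in>{1..N}. pe (e, 1) * pe (f k, r.idx e) * poly_star (pe (f k, l.idx e)))"
    by (intro ER.alg.null_eq_sum ER.alg.null_eq_mult ER.alg.null_eq_st arc_arc_poly[OF e(1) tl e(2)])
  also have "\<dots> = pe (e, 1) * (\<Sum>g\<in>out_arcs E w. pe (g, r.idx e) * poly_star (pe (g, l.idx e)))"
    by (simp add: sum_f[symmetric] sum_distrib_left mult.assoc)
  finally show ?thesis
    using e(2) by (simp add: l.head_EI head_EH sum.reindex inj_on_def path_map_vpath)
qed

text \<open>By \<open>star_hom_eqI\<close> it is enough to compare generators. There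
  \<open>\<gamma>\<close> gives the sum over the fiber, and the sums of the images under
  \<open>\<Xi>\<close> are those evaluated just before.\<close>

lemma decomposition:
  assumes \<Phi>: "is_balanced_in_split_hom E w n L R \<Phi>"
    and \<gamma>: "is_pullback EH EL multi_out_split_hom \<gamma>"
    and \<Xi>: "is_pushforward EH ER \<xi> \<Xi>"
    and a: "a \<in> carrier (graph_cstar EL)"
  shows "\<Phi> a = \<Xi> (\<gamma> a)"
proof -
  interpret LR: graph_algebra_pair EL ER
    using l.wf_digraph_EI r.wf_digraph_EI by (simp add: graph_algebra_pair_def graph_algebra_def)
  interpret HR: graph_algebra_pair EH ER
    using hat.wf_digraph_split r.wf_digraph_EI by (simp add: graph_algebra_pair_def graph_algebra_def)
  have \<Xi>_hom: "star_hom EH.alg.C ER.alg.C \<Xi>"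
    using \<Xi> by (simp add: is_pushforward_def EH.graph_cstar_eq ER.graph_cstar_eq)
  have vert: "\<Xi> (\<gamma> (SV EL x)) = SV ER x" if x: "x \<in> verts EL" for x
  proof -
    let ?g = "\<lambda>u. ER.gis_poly (\<xi> (Some (vpath u, vpath u)))"
    have u: "u \<in> verts EH" if "u \<in> Pair x ` {1..m x}" for u
      using that x by (auto simp: hat.verts_split)
    have car: "\<xi> (Some (vpath u, vpath u)) \<in> gis_carrier ER" if "u \<in> verts EH" for u
      using that by (intro \<xi>_carrier) (simp add: vpath_def EH.gis_carrier_iff EH.awalk_Nil_iff)
    have 1: "\<gamma> (SV EL x) = csum EH.alg.C (SV EH) (Pair x ` {1..m x})"
      using \<gamma> x by (simp add: is_pullback_def hat.vert_fiber EH.graph_cstar_eq)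
    have 2: "\<Xi> (csum EH.alg.C (SV EH) (Pair x ` {1..m x})) = ER.alg.cls (sum ?g (Pair x ` {1..m x}))"
    proof (rule HR.alg.star_hom_csum[OF \<Xi>_hom])
      fix u assume "u \<in> Pair x ` {1..m x}"
      from u[OF this] show "\<Xi> (SV EH u) = ER.alg.cls (?g u)" "pv u \<in> EH.alg.F"
        "?g u \<in> ER.alg.F" "SV EH u = EH.alg.cls (pv u)"
        using \<Xi> car by (simp_all add: is_pushforward_def ER.S_gis_eq EH.SV_eq del: \<xi>_simps)
    qed simp
    show ?thesis
      unfolding 1 2 ER.SV_eq by (rule ER.alg.cls_eqI[OF sum_vert_\<xi>[OF x]])
  qed
  have arc: "\<Xi> (\<gamma> (SE EL y)) = ER.alg.cls (\<Sum>x\<in>Pair y ` {1..m (head EL y)}.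
      ER.gis_poly (\<xi> (Some (epath EH x, vpath (head EH x)))))" if y: "y \<in> arcs EL" for y
  proof -
    let ?g = "\<lambda>x. ER.gis_poly (\<xi> (Some (epath EH x, vpath (head EH x))))"
    have x: "x \<in> arcs EH" if "x \<in> Pair y ` {1..m (head EL y)}" for x
      using that y by (auto simp: hat.arcs_split)
    have car: "\<xi> (Some (epath EH x, vpath (head EH x))) \<in> gis_carrier ER" if "x \<in> arcs EH" for x
      using that by (intro \<xi>_carrier) (simp add: vpath_def epath_def EH.gis_carrier_iff EH.awalk_simps)
    have 1: "\<gamma> (SE EL y) = csum EH.alg.C (SE EH) (Pair y ` {1..m (head EL y)})"
      using \<gamma> y by (simp add: is_pullback_def hat.arc_fiber EH.graph_cstar_eq)
    have 2: "\<Xi> (csum EH.alg.C (SE EH) (Pair y ` {1..m (head EL y)})) =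
        ER.alg.cls (sum ?g (Pair y ` {1..m (head EL y)}))"
    proof (rule HR.alg.star_hom_csum[OF \<Xi>_hom])
      fix u assume "u \<in> Pair y ` {1..m (head EL y)}"
      from x[OF this] show "\<Xi> (SE EH u) = ER.alg.cls (?g u)" "pe u \<in> EH.alg.F"
        "?g u \<in> ER.alg.F" "SE EH u = EH.alg.cls (pe u)"
        using \<Xi> car by (simp_all add: is_pushforward_def ER.S_gis_eq EH.SE_eq del: \<xi>_simps)
    qed simp
    show ?thesis unfolding 1 2 ..
  qed
  show ?thesis
  proof (rule LR.star_hom_eqI[OF _ _ _ _ a])
    show "star_hom (graph_cstar EL) (graph_cstar ER) \<Phi>"
      using \<Phi> by (simp add: is_balanced_in_split_hom_def Let_def)
    show "star_hom (graph_cstar EL) (graph_cstar ER) (\<lambda>a. \<Xi> (\<gamma> a))"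
      using \<gamma> \<Xi> by (auto simp: is_pullback_def is_pushforward_def intro: star_hom_comp)
  next
    fix x assume "x \<in> verts EL"
    then show "\<Phi> (SV EL x) = \<Xi> (\<gamma> (SV EL x))"
      using \<Phi> vert by (simp add: is_balanced_in_split_hom_def Let_def)
  next
    fix y assume y: "y \<in> arcs EL"
    obtain e i where ei: "y = (e, i)" by (cases y)
    show "\<Phi> (SE EL y) = \<Xi> (\<gamma> (SE EL y))"
    proof (cases "head E e = w")
      case False
      have "\<Phi> (SE EL y) = SE ER y"
        using \<Phi> y False by (simp add: is_balanced_in_split_hom_def Let_def ei)
      then show ?thesis
        using ER.alg.cls_eqI[OF sum_arc_\<xi>[of e i]] y False arc[OF y] by (simp add: ei ER.SE_eq)
    next
      case True
      let ?j = "l.idx e" and ?k = "r.idx e"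
      have e1: "e \<in> arcs E" using y by (simp add: ei l.arcs_EI)
      then have tl: "tail E e \<noteq> w" using no_loop True by blast
      have e: "e \<in> arcs E" "tail E e \<noteq> w" "i = 1"
        using e1 tl y by (simp_all add: ei l.arcs_EI)
      \<comment> \<open>The sets of the two partitions that contain \<open>e\<close>; with these
        indices the defining equation for arcs into \<open>w\<close> can be instantiated.\<close>
      have j: "?j \<in> {1..n}" "e \<in> L ?j" and k: "?k \<in> {1..n}" "e \<in> R ?k"
        using l.idx[OF e(1) True] r.idx[OF e(1) True] by auto
      have cl: "(e, 1) \<in> arcs ER" "\<And>g. g \<in> out_arcs E w \<Longrightarrow> (g, ?j) \<in> arcs ER"
        "\<And>g. g \<in> out_arcs E w \<Longrightarrow> (g, ?k) \<in> arcs ER"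
        using e j k by (auto simp: r.arcs_EI)
      have fin: "finite (out_arcs E w)" using w_reg by (simp add: reg_def)
      have sum: "csum ER.alg.C (\<lambda>g. cmult ER.alg.C (SE ER (g, ?k)) (cstar ER.alg.C (SE ER (g, ?j)))) (out_arcs E w) =
          ER.alg.cls (\<Sum>g\<in>out_arcs E w. pe (g, ?k) * poly_star (pe (g, ?j)))"
        using cl by (intro ER.alg.csum_cong_cls fin) (simp_all add: ER.SE_eq ER.alg.cls_star ER.alg.cls_mult)
      have sum_cl: "(\<Sum>g\<in>out_arcs E w. pe (g, ?k) * poly_star (pe (g, ?j))) \<in> ER.alg.F"
        using cl by (intro free.sum_closed) simp
      have "\<Phi> (SE EL (e, 1)) = cmult ER.alg.C (SE ER (e, 1)) (csum ER.alg.C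
          (\<lambda>g. cmult ER.alg.C (SE ER (g, ?k)) (cstar ER.alg.C (SE ER (g, ?j)))) (out_arcs E w))"
        using \<Phi> y True j k e unfolding is_balanced_in_split_hom_def Let_def ER.graph_cstar_eq ei
        by blast
      also have "\<dots> = ER.alg.cls (pe (e, 1) * (\<Sum>g\<in>out_arcs E w. pe (g, ?k) * poly_star (pe (g, ?j))))"
        unfolding sum unfolding ER.SE_eq using cl(1) sum_cl by (intro ER.alg.cls_mult) simp_all
      also have "\<dots> = \<Xi> (\<gamma> (SE EL (e, 1)))"
        using ER.alg.cls_eqI[OF sum_arc_w_\<xi>[OF e(1) True]] arc[of "(e, 1)"] y ei e(3) by simp
      finally show ?thesis using ei e(3) by simp
    qed
  qed
qed

lemma pushforward_\<xi>_exists: "\<exists>\<Xi>. is_pushforward EH ER \<xi> \<Xi>"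
proof -
  interpret HR: graph_algebra_pair EH ER
    using hat.wf_digraph_split r.wf_digraph_EI by (simp add: graph_algebra_pair_def graph_algebra_def)
  show ?thesis
    by (rule HR.pushforward_exists[OF ext_path_hom_\<xi> \<xi>_inv reg_sum_\<xi>])
qed

end

theorem corollary5p30:
  fixes E :: "('v, 'e) pre_digraph" and w :: 'v and n :: nat and L R :: "nat \<Rightarrow> 'e set"
    and \<Phi> :: "('v \<times> nat, 'e \<times> nat) graph_gen univ_elt \<Rightarrow> ('v \<times> nat, 'e \<times> nat) graph_gen univ_elt"
  assumes "wf_digraph E"
    and "w \<in> reg E"
    and "\<not> (\<exists>e\<in>arcs E. tail E e = w \<and> head E e = w)"
    and "in_partition E w n L"
    and "in_partition E w n R"
    and "is_balanced_in_split_hom E w n L R \<Phi>"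
  shows "\<exists>m P \<xi> \<gamma> \<Xi>.
           multi_out_partition (in_split E w n L) m P \<and>
           regular_ext_path_hom (multi_out_split (in_split E w n L) m P) (in_split E w n R) \<xi> \<and>
           is_pullback (multi_out_split (in_split E w n L) m P) (in_split E w n L)
             multi_out_split_hom \<gamma> \<and>
           is_pushforward (multi_out_split (in_split E w n L) m P) (in_split E w n R) \<xi> \<Xi> \<and>
           (\<forall>a\<in>carrier (graph_cstar (in_split E w n L)). \<Phi> a = \<Xi> (\<gamma> a))"
proof -
  interpret balanced_in_split E w n L R
    using assms(1-5)
    by (auto simp: balanced_in_split_def balanced_in_split_axioms_def in_splitting_def
        in_splitting_axioms_def)
  obtain \<gamma> where "is_pullback EH EL multi_out_split_hom \<gamma>"
    using hat.pullback_exists by blast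
  moreover obtain \<Xi> where "is_pushforward EH ER \<xi> \<Xi>"
    using pushforward_\<xi>_exists by blast
  ultimately show ?thesis
    using multi_out_partition_EL regular_\<xi> decomposition[OF assms(6)] by blast
qed

end
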